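(* Let $w\in\mathcal L$. (1) The elements $\beta_{\mathbf t}$, $\mathbf t\in\mathcal D_w$, constitute a $\mathbb Z$-basis of $\mathcal B_w$. (2) If $k=\ell_T(w)\ge 1$, the elements $z_{\mathbf t}$, $\mathbf t\in\mathcal D_w$, form a $\mathbb Z$-basis of $\widetilde H_{k-2}(e,w)$. (3) If $k=\ell_T(w)\ge 1$, the $\mathbb Z$-linear map $d:\mathcal B_w\to\widetilde H_{k-2}(e,w)$, $\beta_{\mathbf t}\mapsto z_{\mathbf t}$ ($\mathbf t\in \mathrm{Rex}_T(w)$), is an isomorphism of free abelian groups.
   Context: Let $W$ be a finite Coxeter group of rank $n\ge1$ acting faithfully as a reflection group on Euclidean space $\mathbb R^n$, $T$ its set of reflections, $\ell_T(w)$ the minimal number of reflections in a factorisation of $w$ into reflections (such a shortest factorisation is called $T$-reduced), and $u^w:=w^{-1}uw$. The absolute order on $W$ is: $u\le v$ iff $\ell_T(v)=\ell_T(u)+\ell_T(u^{-1}v)$. Write the simple roots as $\Pi=\Pi_1\sqcup\Pi_2$ with the roots in each $\Pi_j$ mutually orthogonal, and let $\gamma=(\prod_{\alpha\in\Pi_1}t_\alpha)(\prod_{\alpha\in\Pi_2}t_\alpha)$, a Coxeter element ($t_\alpha$ is the reflection in $\alpha$). The noncrossing partition lattice is $\mathcal L=[e,\gamma]=\{w: w\le\gamma\}$, ranked by $\ell_T$; $\mathcal L_k=\{w\in\mathcal L:\ell_T(w)=k\}$. Total order $\preceq$ on $T$: for $W$ irreducible with Coxeter number $h$ (order of $\gamma$),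 write $\Pi_1=\{\alpha_{i_1},\dots,\alpha_{i_l}\}$, $\Pi_2=\{\alpha_{i_{l+1}},\dots,\alpha_{i_n}\}$; the positive roots are $\rho_k=\alpha_{i_k}$ for $1\le k\le l$, $\rho_k=-\gamma(\alpha_{i_k})$ for $l+1\le k\le n$, $\rho_k=\gamma(\rho_{k-n})$ for $n+1\le k\le nh/2$, and $t_{\rho_1}\prec t_{\rho_2}\prec\dots\prec t_{\rho_{nh/2}}$. For $W$ reducible, $T$ is the disjoint union of the sets of reflections of the irreducible components, and $\preceq$ is any total order on $T$ which, on the set of reflections of each irreducible component $W'$ (of rank $n'$, with simple roots $\Pi'\subseteq\Pi$, $\Pi'_j=\Pi_j\cap\Pi'$, and Coxeter element $\gamma'=(\prod_{\alpha\in\Pi'_1}t_\alpha)(\prod_{\alpha\in\Pi'_2}t_\alpha)$ of order $h'$), restricts to $t_{\rho'_1}\prec t_{\rho'_2}\prec\dots\prec t_{\rho'_{n'h'/2}}$, where, writing $\Pi'_1=\{\alpha'_1,\dots,\alpha'_{l'}\}$ and $\Pi'_2=\{\alpha'_{l'+1},\dots,\alpha'_{n'}\}$, one puts $\rho'_k=\alpha'_k$ for $1\le k\le l'$, $\rho'_k=-\gamma'(\alpha'_k)$ for $l'+1\le k\le n'$, and $\rho'_k=\gamma'(\rho'_{k-n'})$ for $n'+1\le k\le n'h'/2$. For $w\in\mathcal L_k$, $\mathrm{Rex}_T(w)$ is the set of sequences $(t_1,\dots,t_k)\in T^k$ with $w=t_1\cdots t_k$ ($T$-reduced); for $w=e$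 it consists of the empty sequence $\emptyset$. $C_{k-1}(w)$ is the free abelian group on $\mathrm{Rex}_T(w)$ ($C_{-1}(e)=\mathbb Z$) and $C_{k-1}=\bigoplus_{w\in\mathcal L_k}C_{k-1}(w)$. The braid group $B_k$ (standard generators $\sigma_1,\dots,\sigma_{k-1}$) acts on $C_{k-1}(w)$ by the Hurwitz action $\sigma_i.(t_1,\dots,t_k)=(t_1,\dots,t_{i-1},t_{i+1},t_i^{t_{i+1}},t_{i+2},\dots,t_k)$. For $\pi\in\mathrm{Sym}_k$ with reduced expression $\pi=s_{i_1}\cdots s_{i_p}$, $s_i=(i,i+1)$, put $\underline\pi=\sigma_{i_1}\cdots\sigma_{i_p}\in B_k$. For $\mathbf t\in\mathrm{Rex}_T(w)$ let $\beta_{\mathbf t}=\sum_{\pi\in\mathrm{Sym}_k}\mathrm{sgn}(\pi)\,\underline\pi.\mathbf t\in C_{k-1}(w)$, with $\beta_{(t)}=(t)$ and $\beta_\emptyset=1$. $\mathcal B_w\subseteq C_{k-1}(w)$ is the subgroup spanned by all $\beta_{\mathbf t}$, $\mathbf t\in\mathrm{Rex}_T(w)$ ($\mathcal B_e=\mathbb Z$). The linear truncation $d:C_{k-1}\to C_{k-2}$ is $d(t_1,\dots,t_k)=(t_1,\dots,t_{k-1})$ for $k\ge2$ and $d(t)=1$ for $k=1$; $z_{\mathbf t}:=d(\beta_{\mathbf t})$. $\mathcal D_w$ is the set of $(t_1,\dots,t_k)\in\mathrm{Rex}_T(w)$ with $t_1\succ t_2\succ\dots\succ t_k$ ($\mathcal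 D_e=\{\emptyset\}$). $\widetilde H_{k-2}(e,w)$ is the top reduced integral simplicial homology of the order complex of the open interval $(e,w)$ of $\mathcal L$ ($\widetilde H_{-1}(\emptyset)=\mathbb Z$). It is a subgroup of the group of top-dimensional chains, where the maximal chain $t_1<t_1t_2<\dots<t_1\cdots t_{k-1}$ of $(e,w)$ is identified with the sequence $(t_1,\dots,t_{k-1})$. *)

theory Defs
  imports
    "HOL-Analysis.Analysis"
    "HOL-Algebra.Free_Abelian_Groups"
    "HOL-Combinatorics.Permutations"
begin

section \<open>Finite reflection groups\<close>

text \<open>
  Group elements are maps of the ambient Euclidean space and the group product is composition,
  so that a product \<open>t\<^sub>1 \<cdots> t\<^sub>k\<close> acts on vectors from the left.
\<close>

definition reflect :: "'a::euclidean_space \<Rightarrow> 'a \<Rightarrow> 'a" where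
  "reflect a x = x - (2 * (x \<bullet> a) / (a \<bullet> a)) *\<^sub>R a"

definition is_reflection :: "('a::euclidean_space \<Rightarrow> 'a) \<Rightarrow> bool" where
  "is_reflection f \<longleftrightarrow> (\<exists>a. a \<noteq> 0 \<and> f = reflect a)"

definition prod_of :: "('a \<Rightarrow> 'a) list \<Rightarrow> 'a \<Rightarrow> 'a" where
  "prod_of fs = foldr (\<circ>) fs id"

text \<open>For a set \<open>S\<close> of involutions, such as reflections, the monoid generated by \<open>S\<close> is the
  group generated by \<open>S\<close>; the definition is only used in this situation.\<close>

definition generated_by :: "('a \<Rightarrow> 'a) set \<Rightarrow> ('a \<Rightarrow> 'a) set" where
  "generated_by S = {prod_of fs | fs. set fs \<subseteq> S}"

definition reflections :: "('a::euclidean_space \<Rightarrow> 'a) set \<Rightarrow> ('a \<Rightarrow> 'a) set" where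
  "reflections W = {t \<in> W. is_reflection t}"

definition finite_reflection_group :: "('a::euclidean_space \<Rightarrow> 'a) set \<Rightarrow> bool" where
  "finite_reflection_group W \<longleftrightarrow> finite W \<and> W = generated_by (reflections W)"

text \<open>Roots may have arbitrary lengths, subject to \<open>W\<close>-invariance; the root system need not be
  crystallographic.\<close>

definition root_system_of ::
  "('a::euclidean_space \<Rightarrow> 'a) set \<Rightarrow> 'a set \<Rightarrow> bool" where
  "root_system_of W \<Phi> \<longleftrightarrow>
     finite \<Phi> \<and> 0 \<notin> \<Phi> \<and>
     (\<forall>a\<in>\<Phi>. \<forall>c. c *\<^sub>R a \<in> \<Phi> \<longleftrightarrow> c = 1 \<or> c = - 1) \<and>
     (\<forall>w\<in>W. w ` \<Phi> \<subseteq> \<Phi>) \<and>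
     reflect ` \<Phi> = reflections W"

definition simple_system :: "'a::euclidean_space set \<Rightarrow> 'a set \<Rightarrow> bool" where
  "simple_system \<Phi> \<Delta> \<longleftrightarrow>
     \<Delta> \<subseteq> \<Phi> \<and> independent \<Delta> \<and>
     (\<forall>b\<in>\<Phi>. \<exists>c. b = (\<Sum>a\<in>\<Delta>. c a *\<^sub>R a) \<and> ((\<forall>a\<in>\<Delta>. c a \<ge> 0) \<or> (\<forall>a\<in>\<Delta>. c a \<le> 0)))"


section \<open>Absolute order and noncrossing partitions\<close>

definition abs_length :: "('a::euclidean_space \<Rightarrow> 'a) set \<Rightarrow> ('a \<Rightarrow> 'a) \<Rightarrow> nat" where
  "abs_length W w = (LEAST k. \<exists>ts. set ts \<subseteq> reflections W \<and> length ts = k \<and> prod_of ts = w)"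

definition abs_le ::
  "('a::euclidean_space \<Rightarrow> 'a) set \<Rightarrow> ('a \<Rightarrow> 'a) \<Rightarrow> ('a \<Rightarrow> 'a) \<Rightarrow> bool" where
  "abs_le W u v \<longleftrightarrow> abs_length W v = abs_length W u + abs_length W (inv_into UNIV u \<circ> v)"

definition abs_less ::
  "('a::euclidean_space \<Rightarrow> 'a) set \<Rightarrow> ('a \<Rightarrow> 'a) \<Rightarrow> ('a \<Rightarrow> 'a) \<Rightarrow> bool" where
  "abs_less W u v \<longleftrightarrow> abs_le W u v \<and> u \<noteq> v"

definition coxeter_element :: "'a::euclidean_space list \<Rightarrow> 'a list \<Rightarrow> 'a \<Rightarrow> 'a" where
  "coxeter_element as bs = prod_of (map reflect as) \<circ> prod_of (map reflect bs)"

definition noncrossing ::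
  "('a::euclidean_space \<Rightarrow> 'a) set \<Rightarrow> ('a \<Rightarrow> 'a) \<Rightarrow> ('a \<Rightarrow> 'a) set" where
  "noncrossing W \<gamma> = {w \<in> W. abs_le W w \<gamma>}"

definition open_interval ::
  "('a::euclidean_space \<Rightarrow> 'a) set \<Rightarrow> ('a \<Rightarrow> 'a) \<Rightarrow> ('a \<Rightarrow> 'a) \<Rightarrow> ('a \<Rightarrow> 'a) set" where
  "open_interval W \<gamma> w = {u \<in> noncrossing W \<gamma>. abs_less W id u \<and> abs_less W u w}"


section \<open>The total order on reflections\<close>

text \<open>Here \<open>as\<close> and \<open>bs\<close> enumerate the two halves of the simple roots of an irreducible
  component. Indices start at 0, so \<open>bip_root as bs k\<close> is the root usually called
  \<open>\<rho>\<^bsub>k+1\<^esub>\<close>. The value in the degenerate case of no simple roots is irrelevant.\<close>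

function bip_root :: "'a::euclidean_space list \<Rightarrow> 'a list \<Rightarrow> nat \<Rightarrow> 'a" where
  "bip_root as bs k =
     (let l = length as; n = length as + length bs; \<gamma> = coxeter_element as bs in
      if k < l then as ! k
      else if k < n then - \<gamma> (bs ! (k - l))
      else if n = 0 then 0
      else \<gamma> (bip_root as bs (k - n)))"
  by auto
termination
proof (relation "Wellfounded.measure (\<lambda>(as, bs, k). k)", goal_cases)
  case 1
  then show ?case by simp
next
  case (2 as bs k)
  then show ?case by (cases "length as + length bs") auto
qed

declare bip_root.simps [simp del]

definition coxeter_number :: "'a::euclidean_space list \<Rightarrow> 'a list \<Rightarrow> nat" where
  "coxeter_number as bs = (LEAST h. 0 < h \<and> coxeter_element as bs ^^ h = id)"

text \<open>The vertex sets of the connected components of the Coxeter graph: two distinct simple roots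
  are adjacent iff they are not orthogonal.\<close>

definition irreducible_components :: "'a::euclidean_space set \<Rightarrow> 'a set set" where
  "irreducible_components \<Delta> = \<Delta> // {(a, b). a \<in> \<Delta> \<and> b \<in> \<Delta> \<and> a \<bullet> b \<noteq> 0}\<^sup>*"

text \<open>If the group is irreducible then \<open>C = set as \<union> set bs\<close> is the only component and the
  order is completely determined up to the choice of the enumerations. The strict inequality
  \<open>2 * j < n * h\<close> bounds the 0-based index by \<open>j + 1 \<le> n h / 2\<close>.\<close>

definition admissible_order ::
  "('a::euclidean_space \<Rightarrow> 'a) set \<Rightarrow> 'a list \<Rightarrow> 'a list \<Rightarrow>
   (('a \<Rightarrow> 'a) \<times> ('a \<Rightarrow> 'a)) set \<Rightarrow> bool" where
  "admissible_order W as bs r \<longleftrightarrow>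
     linear_order_on (reflections W) r \<and>
     (\<forall>C \<in> irreducible_components (set as \<union> set bs).
        \<exists>as' bs'. distinct as' \<and> set as' = set as \<inter> C \<and>
                  distinct bs' \<and> set bs' = set bs \<inter> C \<and>
          (let T' = reflections (generated_by (reflect ` C)) in
           r \<inter> T' \<times> T' =
             {(reflect (bip_root as' bs' i), reflect (bip_root as' bs' j)) | i j.
                i \<le> j \<and> 2 * j < (length as' + length bs') * coxeter_number as' bs'}))"


section \<open>Reduced factorisations and the Hurwitz action\<close>

definition rex :: "('a::euclidean_space \<Rightarrow> 'a) set \<Rightarrow> ('a \<Rightarrow> 'a) \<Rightarrow> ('a \<Rightarrow> 'a) list set" where
  "rex W w = {ts. set ts \<subseteq> reflections W \<and> length ts = abs_length W w \<and> prod_of ts = w}"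

definition decreasing_rex ::
  "('a::euclidean_space \<Rightarrow> 'a) set \<Rightarrow> (('a \<Rightarrow> 'a) \<times> ('a \<Rightarrow> 'a)) set \<Rightarrow>
   ('a \<Rightarrow> 'a) \<Rightarrow> ('a \<Rightarrow> 'a) list set" where
  "decreasing_rex W r w = {ts \<in> rex W w. sorted_wrt (\<lambda>s t. (t, s) \<in> r \<and> t \<noteq> s) ts}"

text \<open>Action of the braid generator exchanging the entries at the 0-based positions \<open>i\<close> and
  \<open>i + 1\<close>; the entry \<open>t\<^sub>i\<close> is replaced by its conjugate under \<open>t\<^bsub>i+1\<^esub>\<close>.\<close>

definition hurwitz :: "nat \<Rightarrow> ('a \<Rightarrow> 'a) list \<Rightarrow> ('a \<Rightarrow> 'a) list" where
  "hurwitz i ts =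
     ts[i := ts ! Suc i, Suc i := inv_into UNIV (ts ! Suc i) \<circ> ts ! i \<circ> ts ! Suc i]"

definition expression_of :: "nat \<Rightarrow> (nat \<Rightarrow> nat) \<Rightarrow> nat list \<Rightarrow> bool" where
  "expression_of k p is \<longleftrightarrow>
     (\<forall>i\<in>set is. Suc i < k) \<and> p = foldr (\<circ>) (map (\<lambda>i. Transposition.transpose i (Suc i)) is) id"

definition reduced_expression :: "nat \<Rightarrow> (nat \<Rightarrow> nat) \<Rightarrow> nat list \<Rightarrow> bool" where
  "reduced_expression k p is \<longleftrightarrow>
     expression_of k p is \<and> (\<forall>js. expression_of k p js \<longrightarrow> length is \<le> length js)"

text \<open>The action of the positive braid lift of a permutation \<open>p\<close> of \<open>{..<k}\<close>. The generators
  \<open>hurwitz i\<close> satisfy the braid relations on sequences of group elements, so by Matsumoto's theorem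
  the result does not depend on the reduced expression that is chosen.\<close>

definition braid_lift_action ::
  "nat \<Rightarrow> (nat \<Rightarrow> nat) \<Rightarrow> ('a \<Rightarrow> 'a) list \<Rightarrow> ('a \<Rightarrow> 'a) list" where
  "braid_lift_action k p ts = foldr hurwitz (SOME is. reduced_expression k p is) ts"


section \<open>The elements \<open>\<beta>\<close> and the truncation map\<close>

text \<open>The free abelian groups \<open>C\<^bsub>k-1\<^esub>(w)\<close> are \<open>free_Abelian_group (rex W w)\<close>. All of them,
  and their direct sums over \<open>w\<close>, sit inside the finitely supported integer combinations of lists,
  the generator of \<open>C\<^bsub>-1\<^esub>(e) = \<int>\<close> being the empty list.\<close>

definition beta :: "('a \<Rightarrow> 'a) list \<Rightarrow> ('a \<Rightarrow> 'a) list \<Rightarrow>\<^sub>0 int" where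
  "beta ts =
     (\<Sum>p | p permutes {..<length ts}.
        frag_cmul (sign p) (frag_of (braid_lift_action (length ts) p ts)))"

definition beta_group ::
  "('a::euclidean_space \<Rightarrow> 'a) set \<Rightarrow> ('a \<Rightarrow> 'a) \<Rightarrow> (('a \<Rightarrow> 'a) list \<Rightarrow>\<^sub>0 int) monoid" where
  "beta_group W w = subgroup_generated (free_Abelian_group (rex W w)) (beta ` rex W w)"

definition truncation :: "('b list \<Rightarrow>\<^sub>0 int) \<Rightarrow> ('b list \<Rightarrow>\<^sub>0 int)" where
  "truncation = frag_extend (\<lambda>ts. frag_of (butlast ts))"

definition zeta :: "('a \<Rightarrow> 'a) list \<Rightarrow> ('a \<Rightarrow> 'a) list \<Rightarrow>\<^sub>0 int" where
  "zeta ts = truncation (beta ts)"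

text \<open>The indexed family \<open>b\<close> is a \<open>\<int>\<close>-basis of \<open>G\<close>: the formal finite integer combinations
  of the indices correspond bijectively to the elements of \<open>G\<close>.\<close>

definition int_basis :: "'i set \<Rightarrow> ('i \<Rightarrow> ('b \<Rightarrow>\<^sub>0 int)) \<Rightarrow> ('b \<Rightarrow>\<^sub>0 int) set \<Rightarrow> bool" where
  "int_basis I b G \<longleftrightarrow> bij_betw (frag_extend b) {c. Poly_Mapping.keys c \<subseteq> I} G"


section \<open>Homology of order complexes\<close>

text \<open>Simplices of the order complex of \<open>(P, lt)\<close> with \<open>j\<close> vertices, i.e. of dimension
  \<open>j - 1\<close>, written as increasing lists. The empty simplex is included, so that the
  complex below computes reduced homology.\<close>

definition order_simplices :: "('b \<Rightarrow> 'b \<Rightarrow> bool) \<Rightarrow> 'b set \<Rightarrow> nat \<Rightarrow> 'b list set" where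
  "order_simplices lt P j = {us. set us \<subseteq> P \<and> length us = j \<and> sorted_wrt lt us}"

definition simplicial_boundary :: "('b list \<Rightarrow>\<^sub>0 int) \<Rightarrow> ('b list \<Rightarrow>\<^sub>0 int)" where
  "simplicial_boundary =
     frag_extend (\<lambda>us. \<Sum>i<length us. frag_cmul ((- 1) ^ i) (frag_of (take i us @ drop (Suc i) us)))"

definition reduced_cycles :: "('b \<Rightarrow> 'b \<Rightarrow> bool) \<Rightarrow> 'b set \<Rightarrow> nat \<Rightarrow> ('b list \<Rightarrow>\<^sub>0 int) set" where
  "reduced_cycles lt P j =
     {c. Poly_Mapping.keys c \<subseteq> order_simplices lt P j \<and> simplicial_boundary c = 0}"

definition reduced_boundaries :: "('b \<Rightarrow> 'b \<Rightarrow> bool) \<Rightarrow> 'b set \<Rightarrow> nat \<Rightarrow> ('b list \<Rightarrow>\<^sub>0 int) set" where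
  "reduced_boundaries lt P j =
     simplicial_boundary ` {c. Poly_Mapping.keys c \<subseteq> order_simplices lt P (Suc j)}"

text \<open>The top reduced homology of the open interval \<open>(e, w)\<close>, for \<open>w\<close> of absolute length
  \<open>k \<ge> 1\<close>, lives on simplices with \<open>k - 1\<close> vertices. There are no simplices with \<open>k\<close> vertices
  (lemma \<open>top_boundaries_trivial\<close> below), so homology is the group of cycles.\<close>

definition top_homology ::
  "('a::euclidean_space \<Rightarrow> 'a) set \<Rightarrow> ('a \<Rightarrow> 'a) \<Rightarrow> ('a \<Rightarrow> 'a) \<Rightarrow>
   (('a \<Rightarrow> 'a) list \<Rightarrow>\<^sub>0 int) monoid" where
  "top_homology W \<gamma> w =
     (let P = open_interval W \<gamma> w; j = abs_length W w - 1 in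
      subgroup_generated (free_Abelian_group (order_simplices (abs_less W) P j))
        (reduced_cycles (abs_less W) P j))"

text \<open>The identification of a sequence \<open>(t\<^sub>1, \<dots>, t\<^sub>m)\<close> with the chain
  \<open>t\<^sub>1 < t\<^sub>1t\<^sub>2 < \<dots> < t\<^sub>1\<cdots>t\<^sub>m\<close>, extended linearly.\<close>

definition chain_of :: "('a \<Rightarrow> 'a) list \<Rightarrow> ('a \<Rightarrow> 'a) list" where
  "chain_of ts = map (\<lambda>i. prod_of (take (Suc i) ts)) [0..<length ts]"

definition as_chains :: "(('a \<Rightarrow> 'a) list \<Rightarrow>\<^sub>0 int) \<Rightarrow> (('a \<Rightarrow> 'a) list \<Rightarrow>\<^sub>0 int)" where
  "as_chains = frag_extend (\<lambda>ts. frag_of (chain_of ts))"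


section \<open>Absence of simplices above the top dimension\<close>

lemma reflect_reflect: "reflect a (reflect a x) = x"
  by (cases "a = 0") (simp_all add: reflect_def inner_diff_left algebra_simps)

lemma reflection_involution: "t \<in> reflections W \<Longrightarrow> t \<circ> t = id"
  by (auto simp: reflections_def is_reflection_def reflect_reflect)

lemma prod_of_append: "prod_of (xs @ ys) = prod_of xs \<circ> prod_of ys"
  unfolding prod_of_def by (induction xs) (auto simp: fun_eq_iff)

lemma prod_of_rev:
  "set ts \<subseteq> reflections W \<Longrightarrow> prod_of (rev ts) \<circ> prod_of ts = id \<and> prod_of ts \<circ> prod_of (rev ts) = id"
proof (induction ts)
  case Nil
  then show ?case by (simp add: prod_of_def)
next
  case (Cons t ts)
  have t: "t (t x) = x" for x
    using reflection_involution[of t W] Cons.prems by (auto simp: fun_eq_iff)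
  have 1: "prod_of (rev ts) (prod_of ts x) = x" "prod_of ts (prod_of (rev ts) x) = x" for x
    using Cons by (auto simp: fun_eq_iff)
  have "prod_of (t # ts) = t \<circ> prod_of ts" "prod_of (rev (t # ts)) = prod_of (rev ts) \<circ> t"
    by (simp_all add: prod_of_append) (simp_all add: prod_of_def)
  then show ?case using t 1 by (auto simp: fun_eq_iff)
qed

lemma abs_less_imp_length_less:
  assumes "finite_reflection_group W" "u \<in> W" "v \<in> W" "abs_less W u v"
  shows "abs_length W u < abs_length W v"
proof -
  let ?x = "inv_into UNIV u \<circ> v"
  have W: "W = generated_by (reflections W)"
    using assms(1) by (simp add: finite_reflection_group_def)
  obtain us where us: "set us \<subseteq> reflections W" "u = prod_of us"
    using assms(2) W by (auto simp: generated_by_def)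
  obtain vs where vs: "set vs \<subseteq> reflections W" "v = prod_of vs"
    using assms(3) W by (auto simp: generated_by_def)
  have inv: "inv_into UNIV u = prod_of (rev us)"
    using prod_of_rev[OF us(1)] us(2) inv_unique_comp by metis
  have "prod_of (rev us @ vs) = ?x" "set (rev us @ vs) \<subseteq> reflections W"
    using us vs inv by (auto simp: prod_of_append)
  then have ex: "\<exists>k ts. set ts \<subseteq> reflections W \<and> length ts = k \<and> prod_of ts = ?x" by blast
  have "abs_length W ?x \<noteq> 0"
  proof
    assume "abs_length W ?x = 0"
    with LeastI_ex[OF ex] have "?x = id"
      unfolding abs_length_def by (auto simp: prod_of_def)
    then have "u = v"
      using prod_of_rev[OF us(1)] inv us(2) by (metis comp_assoc comp_id id_comp)
    with assms(4) show False by (simp add: abs_less_def)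
  qed
  with assms(4) show ?thesis by (simp add: abs_less_def abs_le_def)
qed

lemma no_simplices_above_top:
  assumes W: "finite_reflection_group W" and w: "w \<in> W" and k: "abs_length W w \<le> j" "1 \<le> j"
  shows "order_simplices (abs_less W) (open_interval W \<gamma> w) j = {}"
proof (rule ccontr)
  assume "\<not> ?thesis"
  then obtain us where us: "set us \<subseteq> open_interval W \<gamma> w" "length us = j" "sorted_wrt (abs_less W) us"
    by (auto simp: order_simplices_def)
  have id: "id \<in> W"
    using W unfolding finite_reflection_group_def generated_by_def
    by (metis (mono_tags, lifting) empty_set empty_subsetI foldr.simps(1) id_apply mem_Collect_eq prod_of_def)
  have in_W: "x \<in> W" "abs_less W id x" "abs_less W x w" if "x \<in> set us" for x
    using us(1) that by (auto simp: open_interval_def noncrossing_def)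
  have "sorted_wrt (\<lambda>u v. abs_length W u < abs_length W v) us"
    using us(3) by (rule sorted_wrt_mono_rel[rotated]) (use W in_W abs_less_imp_length_less in blast)
  then have "sorted_wrt (<) (map (abs_length W) us)"
    by (simp add: sorted_wrt_map)
  then have d: "distinct (map (abs_length W) us)"
    using strict_sorted_iff by blast
  have "set (map (abs_length W) us) \<subseteq> {1..<abs_length W w}"
  proof
    fix m assume "m \<in> set (map (abs_length W) us)"
    then obtain x where x: "x \<in> set us" "m = abs_length W x" by auto
    show "m \<in> {1..<abs_length W w}"
      using abs_less_imp_length_less[OF W id in_W(1) in_W(2), OF x(1) x(1)]
        abs_less_imp_length_less[OF W in_W(1) w in_W(3), OF x(1) x(1)] x(2) by simp
  qed
  then have "length us \<le> abs_length W w - 1"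
    using card_mono[of "{1..<abs_length W w}" "set (map (abs_length W) us)"] distinct_card[OF d]
    by simp
  with us(2) k show False by simp
qed

lemma top_boundaries_trivial:
  assumes "finite_reflection_group W" "w \<in> W" "1 \<le> abs_length W w"
  shows "reduced_boundaries (abs_less W) (open_interval W \<gamma> w) (abs_length W w - 1) = {0}"
proof -
  have "order_simplices (abs_less W) (open_interval W \<gamma> w) (Suc (abs_length W w - 1)) = {}"
    using no_simplices_above_top[OF assms(1,2)] assms(3) by simp
  then show ?thesis
    by (simp add: reduced_boundaries_def simplicial_boundary_def)
qed

end

theory Submission
  imports Defs
begin

text \<open>
  Truncation followed by the identification with chains is injective on the combinations of reduced
  factorizations of \<open>w\<close>, so everything reduces to one claim: the \<open>\<beta>\<close> of the decreasing
  factorizations form a basis of the group of those combinations that map to cycles.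
  Each \<open>\<beta>\<close> maps to a cycle, because the permutations \<open>p\<close> and \<open>s\<^sub>i p\<close> contribute chains that agree
  outside one vertex, with opposite signs. For a decreasing factorization \<open>ts\<close> all other terms
  of its \<open>\<beta>\<close> are lexicographically smaller than \<open>ts\<close>, and the lexicographically largest term of any
  cycle is decreasing; so the family is unitriangular and spans.

  The last fact needs only that an ascent \<open>(s, t)\<close> inside a reduced factorization of \<open>\<gamma>\<close> has the
  smallest first entry among all factorizations of \<open>s t\<close>. With the Wall form
  \<open>B x y = (1 - \<gamma>)\<^sup>-\<^sup>1 x \<bullet> y\<close>, the roots of \<open>s\<close> and \<open>t\<close> satisfy \<open>B \<alpha> \<beta> = 0\<close>, whereas the ordered roots
  satisfy \<open>B \<rho>\<^sub>i \<rho>\<^sub>j \<ge> 0\<close> and \<open>B \<rho>\<^sub>j \<rho>\<^sub>i \<le> 0\<close> for \<open>i < j\<close>; together these signs exclude a smaller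
  reflection in the plane of \<open>\<alpha>\<close> and \<open>\<beta>\<close>. The signs are the positivity of the roots \<open>\<rho>\<^sub>j\<close>, read off
  through \<open>\<gamma>\<close>-invariance of \<open>B\<close>.
\<close>

unbundle no m_inv_syntax

section \<open>Positive braid lifts of permutations\<close>

text \<open>The lift in \<open>beta\<close> is taken along an arbitrarily chosen reduced expression.
  A closed formula for its entries makes it tractable: at the first position that the permutation
  disturbs, the arriving entry is still unconjugated, which is why decreasing factorizations give
  leading terms. \<open>B\<close> vanishes on an earlier against a later root of a shortest
  factorization of \<open>\<gamma>\<close> because some nonzero vector is orthogonal to all the
  other roots once the earlier one has been moved to the front, and \<open>\<gamma>\<close>
  displaces that vector along this root alone. Positivity of the \<open>\<rho>\<close> needs the
  reflections in them to be distinct. This is extracted from the order itself: a repetition would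
  squeeze two consecutive reflections together, against antisymmetry. In the reducible case the
  order between components is arbitrary. A plane spanned by roots of two components contains, up to
  sign, only these two roots, so the comparison needed there is the given one.\<close>

definition inversions :: "nat \<Rightarrow> (nat \<Rightarrow> nat) \<Rightarrow> (nat \<times> nat) set" where
  "inversions k p = {(a, b). a < b \<and> b < k \<and> p b < p a}"

lemma finite_inversions: "finite (inversions k p)"
  by (rule finite_subset[of _ "{..<k} \<times> {..<k}"]) (auto simp: inversions_def)

abbreviation adj :: "nat \<Rightarrow> nat \<Rightarrow> nat" where
  "adj i \<equiv> Transposition.transpose i (Suc i)"

lemma adj_permutes: "Suc i < k \<Longrightarrow> adj i permutes {..<k}"
  by (rule permutes_swap_id) auto

lemma adj_less_iff:
  "u \<noteq> v \<Longrightarrow> {u, v} \<noteq> {i, Suc i} \<Longrightarrow> adj i u < adj i v \<longleftrightarrow> u < v"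
  unfolding Transposition.transpose_def by (auto split: if_splits)

text \<open>Composing with \<open>adj i\<close> on the left exchanges the values \<open>i\<close>
  and \<open>Suc i\<close>. These are compared with each other only at the two positions carrying
  them; every other comparison of values survives.\<close>

lemma inversions_adj:
  assumes p: "p permutes {..<k}" and i: "Suc i < k" and ab: "inv p i < inv p (Suc i)"
  shows "inversions k (adj i \<circ> p) = insert (inv p i, inv p (Suc i)) (inversions k p)"
    and "(inv p i, inv p (Suc i)) \<notin> inversions k p"
proof -
  have q: "inv p permutes {..<k}" by (rule permutes_inv[OF p])
  have pa: "p (inv p i) = i" and pb: "p (inv p (Suc i)) = Suc i"
    using permutes_inverses(1)[OF p] by simp_all
  have b: "inv p (Suc i) < k" using permutes_in_image[OF q, of "Suc i"] i by simp
  have inj: "inj p" using permutes_inj[OF p] .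
  show "inversions k (adj i \<circ> p) = insert (inv p i, inv p (Suc i)) (inversions k p)"
  proof -
    have "(x, y) \<in> inversions k (adj i \<circ> p) \<longleftrightarrow>
        (x, y) \<in> insert (inv p i, inv p (Suc i)) (inversions k p)" for x y
    proof (cases "x < y \<and> {p y, p x} = {i, Suc i}")
      case True
      then have "x = inv p i \<and> y = inv p (Suc i) \<or> x = inv p (Suc i) \<and> y = inv p i"
        by (metis doubleton_eq_iff inj inv_f_f)
      then have "x = inv p i" "y = inv p (Suc i)" using True ab by auto
      then show ?thesis using pa pb b ab by (simp add: inversions_def)
    next
      case False
      then have "x < y \<Longrightarrow> adj i (p y) < adj i (p x) \<longleftrightarrow> p y < p x"
        using adj_less_iff[of "p y" "p x" i] inj by (auto simp: inj_eq)
      moreover have "x < y \<Longrightarrow> (x, y) \<noteq> (inv p i, inv p (Suc i))"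
        using False pa pb by auto
      ultimately show ?thesis using ab by (auto simp: inversions_def)
    qed
    then show ?thesis by (simp add: set_eq_iff del: insert_iff)
  qed
  show "(inv p i, inv p (Suc i)) \<notin> inversions k p"
    using pa pb by (simp add: inversions_def)
qed

lemma card_inversions_adj:
  assumes "p permutes {..<k}" "Suc i < k" "inv p i < inv p (Suc i)"
  shows "card (inversions k (adj i \<circ> p)) = Suc (card (inversions k p))"
  using inversions_adj[OF assms] finite_inversions by simp

lemma inv_adj_comp:
  assumes "p permutes {..<k}"
  shows "inv (adj i \<circ> p) j = inv p (adj i j)"
proof -
  have "inv (adj i \<circ> p) = inv p \<circ> adj i"
    using o_inv_distrib[OF bij_transpose permutes_bij[OF assms]] by (metis inv_transpose_eq)
  then show ?thesis by simp
qed

text \<open>The preceding count applied to \<open>adj i \<circ> p\<close>, for which the two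
  positions are in increasing order; a second composition with \<open>adj i\<close> returns
  \<open>p\<close>.\<close>

lemma card_inversions_adj':
  assumes p: "p permutes {..<k}" and i: "Suc i < k" and ab: "\<not> inv p i < inv p (Suc i)"
  shows "card (inversions k p) = Suc (card (inversions k (adj i \<circ> p)))"
proof -
  have "inv p i \<noteq> inv p (Suc i)"
    using permutes_inj[OF permutes_inv[OF p]] by (metis injD n_not_Suc_n)
  then have "inv (adj i \<circ> p) i < inv (adj i \<circ> p) (Suc i)"
    using ab by (simp add: inv_adj_comp[OF p])
  moreover have "adj i \<circ> p permutes {..<k}" by (rule permutes_compose[OF p adj_permutes[OF i]])
  moreover have "adj i \<circ> (adj i \<circ> p) = p" by (simp add: comp_assoc[symmetric])
  ultimately show ?thesis using card_inversions_adj i by metis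
qed

lemma inversions_id: "inversions k (\<lambda>a. a) = {}"
  by (auto simp: inversions_def)

lemma expression_of_Nil: "expression_of k p [] \<longleftrightarrow> p = id"
  by (auto simp: expression_of_def)

lemma expression_of_Cons:
  "expression_of k p (i # is) \<longleftrightarrow> (\<exists>q. Suc i < k \<and> expression_of k q is \<and> p = adj i \<circ> q)"
  by (auto simp: expression_of_def)

text \<open>Each letter changes the number of inversions by exactly one, so an expression cannot be
  shorter than that number.\<close>

lemma expression_of_bound:
  "expression_of k p is \<Longrightarrow> p permutes {..<k} \<and> card (inversions k p) \<le> length is"
proof (induction "is" arbitrary: p)
  case Nil
  then show ?case by (simp add: expression_of_Nil inversions_id permutes_id[unfolded id_def] id_def)
next
  case (Cons i js)
  then obtain q where q: "Suc i < k" "expression_of k q js" "p = adj i \<circ> q"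
    by (auto simp: expression_of_Cons)
  with Cons.IH have IH: "q permutes {..<k}" "card (inversions k q) \<le> length js" by auto
  then have "card (inversions k p) \<le> Suc (card (inversions k q))"
    using q card_inversions_adj[of q k i] card_inversions_adj'[of q k i] by (cases "inv q i < inv q (Suc i)") auto
  moreover have "p permutes {..<k}"
    unfolding q(3) by (rule permutes_compose[OF IH(1) adj_permutes[OF q(1)]])
  ultimately show ?case using IH(2) by simp
qed

lemma ex_expression_of:
  "p permutes {..<k} \<Longrightarrow> \<exists>is. expression_of k p is \<and> length is = card (inversions k p)"
proof (induction "card (inversions k p)" arbitrary: p)
  case 0
  have q: "inv p permutes {..<k}" by (rule permutes_inv[OF 0(2)])
  have *: "inv p i < inv p (Suc i)" if "Suc i < k" for i
    using card_inversions_adj'[OF 0(2) that] 0(1) by fastforce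
  \<comment> \<open>Without inversions \<open>inv p\<close> increases along consecutive positions; a
    permutation of an initial segment that never falls below its argument is the identity.\<close>
  have **: "\<forall>i<k. i \<le> inv p i"
  proof (intro allI impI)
    fix i assume "i < k"
    then show "i \<le> inv p i"
    proof (induction i)
      case (Suc i)
      then show ?case using *[of i] by simp
    qed simp
  qed
  have "inv p i = i" for i
    using permutes_natset_ge[OF q] ** q permutes_not_in[OF q] by fastforce
  then have "p = id"
    using permutes_inv_inv[OF 0(2)] by (metis eq_id_iff inv_id)
  then show ?case using 0 by (intro exI[of _ "[]"]) (simp add: expression_of_Nil id_def)
next
  case (Suc n)
  \<comment> \<open>If \<open>inv p\<close> had no descent it would be increasing and leave no
    inversion. A descent supplies the first letter, and removing it lowers the count.\<close>
  have "\<exists>i. Suc i < k \<and> \<not> inv p i < inv p (Suc i)"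
  proof (rule ccontr)
    assume "\<not> ?thesis"
    then have *: "inv p i < inv p (Suc i)" if "Suc i < k" for i using that by blast
    have **: "inv p i < inv p j" if "i < j" "j < k" for i j
      using that
    proof (induction j)
      case (Suc j)
      then show ?case using *[of j] by (cases "i = j") auto
    qed simp
    have "inversions k p = {}"
    proof -
      have "\<not> (x < y \<and> y < k \<and> p y < p x)" for x y
      proof
        assume a: "x < y \<and> y < k \<and> p y < p x"
        then have "p x < k" using permutes_in_image[OF Suc(3), of x] by simp
        from **[of "p y" "p x"] a this show False
          using permutes_inverses(2)[OF Suc(3)] by simp
      qed
      then show ?thesis by (auto simp: inversions_def)
    qed
    then show False using Suc(2) by simp
  qed
  then obtain i where i: "Suc i < k" "\<not> inv p i < inv p (Suc i)" by blast
  have c: "card (inversions k p) = Suc (card (inversions k (adj i \<circ> p)))"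
    by (rule card_inversions_adj'[OF Suc(3) i])
  have "adj i \<circ> p permutes {..<k}" by (rule permutes_compose[OF Suc(3) adj_permutes[OF i(1)]])
  then obtain js where js: "expression_of k (adj i \<circ> p) js" "length js = card (inversions k (adj i \<circ> p))"
    using Suc(1)[of "adj i \<circ> p"] c Suc(2) by auto
  have "p = adj i \<circ> (adj i \<circ> p)" by (simp add: comp_assoc[symmetric])
  then show ?case using js c i by (intro exI[of _ "i # js"]) (auto simp: expression_of_Cons)
qed

lemma reduced_expression_bound: "reduced_expression k p is \<Longrightarrow> i \<in> set is \<Longrightarrow> Suc i < k"
  unfolding reduced_expression_def expression_of_def by blast

text \<open>The lower bound is attained, so minimality becomes a count of inversions. This controls
  the choice made in \<open>braid_lift_action\<close>.\<close>

lemma reduced_expression_iff: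
  assumes "p permutes {..<k}"
  shows "reduced_expression k p is \<longleftrightarrow> expression_of k p is \<and> length is = card (inversions k p)"
  using ex_expression_of[OF assms] expression_of_bound unfolding reduced_expression_def
  by (metis le_antisym)

section \<open>A closed formula for the positive lift\<close>

definition conj_by :: "('a \<Rightarrow> 'a) \<Rightarrow> ('a \<Rightarrow> 'a) \<Rightarrow> 'a \<Rightarrow> 'a" where
  "conj_by c t = inv c \<circ> t \<circ> c"

lemma prod_of_Nil [simp]: "prod_of [] = id"
  by (simp add: prod_of_def)

lemma prod_of_Cons [simp]: "prod_of (t # ts) = t \<circ> prod_of ts"
  by (simp add: prod_of_def)

lemma bij_prod_of: "(\<And>t. t \<in> set ts \<Longrightarrow> bij t) \<Longrightarrow> bij (prod_of ts)"
  by (induction ts) (auto intro: bij_comp)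

lemma conj_by_id [simp]: "conj_by id t = t"
  by (simp add: conj_by_def)

lemma comp_conj_by: "bij c \<Longrightarrow> c \<circ> conj_by c t = t \<circ> c"
  by (simp add: conj_by_def fun_eq_iff bij_is_surj surj_f_inv_f)

lemma conj_by_comp: "bij c \<Longrightarrow> bij d \<Longrightarrow> conj_by (c \<circ> d) t = conj_by d (conj_by c t)"
  by (simp add: conj_by_def o_inv_distrib comp_assoc)

text \<open>In the positive lift of \<open>p\<close>, the strand starting at position \<open>a\<close> passes exactly the strands
  \<open>m > a\<close> with \<open>p m < p a\<close>.\<close>

definition crossed :: "nat \<Rightarrow> (nat \<Rightarrow> nat) \<Rightarrow> nat \<Rightarrow> nat \<Rightarrow> nat list" where
  "crossed k p a j = filter (\<lambda>m. p m < j) [Suc a..<k]"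

text \<open>The conjugator is built from the original entries of the strands passed, in the order of
  their starting positions; the conjugations that those strands have undergone themselves are
  absorbed in this product.\<close>

definition lift_formula :: "nat \<Rightarrow> (nat \<Rightarrow> nat) \<Rightarrow> ('a \<Rightarrow> 'a) list \<Rightarrow> ('a \<Rightarrow> 'a) list" where
  "lift_formula k p ts =
     map (\<lambda>j. conj_by (prod_of (map ((!) ts) (crossed k p (inv p j) j))) (ts ! inv p j)) [0..<k]"

lemma length_hurwitz [simp]: "length (hurwitz i ts) = length ts"
  by (simp add: hurwitz_def)

lemma hurwitz_eq:
  assumes "Suc i < length ts"
  shows "hurwitz i ts = take i ts @ [ts ! Suc i, conj_by (ts ! Suc i) (ts ! i)] @ drop (Suc (Suc i)) ts"
  using assms
  by (intro nth_equalityI) (auto simp: hurwitz_def conj_by_def nth_append nth_list_update nth_Cons split: nat.split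
      intro!: arg_cong[of _ _ "(!) ts"])

lemma lift_formula_adj:
  assumes p: "p permutes {..<k}" and i: "Suc i < k" and ab: "inv p i < inv p (Suc i)"
    and len: "length ts = k" and bij: "\<And>t. t \<in> set ts \<Longrightarrow> bij t"
  shows "lift_formula k (adj i \<circ> p) ts = hurwitz i (lift_formula k p ts)"
proof (rule nth_equalityI)
  show "length (lift_formula k (adj i \<circ> p) ts) = length (hurwitz i (lift_formula k p ts))"
    by (simp add: lift_formula_def)
  fix j assume "j < length (lift_formula k (adj i \<circ> p) ts)"
  then have j: "j < k" by (simp add: lift_formula_def)
  define a where "a = inv p i"
  define b where "b = inv p (Suc i)"
  have q: "inv p permutes {..<k}" by (rule permutes_inv[OF p])
  have pa: "p a = i" and pb: "p b = Suc i" unfolding a_def b_def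
    using permutes_inverses(1)[OF p] by simp_all
  have bk: "b < k" unfolding b_def using permutes_in_image[OF q, of "Suc i"] i by simp
  have inj: "inj p" using permutes_inj[OF p] .
  have iff_a: "p m = i \<longleftrightarrow> m = a" and iff_b: "p m = Suc i \<longleftrightarrow> m = b" for m
    using inj pa pb by (metis injD)+
  have ne: "p m \<noteq> i" "p m \<noteq> Suc i" if "m \<noteq> a" "m \<noteq> b" for m
    using that iff_a iff_b by auto
  have ab': "a < b" using ab by (simp add: a_def b_def)
  let ?P = "\<lambda>l. prod_of (map ((!) ts) l)"
  have ba: "bij (?P l)" if "set l \<subseteq> {..<k}" for l
    using that bij len by (intro bij_prod_of) auto
  have L: "lift_formula k p ts ! j = conj_by (?P (crossed k p (inv p j) j)) (ts ! inv p j)" if "j < k" for j p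
    using that by (simp add: lift_formula_def)
  have len': "length (lift_formula k p ts) = k" by (simp add: lift_formula_def)
  consider "j = i" | "j = Suc i" | "j \<noteq> i" "j \<noteq> Suc i" by blast
  then show "lift_formula k (adj i \<circ> p) ts ! j = hurwitz i (lift_formula k p ts) ! j"
  proof cases
    case 1
    \<comment> \<open>The only strand ending at \<open>i\<close> under \<open>p\<close> is
      \<open>a\<close>, which starts before \<open>b\<close>; so lowering the target of
      \<open>b\<close> does not change what it passes.\<close>
    have "crossed k (adj i \<circ> p) b i = crossed k p b (Suc i)"
      unfolding crossed_def
    proof (rule filter_cong[OF refl])
      fix m assume "m \<in> set [Suc b..<k]"
      then have "p m \<noteq> i" "p m \<noteq> Suc i" using ab iff_a iff_b by (auto simp: a_def b_def)
      then show "((adj i \<circ> p) m < i) = (p m < Suc i)" by (auto simp: Transposition.transpose_def)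
    qed
    then show ?thesis using 1 i j by (simp add: L inv_adj_comp[OF p] hurwitz_def len' b_def)
  next
    case 2
    define B where "B = ?P (crossed k p b (Suc i))"
    define A where "A = ?P (crossed k p a i)"
    define A1 where "A1 = ?P (filter (\<lambda>m. p m < i) [Suc a..<b])"
    have up: "[Suc a..<k] = [Suc a..<b] @ b # [Suc b..<k]"
    proof -
      have "[Suc a..<k] = [Suc a..<b] @ [b..<k]"
        using upt_add_eq_append[of "Suc a" b "k - b"] ab bk by (simp add: a_def b_def)
      then show ?thesis using bk by (simp add: upt_conv_Cons)
    qed
    have f1: "crossed k p b (Suc i) = filter (\<lambda>m. p m < i) [Suc b..<k]"
      unfolding crossed_def
      by (rule filter_cong[OF refl]) (use ab' ne in \<open>auto simp: less_Suc_eq\<close>)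
    \<comment> \<open>Under \<open>p\<close> strand \<open>a\<close> does not pass \<open>b\<close>,
      and beyond \<open>b\<close> both pass the same strands, so the conjugator of \<open>a\<close>
      ends with that of \<open>b\<close>. The new crossing inserts \<open>ts ! b\<close> between the
      two parts.\<close>
    have A: "A = A1 \<circ> B"
      unfolding A_def A1_def B_def f1 unfolding crossed_def up by (simp add: pb prod_of_append)
    have f2: "filter (\<lambda>m. (adj i \<circ> p) m < Suc i) [Suc a..<b] = filter (\<lambda>m. p m < i) [Suc a..<b]"
      by (rule filter_cong[OF refl]) (use ne in \<open>auto simp: Transposition.transpose_def less_Suc_eq\<close>)
    have f3: "filter (\<lambda>m. (adj i \<circ> p) m < Suc i) [Suc b..<k] = filter (\<lambda>m. p m < i) [Suc b..<k]"
      by (rule filter_cong[OF refl]) (use ne ab' in \<open>auto simp: Transposition.transpose_def less_Suc_eq\<close>)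
    have new: "?P (crossed k (adj i \<circ> p) a (Suc i)) = A1 \<circ> (ts ! b \<circ> B)"
      unfolding crossed_def up B_def A1_def f1 using f2 f3 f1[unfolded crossed_def] by (simp add: pb prod_of_append)
    have bB: "bij B" and bA1: "bij A1" unfolding B_def A1_def crossed_def using bk by (auto intro!: ba)
    have bb: "bij (ts ! b)" using bij bk len by auto
    \<comment> \<open>The move conjugates by the current value \<open>conj_by B (ts ! b)\<close> of
      strand \<open>b\<close>. Multiplied by \<open>B\<close> from the left it becomes
      \<open>ts ! b \<circ> B\<close>, which is exactly the insertion.\<close>
    have "conj_by (A1 \<circ> (ts ! b \<circ> B)) (ts ! a) = conj_by (conj_by B (ts ! b)) (conj_by A (ts ! a))"
    proof -
      have c: "bij (conj_by B (ts ! b))" using bB bb by (auto simp: conj_by_def intro!: bij_comp bij_imp_bij_inv)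
      have "conj_by (conj_by B (ts ! b)) (conj_by A (ts ! a)) = conj_by (A \<circ> conj_by B (ts ! b)) (ts ! a)"
        using c bA1 bB by (simp add: conj_by_comp A bij_comp)
      also have "A \<circ> conj_by B (ts ! b) = A1 \<circ> (ts ! b \<circ> B)"
        unfolding A using comp_conj_by[OF bB] by (simp add: comp_assoc)
      finally show ?thesis by (rule sym)
    qed
    then show ?thesis using 2 i j new
      by (simp add: L inv_adj_comp[OF p] hurwitz_def len' b_def[symmetric] a_def[symmetric] A_def B_def conj_by_def[symmetric])
  next
    case 3
    have "crossed k (adj i \<circ> p) (inv p j) j = crossed k p (inv p j) j"
      unfolding crossed_def
      by (rule filter_cong[OF refl]) (use 3 in \<open>auto simp: Transposition.transpose_def\<close>)
    then show ?thesis using 3 i j by (simp add: L inv_adj_comp[OF p] hurwitz_def len')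
  qed
qed

lemma lift_formula_id: "length ts = k \<Longrightarrow> lift_formula k id ts = ts"
  by (intro nth_equalityI) (auto simp: lift_formula_def crossed_def filter_empty_conv)

text \<open>An expression as short as the inversion number gains one inversion with every letter, so
  each letter is covered by \<open>lift_formula_adj\<close>. The outcome depends on \<open>p\<close>
  alone.\<close>

lemma foldr_hurwitz_eq:
  assumes "length ts = k" "\<And>t. t \<in> set ts \<Longrightarrow> bij t"
    and "expression_of k p is" "length is = card (inversions k p)"
  shows "foldr hurwitz is ts = lift_formula k p ts"
  using assms(3,4)
proof (induction "is" arbitrary: p)
  case Nil
  then show ?case by (metis expression_of_Nil foldr.simps(1) id_apply lift_formula_id assms(1))
next
  case (Cons i js)
  then obtain q where q: "Suc i < k" "expression_of k q js" "p = adj i \<circ> q"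
    by (auto simp: expression_of_Cons)
  have b: "q permutes {..<k}" "card (inversions k q) \<le> length js"
    using expression_of_bound[OF q(2)] by auto
  have ab: "inv q i < inv q (Suc i)"
  proof (rule ccontr)
    assume "\<not> ?thesis"
    from card_inversions_adj'[OF b(1) q(1) this, folded q(3)] show False
      using Cons.prems(2) b(2) by simp
  qed
  then have "length js = card (inversions k q)"
    using card_inversions_adj[OF b(1) q(1), folded q(3)] Cons.prems(2) by simp
  then show ?case
    using Cons.IH[OF q(2)] lift_formula_adj[OF b(1) q(1) ab assms(1,2), folded q(3)] by simp
qed

lemma braid_lift_action_eq:
  assumes "length ts = k" "\<And>t. t \<in> set ts \<Longrightarrow> bij t" "p permutes {..<k}"
  shows "braid_lift_action k p ts = lift_formula k p ts"
proof -
  have "\<exists>is. reduced_expression k p is"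
    using ex_expression_of[OF assms(3)] by (auto simp: reduced_expression_iff[OF assms(3)])
  then have "reduced_expression k p (SOME is. reduced_expression k p is)"
    by (rule someI_ex)
  then show ?thesis
    unfolding braid_lift_action_def reduced_expression_iff[OF assms(3)]
    by (intro foldr_hurwitz_eq assms) simp_all
qed

text \<open>The lift of whichever permutation has fewer inversions becomes the other lift by a
  single move. The disjunction suffices for \<open>beta_cycle\<close>, where the two directions are
  treated alike.\<close>

lemma braid_lift_action_adj:
  assumes "length ts = k" "\<And>t. t \<in> set ts \<Longrightarrow> bij t" "p permutes {..<k}" "Suc i < k"
  shows "braid_lift_action k (adj i \<circ> p) ts = hurwitz i (braid_lift_action k p ts) \<or>
    braid_lift_action k p ts = hurwitz i (braid_lift_action k (adj i \<circ> p) ts)"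
proof -
  note eq = braid_lift_action_eq[OF assms(1,2)]
  have q: "adj i \<circ> p permutes {..<k}" by (rule permutes_compose[OF assms(3) adj_permutes[OF assms(4)]])
  show ?thesis
  proof (cases "inv p i < inv p (Suc i)")
    case True
    then have "lift_formula k (adj i \<circ> p) ts = hurwitz i (lift_formula k p ts)"
      using assms by (intro lift_formula_adj) auto
    then show ?thesis by (simp only: eq[OF _ q] eq[OF _ assms(3)] simp_thms)
  next
    case False
    have "inv p i \<noteq> inv p (Suc i)"
      using permutes_inj[OF permutes_inv[OF assms(3)]] by (metis injD n_not_Suc_n)
    then have "inv (adj i \<circ> p) i < inv (adj i \<circ> p) (Suc i)"
      using False by (simp add: inv_adj_comp[OF assms(3)])
    moreover have "adj i \<circ> (adj i \<circ> p) = p" by (simp add: comp_assoc[symmetric])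
    ultimately have "lift_formula k p ts = hurwitz i (lift_formula k (adj i \<circ> p) ts)"
      using lift_formula_adj[OF q assms(4) _ assms(1)] assms(2) by simp
    then show ?thesis by (simp only: eq[OF _ q] eq[OF _ assms(3)] simp_thms)
  qed
qed

lemma braid_lift_action_closed:
  assumes "P ts" "length ts = k" "p permutes {..<k}"
    and "\<And>i us. P us \<Longrightarrow> Suc i < k \<Longrightarrow> length us = k \<Longrightarrow> P (hurwitz i us)"
  shows "P (braid_lift_action k p ts)"
proof -
  have "\<exists>is. reduced_expression k p is"
    using ex_expression_of[OF assms(3)] by (auto simp: reduced_expression_iff[OF assms(3)])
  then have "reduced_expression k p (SOME is. reduced_expression k p is)" (is "reduced_expression k p ?is")
    by (rule someI_ex)
  then have "\<forall>i\<in>set ?is. Suc i < k" by (blast intro: reduced_expression_bound)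
  moreover have "P (foldr hurwitz js ts) \<and> length (foldr hurwitz js ts) = k" if "\<forall>i\<in>set js. Suc i < k" for js
    using that
  proof (induction js)
    case Nil
    then show ?case using assms(1,2) by simp
  next
    case (Cons i js)
    then show ?case using assms(4)[of "foldr hurwitz js ts" i] by simp
  qed
  ultimately show ?thesis unfolding braid_lift_action_def by blast
qed

section \<open>Integer bases and triangularity\<close>

lemma lookup_sum_frag: "Poly_Mapping.lookup (\<Sum>i\<in>I. f i) x = (\<Sum>i\<in>I. Poly_Mapping.lookup (f i) x)"
  by (induction I rule: infinite_finite_induct) (auto simp: lookup_add)

lemma lookup_frag_extend:
  "Poly_Mapping.lookup (frag_extend b c) x =
     (\<Sum>i\<in>Poly_Mapping.keys c. Poly_Mapping.lookup c i * Poly_Mapping.lookup (b i) x)"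
  by (simp add: frag_extend_def lookup_sum_frag)

lemma frag_extend_mem:
  assumes "0 \<in> Z" "\<And>x y. x \<in> Z \<Longrightarrow> y \<in> Z \<Longrightarrow> x - y \<in> Z"
    and "Poly_Mapping.keys c \<subseteq> I" "\<And>i. i \<in> I \<Longrightarrow> b i \<in> Z"
  shows "frag_extend b c \<in> Z"
  using assms(3)
proof (induction c rule: frag_induction)
  case zero
  then show ?case using assms(1) by simp
next
  case (one i)
  then show ?case using assms(4) by simp
next
  case (diff x y)
  then show ?case using assms(2) by (simp add: frag_extend_diff)
qed

text \<open>Gaussian elimination from the top weight downwards. Leading coefficients equal to 1 keep
  it integral, and \<open>top\<close> ensures that every leading term met on the way belongs to some
  \<open>b d\<close>.\<close>

theorem int_basis_triangular:
  fixes Z :: "('x \<Rightarrow>\<^sub>0 int) set" and wt :: "'x \<Rightarrow> nat"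
  assumes Z: "0 \<in> Z" "\<And>x y. x \<in> Z \<Longrightarrow> y \<in> Z \<Longrightarrow> x - y \<in> Z"
    and b: "\<And>d. d \<in> D \<Longrightarrow> b d \<in> Z"
    and lead: "\<And>d. d \<in> D \<Longrightarrow> Poly_Mapping.lookup (b d) d = 1"
    and less: "\<And>d x. d \<in> D \<Longrightarrow> x \<in> Poly_Mapping.keys (b d) \<Longrightarrow> x \<noteq> d \<Longrightarrow> wt x < wt d"
    and top: "\<And>c x. c \<in> Z \<Longrightarrow> x \<in> Poly_Mapping.keys c \<Longrightarrow>
                (\<And>y. y \<in> Poly_Mapping.keys c \<Longrightarrow> wt y \<le> wt x) \<Longrightarrow> x \<in> D"
  shows "int_basis D b Z"
proof -
  have mem: "frag_extend b e \<in> Z" if "Poly_Mapping.keys e \<subseteq> D" for e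
  proof (rule frag_extend_mem[where I = D])
    show "x - y \<in> Z" if "x \<in> Z" "y \<in> Z" for x y using that by (rule Z(2))
  qed (use Z(1) b that in auto)
  \<comment> \<open>All terms of \<open>b d\<close> other than \<open>d\<close> weigh strictly less
    than \<open>d\<close>, so no \<open>b d\<close> with \<open>d \<noteq> x\<close> of weight at
    most \<open>wt x\<close> can contain \<open>x\<close>.\<close>
  have coeff: "Poly_Mapping.lookup (frag_extend b e) x = Poly_Mapping.lookup e x"
    if e: "Poly_Mapping.keys e \<subseteq> D" and ge: "\<And>d. d \<in> Poly_Mapping.keys e \<Longrightarrow> wt d \<le> wt x" for e x
  proof -
    have "Poly_Mapping.lookup (b d) x = (if d = x then 1 else 0)" if d: "d \<in> Poly_Mapping.keys e" for d
    proof (cases "d = x")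
      case False
      have "x \<notin> Poly_Mapping.keys (b d)"
        using less[of d x] ge[OF d] e d False by fastforce
      then show ?thesis using False by (simp add: in_keys_iff)
    qed (use lead e d in auto)
    then have "Poly_Mapping.lookup (frag_extend b e) x =
        (\<Sum>d\<in>Poly_Mapping.keys e. Poly_Mapping.lookup e d * (if d = x then 1 else 0))"
      by (simp add: lookup_frag_extend)
    also have "\<dots> = Poly_Mapping.lookup e x"
      by (auto simp: if_distrib in_keys_iff cong: if_cong)
    finally show ?thesis .
  qed
  have "inj_on (frag_extend b) {c. Poly_Mapping.keys c \<subseteq> D}"
  proof (rule inj_onI, clarify)
    fix c c' assume c: "Poly_Mapping.keys c \<subseteq> D" "Poly_Mapping.keys c' \<subseteq> D" "frag_extend b c = frag_extend b c'"
    define e where "e = c - c'"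
    have e: "Poly_Mapping.keys e \<subseteq> D" "frag_extend b e = 0"
      using c keys_diff[of c c'] by (auto simp: e_def frag_extend_diff)
    have "e = 0"
    proof (rule ccontr)
      assume "e \<noteq> 0"
      then have "Max (wt ` Poly_Mapping.keys e) \<in> wt ` Poly_Mapping.keys e" by (intro Max_in) auto
      then obtain x where x: "x \<in> Poly_Mapping.keys e" "wt x = Max (wt ` Poly_Mapping.keys e)" by auto
      then have "Poly_Mapping.lookup (frag_extend b e) x = Poly_Mapping.lookup e x"
        by (intro coeff e) auto
      with x(1) e(2) show False by (simp add: in_keys_iff)
    qed
    then show "c = c'" by (simp add: e_def)
  qed
  moreover have surj: "c \<in> frag_extend b ` {c. Poly_Mapping.keys c \<subseteq> D}"
    if "c \<in> Z" "\<And>y. y \<in> Poly_Mapping.keys c \<Longrightarrow> wt y < n" for c n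
    using that
  proof (induction n arbitrary: c)
    case 0
    then have "Poly_Mapping.keys c = {}" using not_less_zero by blast
    then have "c = 0" by simp
    then show ?case by (intro image_eqI[of _ _ 0]) auto
  next
    case (Suc n)
    \<comment> \<open>The part of \<open>c\<close> of top weight \<open>n\<close>. Subtracting
      \<open>frag_extend b e\<close> cancels it and introduces only terms of smaller weight.\<close>
    define e where "e = frag_extend (\<lambda>x. if wt x = n then frag_of x else 0) c"
    have le: "Poly_Mapping.lookup e x = (if wt x = n then Poly_Mapping.lookup c x else 0)" for x
    proof -
      have "Poly_Mapping.lookup e x =
          (\<Sum>i\<in>Poly_Mapping.keys c. if i = x then (if wt x = n then Poly_Mapping.lookup c x else 0) else 0)"
        unfolding e_def lookup_frag_extend by (intro sum.cong) auto
      also have "\<dots> = (if wt x = n then Poly_Mapping.lookup c x else 0)"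
        by (auto simp: in_keys_iff)
      finally show ?thesis .
    qed
    have "Poly_Mapping.keys e \<subseteq> D"
    proof
      fix x assume "x \<in> Poly_Mapping.keys e"
      then have x: "x \<in> Poly_Mapping.keys c" "wt x = n" by (auto simp: in_keys_iff le split: if_splits)
      then show "x \<in> D" using Suc.prems by (intro top[of c x]) (auto simp: less_Suc_eq_le)
    qed
    have we: "wt x = n" if "x \<in> Poly_Mapping.keys e" for x
      using that by (auto simp: in_keys_iff le split: if_splits)
    let ?c = "c - frag_extend b e"
    have "frag_extend b e \<in> Z"
      by (rule mem[OF \<open>Poly_Mapping.keys e \<subseteq> D\<close>])
    then have "?c \<in> Z" using Z(2) Suc.prems(1) by blast
    moreover have "wt y < n" if y: "y \<in> Poly_Mapping.keys ?c" for y
    proof (rule ccontr)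
      assume *: "\<not> wt y < n"
      then have "Poly_Mapping.lookup (frag_extend b e) y = Poly_Mapping.lookup e y"
        by (intro coeff \<open>Poly_Mapping.keys e \<subseteq> D\<close>) (simp add: we)
      then have ly: "Poly_Mapping.lookup ?c y = Poly_Mapping.lookup c y - Poly_Mapping.lookup e y"
        by (simp add: lookup_minus)
      show False
      proof (cases "wt y = n")
        case True
        then show ?thesis using y ly by (simp add: in_keys_iff le)
      next
        case False
        then have "y \<notin> Poly_Mapping.keys c" using * Suc.prems(2)[of y] by auto
        then show ?thesis using y ly False by (simp add: in_keys_iff le)
      qed
    qed
    ultimately obtain c' where c': "Poly_Mapping.keys c' \<subseteq> D" "?c = frag_extend b c'"
      using Suc.IH by blast
    then have "c = frag_extend b (c' + e)" by (simp add: frag_extend_add algebra_simps)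
    moreover have "Poly_Mapping.keys (c' + e) \<subseteq> D"
      using keys_add[of c' e] c' \<open>Poly_Mapping.keys e \<subseteq> D\<close> by blast
    ultimately show ?case by blast
  qed
  moreover have "Z \<subseteq> frag_extend b ` {c. Poly_Mapping.keys c \<subseteq> D}"
  proof
    fix c assume "c \<in> Z"
    then show "c \<in> frag_extend b ` {c. Poly_Mapping.keys c \<subseteq> D}"
      by (rule surj[where n = "Suc (Max (wt ` Poly_Mapping.keys c))"]) (simp add: less_Suc_eq_le)
  qed
  moreover have "frag_extend b ` {c. Poly_Mapping.keys c \<subseteq> D} \<subseteq> Z"
    using mem by blast
  ultimately show ?thesis
    unfolding int_basis_def bij_betw_def by (simp add: subset_antisym)
qed

lemma int_basis_span:
  assumes "int_basis D b Z" "z \<in> Z"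
  obtains c where "Poly_Mapping.keys c \<subseteq> D" "z = frag_extend b c"
proof -
  have "z \<in> frag_extend b ` {c. Poly_Mapping.keys c \<subseteq> D}"
    using assms unfolding int_basis_def bij_betw_def by (metis (no_types))
  then show thesis using that by (elim imageE) simp
qed

section \<open>Induced maps and generated subgroups of free abelian groups\<close>

lemma keys_frag_extend_subset:
  assumes "g ` K \<subseteq> S" "Poly_Mapping.keys c \<subseteq> K"
  shows "Poly_Mapping.keys (frag_extend (\<lambda>x. frag_of (g x)) c) \<subseteq> S"
  using keys_frag_extend[of "\<lambda>x. frag_of (g x)" c] assms by force

lemma lookup_frag_extend_inj:
  assumes "inj_on g K" "Poly_Mapping.keys c \<subseteq> K" "x \<in> K"
  shows "Poly_Mapping.lookup (frag_extend (\<lambda>x. frag_of (g x)) c) (g x) = Poly_Mapping.lookup c x"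
proof -
  have "Poly_Mapping.lookup (frag_extend (\<lambda>x. frag_of (g x)) c) (g x)
      = (\<Sum>i\<in>Poly_Mapping.keys c. Poly_Mapping.lookup c i * (if i = x then 1 else 0))"
    unfolding lookup_frag_extend using assms by (intro sum.cong) (auto dest: inj_onD)
  also have "\<dots> = Poly_Mapping.lookup c x"
    by (auto simp: if_distrib in_keys_iff cong: if_cong)
  finally show ?thesis .
qed

lemma bij_betw_frag_extend:
  assumes "bij_betw g K S"
  shows "bij_betw (frag_extend (\<lambda>x. frag_of (g x))) {c. Poly_Mapping.keys c \<subseteq> K} {c. Poly_Mapping.keys c \<subseteq> S}"
proof (rule bij_betwI')
  have g: "inj_on g K" "g ` K = S" using assms by (auto simp: bij_betw_def)
  show "frag_extend (\<lambda>x. frag_of (g x)) c = frag_extend (\<lambda>x. frag_of (g x)) c' \<longleftrightarrow> c = c'"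
    if "c \<in> {c. Poly_Mapping.keys c \<subseteq> K}" "c' \<in> {c. Poly_Mapping.keys c \<subseteq> K}" for c c'
  proof
    assume eq: "frag_extend (\<lambda>x. frag_of (g x)) c = frag_extend (\<lambda>x. frag_of (g x)) c'"
    show "c = c'"
    proof (rule poly_mapping_eqI)
      fix x
      show "Poly_Mapping.lookup c x = Poly_Mapping.lookup c' x"
      proof (cases "x \<in> K")
        case True
        then show ?thesis using lookup_frag_extend_inj[OF g(1)] that eq by (metis mem_Collect_eq)
      next
        case False
        then show ?thesis using that by (metis in_keys_iff mem_Collect_eq subsetD)
      qed
    qed
  qed simp
  show "frag_extend (\<lambda>x. frag_of (g x)) c \<in> {c. Poly_Mapping.keys c \<subseteq> S}"
    if "c \<in> {c. Poly_Mapping.keys c \<subseteq> K}" for c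
    using keys_frag_extend_subset[of g K S c] g that by simp
  show "\<exists>c\<in>{c. Poly_Mapping.keys c \<subseteq> K}. e = frag_extend (\<lambda>x. frag_of (g x)) c"
    if "e \<in> {c. Poly_Mapping.keys c \<subseteq> S}" for e
  proof
    define h where "h = inv_into K g"
    have h: "h y \<in> K" "g (h y) = y" if "y \<in> S" for y
      using g(2) that by (auto simp: h_def inv_into_into f_inv_into_f)
    show "frag_extend (\<lambda>y. frag_of (h y)) e \<in> {c. Poly_Mapping.keys c \<subseteq> K}"
      using keys_frag_extend_subset[of h S K e] h that by auto
    have "frag_extend (\<lambda>x. frag_of (g x)) (frag_extend (\<lambda>y. frag_of (h y)) e) = frag_extend (\<lambda>y. frag_of (g (h y))) e"
      by (simp add: frag_extend_compose[of "\<lambda>x. frag_of (g x)" h, unfolded o_def, symmetric])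
    also have "\<dots> = frag_extend frag_of e"
      using h that by (intro frag_extend_eq) auto
    finally show "e = frag_extend (\<lambda>x. frag_of (g x)) (frag_extend (\<lambda>y. frag_of (h y)) e)"
      using frag_expansion[of e] by simp
  qed
qed

lemma carrier_subgroup_generated_frag:
  assumes "B \<subseteq> {c. Poly_Mapping.keys c \<subseteq> S}" "0 \<in> B" "\<And>x y. x \<in> B \<Longrightarrow> y \<in> B \<Longrightarrow> x - y \<in> B"
  shows "carrier (subgroup_generated (free_Abelian_group S) B) = B"
proof -
  interpret group "free_Abelian_group S" by simp
  have neg: "- x \<in> B" if "x \<in> B" for x using assms(3)[OF assms(2) that] by simp
  have "subgroup B (free_Abelian_group S)"
  proof (rule subgroupI)
    show "x \<otimes>\<^bsub>free_Abelian_group S\<^esub> y \<in> B" if "x \<in> B" "y \<in> B" for x y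
      using assms(3)[OF that(1) neg[OF that(2)]] by simp
    show "m_inv (free_Abelian_group S) x \<in> B" if "x \<in> B" for x
      using neg[OF that] assms(1) that by auto
  qed (use assms in auto)
  then show ?thesis by (rule subgroup.carrier_subgroup_generated_subgroup)
qed

text \<open>The generated group is squeezed: it lies in the subgroup \<open>Z\<close> and contains a
  basis of \<open>Z\<close>. It is applied with \<open>B\<close> the set of all \<open>beta\<close>
  and \<open>Z\<close> the cycles.\<close>

lemma carrier_subgroup_generated_basis:
  assumes Z: "0 \<in> Z" "\<And>x y. x \<in> Z \<Longrightarrow> y \<in> Z \<Longrightarrow> x - y \<in> Z" "Z \<subseteq> {c. Poly_Mapping.keys c \<subseteq> S}"
    and B: "B \<subseteq> Z" "b ` D \<subseteq> B" and basis: "int_basis D b Z"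
  shows "carrier (subgroup_generated (free_Abelian_group S) B) = Z"
proof
  interpret group "free_Abelian_group S" by simp
  let ?G = "subgroup_generated (free_Abelian_group S)"
  have sub: "carrier (?G B) \<subseteq> carrier (free_Abelian_group S)"
    by (rule carrier_subgroup_generated_subset)
  have ZS: "Z \<subseteq> carrier (free_Abelian_group S)" using Z(3) by (simp add: subset_iff)
  have BS: "B \<subseteq> carrier (free_Abelian_group S)" using B(1) ZS by (rule subset_trans)
  have incl: "B \<subseteq> carrier (?G B)" by (rule subgroup_generated_subset_carrier_subset[OF BS])
  have gen: "carrier (?G B) = generate (free_Abelian_group S) B"
    using BS by (simp only: carrier_subgroup_generated Int_absorb1)
  have "carrier (?G B) \<subseteq> carrier (?G Z)"
    unfolding carrier_subgroup_generated using B(1) by (intro mono_generate Int_mono order_refl)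
  moreover have "carrier (?G Z) = Z"
  proof (rule carrier_subgroup_generated_frag)
    show "x - y \<in> Z" if "x \<in> Z" "y \<in> Z" for x y using that by (rule Z(2))
  qed (rule Z)+
  ultimately show "carrier (?G B) \<subseteq> Z" by (simp only:)
  have "generate (free_Abelian_group S) B \<subseteq> carrier (free_Abelian_group S)"
    using sub unfolding gen .
  have zero: "0 \<in> generate (free_Abelian_group S) B"
    using generate.one[of "free_Abelian_group S" B] by simp
  have diff: "x - y \<in> generate (free_Abelian_group S) B"
    if "x \<in> generate (free_Abelian_group S) B" "y \<in> generate (free_Abelian_group S) B" for x y
  proof -
    have "m_inv (free_Abelian_group S) y \<in> generate (free_Abelian_group S) B"
      by (rule generate_m_inv_closed[OF BS that(2)])
    moreover have "Poly_Mapping.keys y \<subseteq> S"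
      using subsetD[OF sub[unfolded gen] that(2)] by simp
    ultimately have "- y \<in> generate (free_Abelian_group S) B" by simp
    then show ?thesis
      using generate.eng[OF that(1), of "- y"] by simp
  qed
  have mem: "frag_extend b c \<in> generate (free_Abelian_group S) B" if "Poly_Mapping.keys c \<subseteq> D" for c
  proof (rule frag_extend_mem[where I = D])
    show "x - y \<in> generate (free_Abelian_group S) B"
      if "x \<in> generate (free_Abelian_group S) B" "y \<in> generate (free_Abelian_group S) B" for x y
      using that by (rule diff)
    show "b d \<in> generate (free_Abelian_group S) B" if "d \<in> D" for d
      using that B(2) incl unfolding gen by blast
  qed (use zero that in simp_all)
  show "Z \<subseteq> carrier (?G B)"
  proof
    fix z assume "z \<in> Z"
    with basis obtain c where c: "Poly_Mapping.keys c \<subseteq> D" "z = frag_extend b c"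
      by (rule int_basis_span)
    show "z \<in> carrier (?G B)"
      unfolding gen c(2) by (rule mem[OF c(1)])
  qed
qed

section \<open>Products of reflections and the Wall form\<close>

lemma linear_reflect: "linear (reflect a)"
  by (rule linearI) (auto simp: reflect_def algebra_simps inner_add_left add_divide_distrib)

lemma reflect_scaleR: "reflect a (c *\<^sub>R x) = c *\<^sub>R reflect a x"
  by (rule linear_cmul[OF linear_reflect])

lemma reflect_orth: "x \<bullet> a = 0 \<Longrightarrow> reflect a x = x"
  by (simp add: reflect_def)

lemma reflect_self [simp]: "reflect a a = - a"
  by (cases "a = 0") (auto simp: reflect_def scaleR_2)

lemma inner_reflect: "reflect a x \<bullet> reflect a y = x \<bullet> y"
  by (cases "a = 0") (auto simp: reflect_def algebra_simps inner_commute)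

lemma inner_reflect_left: "reflect a x \<bullet> y = x \<bullet> reflect a y"
  by (metis inner_reflect reflect_reflect)

lemma orthogonal_transformation_reflect: "orthogonal_transformation (reflect a)"
  by (simp add: orthogonal_transformation_def linear_reflect inner_reflect)

lemma reflect_comp_reflect [simp]: "reflect a \<circ> reflect a = id"
  by (simp add: fun_eq_iff reflect_reflect)

lemma bij_reflect: "bij (reflect a)"
  using reflect_comp_reflect[of a] by (metis o_bij)

lemma reflect_scale: "c \<noteq> 0 \<Longrightarrow> reflect (c *\<^sub>R a) = reflect a"
  by (simp add: reflect_def fun_eq_iff)

lemma reflect_neg [simp]: "reflect (- a) = reflect a"
  by (simp add: reflect_def fun_eq_iff)

text \<open>Evaluate both reflections at \<open>b\<close>, which its own reflection sends to
  \<open>- b\<close>.\<close>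

lemma reflect_eqD:
  assumes "reflect a = reflect b"
  shows "b = ((b \<bullet> a) / (a \<bullet> a)) *\<^sub>R a"
proof -
  have "reflect a b = - b" using assms by simp
  then have "2 *\<^sub>R b = (2 * (b \<bullet> a) / (a \<bullet> a)) *\<^sub>R a"
    by (simp add: reflect_def algebra_simps scaleR_2)
  then have "(1/2) *\<^sub>R (2 *\<^sub>R b) = (1/2) *\<^sub>R ((2 * (b \<bullet> a) / (a \<bullet> a)) *\<^sub>R a)" by simp
  then show ?thesis by simp
qed

lemma orthogonal_transformation_reflect_comp:
  assumes "orthogonal_transformation f"
  shows "f \<circ> reflect a = reflect (f a) \<circ> f"
proof -
  have l: "linear f" and i: "f v \<bullet> f w = v \<bullet> w" for v w
    using assms by (auto simp: orthogonal_transformation_def)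
  show ?thesis by (simp add: fun_eq_iff reflect_def linear_diff[OF l] linear_cmul[OF l] i)
qed

lemma orthogonal_transformation_prod_of:
  "(\<And>f. f \<in> set fs \<Longrightarrow> orthogonal_transformation f) \<Longrightarrow> orthogonal_transformation (prod_of fs)"
  by (induction fs) (auto intro: orthogonal_transformation_compose orthogonal_transformation_id simp: id_def)

lemma prod_reflect_orth: "(\<And>a. a \<in> set cs \<Longrightarrow> x \<bullet> a = 0) \<Longrightarrow> prod_of (map reflect cs) x = x"
  by (induction cs) (auto simp: reflect_orth)

lemma scaleR_in_spanD: "c *\<^sub>R a \<in> span S \<Longrightarrow> c \<noteq> 0 \<Longrightarrow> (a :: 'a :: real_vector) \<in> span S"
  using span_mul[of "c *\<^sub>R a" S "inverse c"] by simp

lemma prod_reflect_span: "x - prod_of (map reflect cs) x \<in> span (set cs)"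
proof (induction cs)
  case (Cons a cs)
  let ?y = "prod_of (map reflect cs) x"
  have "x - ?y \<in> span (set (a # cs))" using Cons span_mono[of "set cs" "set (a # cs)"] by auto
  moreover have "(2 * (?y \<bullet> a) / (a \<bullet> a)) *\<^sub>R a \<in> span (set (a # cs))"
    by (intro span_mul span_base) simp
  ultimately have "(x - ?y) + (2 * (?y \<bullet> a) / (a \<bullet> a)) *\<^sub>R a \<in> span (set (a # cs))"
    by (rule span_add)
  moreover have "x - reflect a ?y = (x - ?y) + (2 * (?y \<bullet> a) / (a \<bullet> a)) *\<^sub>R a"
    by (simp add: reflect_def)
  ultimately have "x - reflect a ?y \<in> span (set (a # cs))" by (simp only:)
  then show ?case by simp
qed (simp add: span_zero)

text \<open>The leftmost reflection must undo the displacement caused by the others. One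
  displacement is along \<open>c\<close>, the other inside \<open>span (set cs)\<close>, which does
  not contain \<open>c\<close>; so both vanish.\<close>

lemma prod_reflect_fixed:
  assumes "independent (set cs)" "distinct cs" "prod_of (map reflect cs) x = x" "a \<in> set cs"
  shows "x \<bullet> a = 0"
  using assms
proof (induction cs)
  case (Cons c cs)
  let ?y = "prod_of (map reflect cs) x"
  have ind: "independent (set cs)" "c \<notin> span (set cs)"
    using Cons.prems(1,2) by (auto simp: independent_insert)
  have c0: "c \<noteq> 0" using ind(2) span_zero by auto
  have "reflect c ?y = x" using Cons.prems(3) by simp
  then have "?y = reflect c x" by (metis reflect_reflect)
  then have "x - ?y = (2 * (x \<bullet> c) / (c \<bullet> c)) *\<^sub>R c" by (simp add: reflect_def)
  with prod_reflect_span[of x cs] have *: "(2 * (x \<bullet> c) / (c \<bullet> c)) *\<^sub>R c \<in> span (set cs)" by simp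
  have "x \<bullet> c = 0"
  proof (rule ccontr)
    assume "x \<bullet> c \<noteq> 0"
    then have "2 * (x \<bullet> c) / (c \<bullet> c) \<noteq> 0" using c0 by simp
    then have "c \<in> span (set cs)" using * by (rule scaleR_in_spanD[rotated])
    then show False using ind(2) by blast
  qed
  moreover from this have "?y = x" using \<open>?y = reflect c x\<close> by (simp add: reflect_orth)
  ultimately show ?case using Cons.IH ind Cons.prems by auto
qed simp

text \<open>Brings a reflection to the front of a factorization; only the roots it jumps over are
  altered, not those to its right.\<close>

lemma prod_reflect_commute:
  "prod_of (map reflect us) \<circ> reflect a = reflect a \<circ> prod_of (map reflect (map (reflect a) us))"
proof (induction us)
  case (Cons u us)
  have "reflect u \<circ> reflect a = reflect a \<circ> reflect (reflect a u)"
    using orthogonal_transformation_reflect_comp[OF orthogonal_transformation_reflect, of a "reflect a u"]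
    by (simp add: reflect_reflect)
  then have r: "reflect u (reflect a x) = reflect a (reflect (reflect a u) x)" for x
    by (simp add: fun_eq_iff)
  have "prod_of (map reflect us) (reflect a x) = reflect a (prod_of (map reflect (map (reflect a) us)) x)" for x
    using Cons by (simp add: fun_eq_iff)
  then show ?case by (simp add: fun_eq_iff r)
qed simp

text \<open>Displacements of the product stay in the span of \<open>a\<close> and \<open>b\<close>,
  and some vector is displaced by a nonzero multiple of \<open>d\<close>.\<close>

lemma reflect_pair_span:
  assumes eq: "reflect a \<circ> reflect b = reflect d \<circ> reflect e"
    and ne: "reflect d \<noteq> reflect e" and "d \<noteq> 0" "e \<noteq> 0"
  shows "d \<in> span {a, b}"
proof -
  \<comment> \<open>The component of \<open>d\<close> orthogonal to \<open>e\<close>: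
    \<open>reflect e\<close> fixes it, so the product displaces it along \<open>d\<close>
    only.\<close>
  define x where "x = d - ((d \<bullet> e) / (e \<bullet> e)) *\<^sub>R e"
  have xe: "x \<bullet> e = 0" using assms by (simp add: x_def inner_diff_left)
  have "x \<noteq> 0"
  proof
    assume "x = 0"
    then have *: "d = ((d \<bullet> e) / (e \<bullet> e)) *\<^sub>R e" by (simp add: x_def)
    then have "(d \<bullet> e) / (e \<bullet> e) \<noteq> 0" using assms by auto
    then show False using * reflect_scale[of "(d \<bullet> e) / (e \<bullet> e)" e] ne by simp
  qed
  moreover have "x \<bullet> x = x \<bullet> d"
    by (subst (2) x_def) (simp add: inner_diff_right xe)
  ultimately have xd: "x \<bullet> d \<noteq> 0" by (metis inner_eq_zero_iff)
  have "x - (reflect a \<circ> reflect b) x = (2 * (x \<bullet> d) / (d \<bullet> d)) *\<^sub>R d"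
    unfolding eq by (simp add: reflect_orth[OF xe]) (simp add: reflect_def)
  moreover have "x - (reflect a \<circ> reflect b) x \<in> span {a, b}"
    using prod_reflect_span[of x "[a, b]"] by simp
  moreover have "2 * (x \<bullet> d) / (d \<bullet> d) \<noteq> 0" using xd \<open>d \<noteq> 0\<close> by simp
  ultimately show ?thesis using scaleR_in_spanD[of "2 * (x \<bullet> d) / (d \<bullet> d)" d] by (simp only: not_False_eq_True)
qed

text \<open>Up to convention, \<open>B\<close> below is the Wall form of \<open>g\<close>.\<close>

locale wall_form =
  fixes g :: "'a::euclidean_space \<Rightarrow> 'a"
  assumes orth: "orthogonal_transformation g"
    and fixfree: "g x = x \<Longrightarrow> x = 0"
begin

lemma linear_g: "linear g" and inner_g: "g v \<bullet> g w = v \<bullet> w"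
  using orth by (auto simp: orthogonal_transformation_def)

definition mu :: "'a \<Rightarrow> 'a" where
  "mu = inv (\<lambda>x. x - g x)"

definition B :: "'a \<Rightarrow> 'a \<Rightarrow> real" where
  "B x y = mu x \<bullet> y"

lemma linear_diff_g: "linear (\<lambda>x. x - g x)"
  using linear_compose_sub[OF linear_ident linear_g] .

lemma inj_diff_g: "inj (\<lambda>x. x - g x)"
  unfolding linear_injective_0[OF linear_diff_g] using fixfree by (metis eq_iff_diff_eq_0)

lemma mu_diff: "mu (u - g u) = u"
  unfolding mu_def using inv_f_f[OF inj_diff_g] .

lemma diff_mu: "mu x - g (mu x) = x"
  unfolding mu_def using surj_f_inv_f[OF linear_inj_imp_surj[OF linear_diff_g inj_diff_g]] .

lemma obtain_mu: obtains u where "x = u - g u" "mu x = u"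
  using diff_mu[of x] by metis

lemma mu_add: "mu (x + y) = mu x + mu y"
proof -
  have "x + y = (mu x + mu y) - g (mu x + mu y)"
  proof -
    have "x + y = (mu x - g (mu x)) + (mu y - g (mu y))" by (simp only: diff_mu)
    then show ?thesis by (simp add: linear_add[OF linear_g] algebra_simps)
  qed
  then show ?thesis using mu_diff by metis
qed

lemma mu_scaleR: "mu (c *\<^sub>R x) = c *\<^sub>R mu x"
proof -
  have "c *\<^sub>R x = (c *\<^sub>R mu x) - g (c *\<^sub>R mu x)"
    using diff_mu[of x] by (simp add: linear_cmul[OF linear_g] scaleR_diff_right[symmetric])
  then show ?thesis using mu_diff by metis
qed

lemma B_add_left: "B (x + y) z = B x z + B y z"
  and B_scaleR_left: "B (c *\<^sub>R x) z = c * B x z"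
  and B_add_right: "B z (x + y) = B z x + B z y"
  and B_scaleR_right: "B z (c *\<^sub>R x) = c * B z x"
  by (auto simp: B_def mu_add mu_scaleR inner_add_left inner_add_right)

lemma B_minus_left: "B (- x) z = - B x z" and B_minus_right: "B z (- x) = - B z x"
  using B_scaleR_left[of "-1" x z] B_scaleR_right[of z "-1" x] by auto

lemma B_sum_right: "B z (\<Sum>i\<in>I. f i) = (\<Sum>i\<in>I. B z (f i))"
  by (simp add: B_def inner_sum_right)

lemma linear_mu: "linear mu"
  by (rule linearI) (auto simp: mu_add mu_scaleR)

lemma B_sum_left: "B (\<Sum>i\<in>I. f i) z = (\<Sum>i\<in>I. B (f i) z)"
  by (simp add: B_def linear_sum[OF linear_mu] inner_sum_left)

lemma B_symmetrize: "B x y + B y x = x \<bullet> y"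
proof -
  obtain u v where "x = u - g u" "mu x = u" "y = v - g v" "mu y = v"
    using obtain_mu[of x] obtain_mu[of y] by metis
  then show ?thesis
    by (simp add: B_def inner_diff_left inner_diff_right inner_g inner_commute)
qed

lemma B_self: "B x x = (x \<bullet> x) / 2"
  using B_symmetrize[of x x] by simp

text \<open>This has the shape of Serre duality, with \<open>B\<close> as Euler form and
  \<open>g\<close> as Coxeter transformation. Applied twice it gives the invariance
  \<open>B_g\<close>; applied once it exchanges the arguments.\<close>

lemma B_serre: "B x y = - B (g y) x"
proof -
  obtain u v where "x = u - g u" "mu x = u" "y = v - g v" "mu y = v"
    using obtain_mu[of x] obtain_mu[of y] by metis
  moreover from this have "mu (g y) = g v"
    using mu_diff[of "g v"] by (simp add: linear_diff[OF linear_g])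
  ultimately show ?thesis
    by (simp add: B_def inner_diff_left inner_diff_right inner_g inner_commute)
qed

lemma B_g: "B (g x) (g y) = B x y"
  using B_serre[of x y] B_serre[of "g y" x] by simp

text \<open>Fewer than \<open>DIM('a)\<close> roots in \<open>cs\<close> leave a nonzero
  \<open>x\<close> orthogonal to all of them. Then \<open>g\<close> displaces \<open>x\<close> along
  \<open>a\<close> only, so \<open>mu\<close> maps a nonzero multiple of \<open>a\<close> to
  \<open>x\<close>, and \<open>x\<close> is orthogonal to \<open>b\<close>.\<close>

lemma B_eq_0:
  assumes g: "g = reflect a \<circ> prod_of (map reflect cs)" and len: "length cs < DIM('a)"
    and "b \<in> set cs" "a \<noteq> 0"
  shows "B a b = 0"
proof -
  have "dim (set cs) < DIM('a)"
    using dim_le_card[of "set cs" "set cs"] card_length[of cs] len span_superset[of "set cs"] by simp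
  then obtain x where x: "x \<noteq> 0" "\<And>y. y \<in> span (set cs) \<Longrightarrow> orthogonal x y"
    using orthogonal_to_subspace_exists by blast
  then have xc: "x \<bullet> c = 0" if "c \<in> set cs" for c
    using that span_base[of c "set cs"] by (auto simp: orthogonal_def)
  then have gx: "g x = reflect a x" using g by (simp add: prod_reflect_orth)
  define c where "c = 2 * (x \<bullet> a) / (a \<bullet> a)"
  have eq: "x - g x = c *\<^sub>R a" by (simp add: gx c_def reflect_def)
  then have "c \<noteq> 0" using fixfree[of x] x(1) by auto
  have "c * B a b = B (c *\<^sub>R a) b" by (simp add: B_scaleR_left)
  also have "\<dots> = x \<bullet> b" unfolding eq[symmetric] B_def mu_diff ..
  also have "\<dots> = 0" using xc assms by blast
  finally show ?thesis using \<open>c \<noteq> 0\<close> by simp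
qed

text \<open>Bringing \<open>a\<close> to the front changes the roots of \<open>us\<close> but not
  those of \<open>vs\<close>, so \<open>B_eq_0\<close> applies to any earlier root against any later
  one.\<close>

lemma B_eq_0':
  assumes g: "g = prod_of (map reflect (us @ a # vs))" and len: "length (us @ a # vs) \<le> DIM('a)"
    and "b \<in> set vs" "a \<noteq> 0"
  shows "B a b = 0"
proof (rule B_eq_0)
  show "g = reflect a \<circ> prod_of (map reflect (map (reflect a) us @ vs))"
    unfolding g using prod_reflect_commute[of us a] by (simp add: prod_of_append comp_assoc[symmetric])
qed (use assms in auto)

text \<open>A vector orthogonal to all the roots is fixed, and fewer than \<open>DIM('a)\<close>
  roots would leave a nonzero one. This is the minimality half of
  \<open>abs_length_\<gamma>\<close>.\<close>

lemma length_ge_DIM: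
  assumes g: "g = prod_of (map reflect cs)"
  shows "DIM('a) \<le> length cs"
proof (rule ccontr)
  assume "\<not> ?thesis"
  then have "dim (set cs) < DIM('a)"
    using dim_le_card[of "set cs" "set cs"] card_length[of cs] span_superset[of "set cs"] by simp
  then obtain x where x: "x \<noteq> 0" "\<And>y. y \<in> span (set cs) \<Longrightarrow> orthogonal x y"
    using orthogonal_to_subspace_exists by blast
  then have "x \<bullet> c = 0" if "c \<in> set cs" for c
    using that span_base[of c "set cs"] by (auto simp: orthogonal_def)
  then have "g x = x" using g by (simp add: prod_reflect_orth)
  then show False using fixfree x(1) by blast
qed

end

section \<open>Components and roots\<close>

lemma generated_by_comp: "x \<in> generated_by S \<Longrightarrow> y \<in> generated_by S \<Longrightarrow> x \<circ> y \<in> generated_by S"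
proof -
  assume "x \<in> generated_by S" "y \<in> generated_by S"
  then obtain us vs where "set us \<subseteq> S" "x = prod_of us" "set vs \<subseteq> S" "y = prod_of vs"
    by (auto simp: generated_by_def)
  then show ?thesis
    unfolding generated_by_def by (intro CollectI exI[of _ "us @ vs"]) (simp add: prod_of_append)
qed

lemma generated_by_base: "x \<in> S \<Longrightarrow> x \<in> generated_by S"
  unfolding generated_by_def by (intro CollectI exI[of _ "[x]"]) simp

definition adjacency :: "'a::euclidean_space set \<Rightarrow> ('a \<times> 'a) set" where
  "adjacency \<Delta> = {(a, b). a \<in> \<Delta> \<and> b \<in> \<Delta> \<and> a \<bullet> b \<noteq> 0}"

text \<open>The closure \<open>\<^sup>*\<close> is reflexive on the whole type, hence an equivalence
  on \<open>UNIV\<close> rather than on \<open>\<Delta>\<close>; classes of elements of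
  \<open>\<Delta>\<close> still stay inside \<open>\<Delta>\<close>.\<close>

lemma equiv_adjacency: "equiv UNIV ((adjacency \<Delta>)\<^sup>*)"
proof (rule equivI)
  show "sym ((adjacency \<Delta>)\<^sup>*)"
    by (rule sym_rtrancl) (auto simp: adjacency_def sym_def inner_commute)
qed (auto simp: refl_rtrancl trans_rtrancl)

lemma irreducible_components_eq: "irreducible_components \<Delta> = \<Delta> // (adjacency \<Delta>)\<^sup>*"
  by (simp add: irreducible_components_def adjacency_def)

lemma component_subset:
  assumes "C \<in> irreducible_components \<Delta>"
  shows "C \<subseteq> \<Delta>"
proof
  fix b assume "b \<in> C"
  with assms obtain a where a: "a \<in> \<Delta>" "(a, b) \<in> (adjacency \<Delta>)\<^sup>*"
    by (auto simp: irreducible_components_eq quotient_def)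
  from a(2,1) show "b \<in> \<Delta>"
    by (induction rule: rtrancl_induct) (auto simp: adjacency_def)
qed

lemma component_nonempty: "C \<in> irreducible_components \<Delta> \<Longrightarrow> C \<noteq> {}"
  by (auto simp: irreducible_components_eq quotient_def)

lemma ex_component: "a \<in> \<Delta> \<Longrightarrow> \<exists>C\<in>irreducible_components \<Delta>. a \<in> C"
  by (auto simp: irreducible_components_eq quotient_def)

lemma component_orth:
  assumes "C \<in> irreducible_components \<Delta>" "a \<in> C" "b \<in> \<Delta>" "b \<notin> C"
  shows "a \<bullet> b = 0"
proof (rule ccontr)
  assume "a \<bullet> b \<noteq> 0"
  moreover have "a \<in> \<Delta>" using component_subset assms by blast
  ultimately have "(a, b) \<in> (adjacency \<Delta>)\<^sup>*" using assms by (auto simp: adjacency_def)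
  moreover from assms obtain c where "c \<in> \<Delta>" "C = (adjacency \<Delta>)\<^sup>* `` {c}"
    by (auto simp: irreducible_components_eq quotient_def)
  ultimately have "b \<in> C" using assms(2) by (auto intro: rtrancl_trans)
  with assms show False by blast
qed

lemma components_disjoint:
  assumes "C \<in> irreducible_components \<Delta>" "C' \<in> irreducible_components \<Delta>" "C \<noteq> C'"
  shows "C \<inter> C' = {}"
proof -
  have "\<Delta> // (adjacency \<Delta>)\<^sup>* \<subseteq> UNIV // (adjacency \<Delta>)\<^sup>*" by (auto simp: quotient_def)
  then show ?thesis
    using quotient_disj[OF equiv_adjacency] assms unfolding irreducible_components_eq by blast
qed

lemma orthogonal_spans:
  assumes "\<And>a b. a \<in> A \<Longrightarrow> b \<in> B \<Longrightarrow> a \<bullet> b = 0" "x \<in> span A" "y \<in> span B"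
  shows "x \<bullet> y = (0::real)"
proof -
  have "orthogonal x b" if "b \<in> B" for b
    using orthogonal_to_span[OF assms(2), of b] assms(1) that
    by (simp add: orthogonal_commute) (simp add: orthogonal_def inner_commute)
  then show ?thesis
    using orthogonal_to_span[OF assms(3), of x] by (simp add: orthogonal_def)
qed

lemma components_orthogonal:
  assumes "C \<in> irreducible_components \<Delta>" "C' \<in> irreducible_components \<Delta>" "C \<noteq> C'"
    and "x \<in> span C" "y \<in> span C'"
  shows "x \<bullet> y = 0"
proof (rule orthogonal_spans[OF _ assms(4,5)])
  fix a b assume "a \<in> C" "b \<in> C'"
  moreover have "b \<notin> C" using components_disjoint[OF assms(1-3)] \<open>b \<in> C'\<close> by blast
  moreover have "b \<in> \<Delta>" using component_subset[OF assms(2)] \<open>b \<in> C'\<close> by blast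
  ultimately show "a \<bullet> b = 0" using component_orth[OF assms(1)] by blast
qed

text \<open>Subtracting multiples of one root does not change the inner products with the others, so
  the displacements add up. The sum ranges over a set, which allows different enumerations of one
  half to be compared.\<close>

lemma prod_reflect_pairwise_orthogonal:
  assumes "distinct cs" "pairwise orthogonal (set cs)"
  shows "prod_of (map reflect cs) x = x - (\<Sum>a\<in>set cs. (2 * (x \<bullet> a) / (a \<bullet> a)) *\<^sub>R a)"
  using assms
proof (induction cs)
  case (Cons c cs)
  have orth: "a \<bullet> c = 0" if "a \<in> set cs" for a
    using Cons.prems that by (auto simp: pairwise_def orthogonal_def)
  have IH: "prod_of (map reflect cs) x = x - (\<Sum>a\<in>set cs. (2 * (x \<bullet> a) / (a \<bullet> a)) *\<^sub>R a)"
    using Cons by (auto simp: pairwise_insert)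
  have "(\<Sum>a\<in>set cs. (2 * (x \<bullet> a) / (a \<bullet> a)) *\<^sub>R a) \<bullet> c = 0"
    using orth by (simp add: inner_sum_left)
  then have "prod_of (map reflect cs) x \<bullet> c = x \<bullet> c" by (simp add: IH inner_diff_left)
  then have "prod_of (map reflect (c # cs)) x = prod_of (map reflect cs) x - (2 * (x \<bullet> c) / (c \<bullet> c)) *\<^sub>R c"
    by (simp add: reflect_def)
  then show ?case using Cons.prems by (simp add: IH algebra_simps)
qed simp

lemma prod_reflect_restrict:
  assumes cs: "distinct cs" "pairwise orthogonal (set cs)"
    and ds: "distinct ds" "set ds = set cs \<inter> C"
    and orth: "\<And>a. a \<in> set cs - C \<Longrightarrow> x \<bullet> a = 0"
  shows "prod_of (map reflect cs) x = prod_of (map reflect ds) x"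
proof -
  have "pairwise orthogonal (set ds)" using cs(2) ds(2) by (auto simp: pairwise_def)
  moreover have "(\<Sum>a\<in>set cs. (2 * (x \<bullet> a) / (a \<bullet> a)) *\<^sub>R a) = (\<Sum>a\<in>set ds. (2 * (x \<bullet> a) / (a \<bullet> a)) *\<^sub>R a)"
    using ds orth by (intro sum.mono_neutral_right) auto
  ultimately show ?thesis
    by (simp only: prod_reflect_pairwise_orthogonal[OF cs] prod_reflect_pairwise_orthogonal[OF ds(1)])
qed

lemma prod_reflect_span_closed: "x \<in> span S \<Longrightarrow> set cs \<subseteq> S \<Longrightarrow> prod_of (map reflect cs) x \<in> span S"
  using prod_reflect_span[of x cs] span_mono[of "set cs" S] span_diff[of x S "x - prod_of (map reflect cs) x"]
  by auto

section \<open>The reflection group and the Wall form of its Coxeter element\<close>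

locale bipartite_reflection_group =
  fixes W :: "('a::euclidean_space \<Rightarrow> 'a) set"
    and \<Phi> :: "'a set"
    and as bs :: "'a list"
    and r :: "(('a \<Rightarrow> 'a) \<times> ('a \<Rightarrow> 'a)) set"
    and \<gamma> :: "'a \<Rightarrow> 'a"
  assumes W: "finite_reflection_group W"
    and \<Phi>: "root_system_of W \<Phi>"
    and simple: "simple_system \<Phi> (set as \<union> set bs)"
    and rank: "card (set as \<union> set bs) = DIM('a)"
    and distinct: "distinct (as @ bs)"
    and orth_as: "pairwise orthogonal (set as)"
    and orth_bs: "pairwise orthogonal (set bs)"
    and \<gamma>: "\<gamma> = coxeter_element as bs"
    and order: "admissible_order W as bs r"
begin

definition \<Delta> :: "'a set" where
  "\<Delta> = set as \<union> set bs"

lemma W_generated: "W = generated_by (reflections W)"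
  using W unfolding finite_reflection_group_def by (rule conjunct2)

lemma W_comp: "x \<in> W \<Longrightarrow> y \<in> W \<Longrightarrow> x \<circ> y \<in> W"
  using generated_by_comp W_generated by metis

lemma reflections_subset: "reflections W \<subseteq> W"
  by (auto simp: reflections_def)

lemma finite_\<Phi>: "finite \<Phi>" and zero_notin_\<Phi>: "0 \<notin> \<Phi>"
  and \<Phi>_multiple: "a \<in> \<Phi> \<Longrightarrow> c *\<^sub>R a \<in> \<Phi> \<longleftrightarrow> c = 1 \<or> c = - 1"
  and reflections_eq: "reflections W = reflect ` \<Phi>"
  using \<Phi> by (simp_all add: root_system_of_def)

lemma \<Phi>_stable: "w \<in> W \<Longrightarrow> a \<in> \<Phi> \<Longrightarrow> w a \<in> \<Phi>"
  using \<Phi> unfolding root_system_of_def by blast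

lemma \<Phi>_minus: "a \<in> \<Phi> \<Longrightarrow> - a \<in> \<Phi>"
  using \<Phi>_multiple[of a "- 1"] by simp

lemma reflect_in_W: "a \<in> \<Phi> \<Longrightarrow> reflect a \<in> W"
  using reflections_eq reflections_subset by blast

lemma reflect_stable: "a \<in> \<Phi> \<Longrightarrow> b \<in> \<Phi> \<Longrightarrow> reflect a b \<in> \<Phi>"
  using reflect_in_W \<Phi>_stable by blast

lemma finite_\<Delta>: "finite \<Delta>" and \<Delta>_subset: "\<Delta> \<subseteq> \<Phi>" and independent_\<Delta>: "independent \<Delta>"
  using simple by (auto simp: simple_system_def \<Delta>_def)

lemma span_\<Delta>: "span \<Delta> = UNIV"
  using card_ge_dim_independent[of \<Delta> UNIV] rank independent_\<Delta> by (auto simp: \<Delta>_def)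

lemma \<gamma>_eq: "\<gamma> = prod_of (map reflect (as @ bs))"
  by (simp add: \<gamma> coxeter_element_def prod_of_append)

text \<open>A vector fixed by the Coxeter element is orthogonal to all simple roots, because these
  are independent; it is zero, because they span.\<close>

sublocale wall_form \<gamma>
proof
  show "orthogonal_transformation \<gamma>"
    unfolding \<gamma>_eq by (rule orthogonal_transformation_prod_of) (auto simp: orthogonal_transformation_reflect)
  fix x assume "\<gamma> x = x"
  then have xa: "x \<bullet> a = 0" if "a \<in> \<Delta>" for a
    using prod_reflect_fixed[of "as @ bs" x a] independent_\<Delta> distinct that
    by (simp add: \<gamma>_eq \<Delta>_def)
  have "orthogonal x y" if "y \<in> span \<Delta>" for y
    using that by (rule orthogonal_to_span) (simp add: orthogonal_def xa)
  then show "x = 0" using span_\<Delta> by (metis UNIV_I orthogonal_self)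
qed

lemma length_simple: "length (as @ bs) = DIM('a)"
  using rank distinct_card[OF distinct] by simp

subsection \<open>Positive roots\<close>

definition coef :: "'a \<Rightarrow> 'a \<Rightarrow> real" where
  "coef v = representation \<Delta> v"

definition positive :: "'a \<Rightarrow> bool" where
  "positive v \<longleftrightarrow> (\<forall>a\<in>\<Delta>. coef v a \<ge> 0)"

lemma sum_coef: "(\<Sum>a\<in>\<Delta>. coef v a *\<^sub>R a) = v"
  unfolding coef_def using independent_\<Delta> span_\<Delta> finite_\<Delta> by (intro sum_representation_eq) auto

lemma coef_diff: "coef (u - v) a = coef u a - coef v a"
  unfolding coef_def using independent_\<Delta> span_\<Delta> by (simp add: representation_diff)

lemma coef_scale: "coef (c *\<^sub>R v) a = c * coef v a"
  unfolding coef_def using independent_\<Delta> span_\<Delta> by (simp add: representation_scale)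

lemma coef_minus: "coef (- v) a = - coef v a"
  using coef_scale[of "-1" v] by simp

lemma coef_simple: "a \<in> \<Delta> \<Longrightarrow> coef a b = (if b = a then 1 else 0)"
  unfolding coef_def using independent_\<Delta> by (simp add: representation_basis)

lemma coef_sum: "b \<in> \<Delta> \<Longrightarrow> coef (\<Sum>a\<in>\<Delta>. c a *\<^sub>R a) b = c b"
proof -
  assume b: "b \<in> \<Delta>"
  have "coef (\<Sum>a\<in>\<Delta>. c a *\<^sub>R a) b = (\<Sum>a\<in>\<Delta>. coef (c a *\<^sub>R a) b)"
    unfolding coef_def using independent_\<Delta> span_\<Delta> by (simp add: representation_sum)
  also have "\<dots> = (\<Sum>a\<in>\<Delta>. c a * (if b = a then 1 else 0))"
    by (rule sum.cong) (auto simp: coef_scale coef_simple)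
  also have "\<dots> = c b" using finite_\<Delta> b by (simp add: if_distrib cong: if_cong)
  finally show ?thesis .
qed

lemma positive_simple: "a \<in> \<Delta> \<Longrightarrow> positive a"
  by (simp add: positive_def coef_simple)

lemma root_sign: "b \<in> \<Phi> \<Longrightarrow> positive b \<or> positive (- b)"
proof -
  assume "b \<in> \<Phi>"
  then obtain c where c: "b = (\<Sum>a\<in>\<Delta>. c a *\<^sub>R a)" "(\<forall>a\<in>\<Delta>. c a \<ge> 0) \<or> (\<forall>a\<in>\<Delta>. c a \<le> 0)"
    using simple by (auto simp: simple_system_def \<Delta>_def)
  then have "coef b a = c a" if "a \<in> \<Delta>" for a using that coef_sum by simp
  then show ?thesis using c(2) by (auto simp: positive_def coef_minus)
qed

text \<open>\<open>reflect a\<close> alters only the coefficient at \<open>a\<close>. If the image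
  were negative, the remaining coefficients of \<open>b\<close> would have to vanish, making
  \<open>b\<close> a nonnegative multiple of \<open>a\<close> and hence \<open>a\<close>
  itself.\<close>

lemma positive_reflect:
  assumes b: "b \<in> \<Phi>" "positive b" and a: "a \<in> \<Delta>" "b \<noteq> a"
  shows "positive (reflect a b)"
proof (rule ccontr)
  assume n: "\<not> positive (reflect a b)"
  have aP: "a \<in> \<Phi>" using a \<Delta>_subset by blast
  have "positive (- reflect a b)"
    using root_sign[OF reflect_stable[OF aP b(1)]] n by blast
  then have le: "coef (reflect a b) x \<le> 0" if "x \<in> \<Delta>" for x
    using that by (auto simp: positive_def coef_minus)
  have "coef b x = 0" if x: "x \<in> \<Delta>" "x \<noteq> a" for x
  proof -
    have "coef (reflect a b) x = coef b x"
      using a x by (simp add: reflect_def coef_diff coef_scale coef_simple)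
    then show ?thesis using le[OF x(1)] b(2) x(1) by (force simp: positive_def)
  qed
  then have "(\<Sum>x\<in>\<Delta>. coef b x *\<^sub>R x) = (\<Sum>x\<in>{a}. coef b x *\<^sub>R x)"
    using a finite_\<Delta> by (intro sum.mono_neutral_right) auto
  then have eq: "b = coef b a *\<^sub>R a" using sum_coef[of b] by simp
  then have "coef b a = 1 \<or> coef b a = - 1" using \<Phi>_multiple[OF aP, of "coef b a"] b(1) by simp
  moreover have "coef b a \<ge> 0" using b(2) a(1) by (simp add: positive_def)
  ultimately have "coef b a = 1" by simp
  with eq a(2) show False by simp
qed

definition height :: "'a \<Rightarrow> real" where
  "height v = (\<Sum>a\<in>\<Delta>. coef v a)"

lemma height_reflect:
  assumes "a \<in> \<Delta>"
  shows "height (reflect a b) = height b - 2 * (b \<bullet> a) / (a \<bullet> a)"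
proof -
  have "height (reflect a b) = (\<Sum>x\<in>\<Delta>. coef b x - (if x = a then 2 * (b \<bullet> a) / (a \<bullet> a) else 0))"
    unfolding height_def by (rule sum.cong) (auto simp: reflect_def coef_diff coef_scale coef_simple assms)
  then show ?thesis using assms finite_\<Delta> by (simp add: sum_subtractf height_def)
qed

text \<open>A positive root that is not simple can be lowered by a simple reflection. The span
  serves orthogonality between components; membership in the generated group is what
  \<open>admissible_order\<close> asks for, since it prescribes \<open>r\<close> on the reflections
  of that group.\<close>

lemma positive_root_component:
  assumes "b \<in> \<Phi>" "positive b"
  shows "\<exists>C\<in>irreducible_components \<Delta>. b \<in> span C \<and> reflect b \<in> generated_by (reflect ` C)"
  using assms
\<comment> \<open>Heights are real numbers, so well-foundedness comes from counting the finitely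
  many lower roots.\<close>
proof (induction "card {b' \<in> \<Phi>. height b' < height b}" arbitrary: b rule: less_induct)
  case less
  show ?case
  proof (cases "b \<in> \<Delta>")
    case True
    then obtain C where "C \<in> irreducible_components \<Delta>" "b \<in> C" using ex_component by blast
    then show ?thesis by (intro bexI[of _ C]) (auto intro: span_base generated_by_base)
  next
    case False
    have "b \<noteq> 0" using less.prems zero_notin_\<Phi> by blast
    then have "0 < b \<bullet> b" by simp
    also have "b \<bullet> b = (\<Sum>a\<in>\<Delta>. coef b a * (b \<bullet> a))"
      by (subst (2) sum_coef[of b, symmetric]) (simp add: inner_sum_right)
    finally obtain a where a: "a \<in> \<Delta>" "0 < coef b a * (b \<bullet> a)"
      by (metis (no_types, lifting) not_less sum_nonpos)
    have "coef b a \<ge> 0" using less.prems a by (simp add: positive_def)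
    then have pos: "b \<bullet> a > 0" using a(2) by (simp add: zero_less_mult_iff)
    have aP: "a \<in> \<Phi>" "a \<noteq> 0" using a \<Delta>_subset zero_notin_\<Phi> by auto
    let ?c = "reflect a b"
    have c: "?c \<in> \<Phi>" "positive ?c"
      using reflect_stable[OF aP(1) less.prems(1)] positive_reflect[OF less.prems a(1)] False a(1) by auto
    have lt: "height ?c < height b"
      using height_reflect[OF a(1)] pos aP(2) by simp
    have "card {b' \<in> \<Phi>. height b' < height ?c} < card {b' \<in> \<Phi>. height b' < height b}"
      using finite_\<Phi> lt c(1) by (intro psubset_card_mono) auto
    from less.hyps[OF this c] obtain C where C: "C \<in> irreducible_components \<Delta>" "?c \<in> span C"
      "reflect ?c \<in> generated_by (reflect ` C)" by blast
    \<comment> \<open>Lowering does not leave the component: an \<open>a\<close> outside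
      \<open>C\<close> would be orthogonal to the lowered root and hence to
      \<open>b\<close>.\<close>
    have "a \<in> C"
    proof (rule ccontr)
      assume "a \<notin> C"
      then have "?c \<bullet> a = 0"
        using orthogonal_spans[of C "{a}" ?c a] component_orth[OF C(1) _ a(1)] C(2) by (simp add: span_base)
      then show False using pos by (simp add: inner_reflect_left)
    qed
    have "reflect a ?c \<in> span C"
      using prod_reflect_span_closed[OF C(2), of "[a]"] \<open>a \<in> C\<close> by simp
    moreover have "reflect b = reflect a \<circ> (reflect ?c \<circ> reflect a)"
      using orthogonal_transformation_reflect_comp[OF orthogonal_transformation_reflect, of a b]
      by (metis comp_assoc comp_id reflect_comp_reflect id_comp)
    moreover have "reflect a \<in> generated_by (reflect ` C)"
      using \<open>a \<in> C\<close> by (intro generated_by_base) auto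
    ultimately have "b \<in> span C \<and> reflect b \<in> generated_by (reflect ` C)"
      using C(3) by (simp add: reflect_reflect generated_by_comp)
    then show ?thesis using C(1) by blast
  qed
qed

lemma root_component:
  assumes "b \<in> \<Phi>"
  obtains C where "C \<in> irreducible_components \<Delta>" "b \<in> span C" "reflect b \<in> generated_by (reflect ` C)"
proof -
  have "\<exists>C\<in>irreducible_components \<Delta>. b \<in> span C \<and> reflect b \<in> generated_by (reflect ` C)"
  proof (cases "positive b")
    case False
    then have "positive (- b)" using root_sign[OF assms] by blast
    then obtain C where "C \<in> irreducible_components \<Delta>" "- b \<in> span C" "reflect b \<in> generated_by (reflect ` C)"
      using positive_root_component[OF \<Phi>_minus[OF assms]] by auto
    then show ?thesis using span_neg[of "- b" C] by auto
  qed (rule positive_root_component[OF assms])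
  then show thesis using that by blast
qed

end

lemma bip_root_simple_left: "k < length as \<Longrightarrow> bip_root as bs k = as ! k"
  by (subst bip_root.simps) (simp add: Let_def)

lemma bip_root_simple_right:
  "length as \<le> k \<Longrightarrow> k < length as + length bs \<Longrightarrow>
    bip_root as bs k = - coxeter_element as bs (bs ! (k - length as))"
  by (subst bip_root.simps) (simp add: Let_def)

lemma bip_root_shift:
  "0 < length as + length bs \<Longrightarrow>
    bip_root as bs (k + (length as + length bs)) = coxeter_element as bs (bip_root as bs k)"
  by (subst bip_root.simps) (auto simp: Let_def)

context bipartite_reflection_group
begin

subsection \<open>The Wall form on simple roots\<close>

lemma prod_reflect_in_W: "set cs \<subseteq> \<Phi> \<Longrightarrow> prod_of (map reflect cs) \<in> W"
proof (induction cs)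
  case Nil
  have "prod_of [] \<in> generated_by (reflections W)" unfolding generated_by_def by (intro CollectI exI[of _ "[]"]) simp
  then have "prod_of [] \<in> W" by (simp only: W_generated[symmetric])
  then show ?case by (simp only: list.map)
qed (auto intro: W_comp reflect_in_W)

lemma \<gamma>_root: "b \<in> \<Phi> \<Longrightarrow> \<gamma> b \<in> \<Phi>"
  using \<Phi>_stable[OF prod_reflect_in_W[of "as @ bs"]] \<Delta>_subset by (simp add: \<gamma>_eq \<Delta>_def)

lemma B_simple_order:
  assumes "as @ bs = us @ a # vs" "b \<in> set vs"
  shows "B a b = 0"
proof (rule B_eq_0'[of us a vs])
  show "\<gamma> = prod_of (map reflect (us @ a # vs))" using \<gamma>_eq assms(1) by simp
  show "length (us @ a # vs) \<le> DIM('a)" using length_simple unfolding assms(1) by simp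
  have "a \<in> \<Delta>" using assms(1) unfolding \<Delta>_def set_append[symmetric] by simp
  then show "a \<noteq> 0" using \<Delta>_subset zero_notin_\<Phi> by blast
qed fact

text \<open>Position in the product kills \<open>B\<close> in one direction, and for orthogonal
  roots \<open>B_symmetrize\<close> then kills it in the other. The lists \<open>xs\<close> and
  \<open>ys\<close> allow \<open>cs\<close> to be either half.\<close>

lemma B_orthogonal_cases:
  assumes "a \<in> set cs" "b \<in> set cs" "a \<noteq> b" "as @ bs = xs @ cs @ ys" "a \<bullet> b = 0"
  shows "B a b = 0"
proof -
  obtain us vs where cs: "cs = us @ a # vs" using assms(1) split_list by metis
  with assms(2,3) consider "b \<in> set us" | "b \<in> set vs" by auto
  then show ?thesis
  proof cases
    case 1
    then obtain us1 us2 where "us = us1 @ b # us2" using split_list by metis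
    then have "B b a = 0" using B_simple_order[of "xs @ us1" b "us2 @ a # vs @ ys" a] assms(4) cs by simp
    then show ?thesis using B_symmetrize[of a b] assms(5) by simp
  next
    case 2
    then show ?thesis using B_simple_order[of "xs @ us" a "vs @ ys" b] assms(4) cs by simp
  qed
qed

lemma B_left_simple:
  assumes "a \<in> set as" "b \<in> \<Delta>" "a \<noteq> b"
  shows "B a b = 0"
proof (cases "b \<in> set as")
  case True
  then have "a \<bullet> b = 0" using orth_as assms by (auto simp: pairwise_def orthogonal_def)
  then show ?thesis using B_orthogonal_cases[of a as b "[]" bs] True assms by simp
next
  case False
  then have "b \<in> set bs" using assms by (simp add: \<Delta>_def)
  moreover obtain us vs where "as = us @ a # vs" using assms(1) split_list by metis
  ultimately show ?thesis using B_simple_order[of us a "vs @ bs" b] by simp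
qed

lemma B_right_simple:
  assumes "b \<in> set bs" "a \<in> \<Delta>" "a \<noteq> b"
  shows "B a b = 0"
proof (cases "a \<in> set as")
  case True
  then show ?thesis using B_left_simple[of a b] assms by (simp add: \<Delta>_def)
next
  case False
  then have "a \<in> set bs" using assms by (simp add: \<Delta>_def)
  moreover from this have "a \<bullet> b = 0" using orth_bs assms by (auto simp: pairwise_def orthogonal_def)
  ultimately show ?thesis using B_orthogonal_cases[of a bs b as "[]"] assms by simp
qed

text \<open>Pairing with a root of \<open>as\<close> on the left annihilates all other simple roots
  and so reads off one coefficient; roots of \<open>bs\<close> do the same on the right. Positivity
  of a root thereby becomes a sign of \<open>B\<close>.\<close>

lemma B_left_coef:
  assumes "a \<in> set as"
  shows "B a y = coef y a * ((a \<bullet> a) / 2)"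
proof -
  have "B a y = (\<Sum>b\<in>\<Delta>. coef y b * B a b)"
    by (subst sum_coef[of y, symmetric]) (simp add: B_sum_right B_scaleR_right)
  also have "\<dots> = (\<Sum>b\<in>{a}. coef y b * B a b)"
    using assms finite_\<Delta> B_left_simple[OF assms] by (intro sum.mono_neutral_right) (auto simp: \<Delta>_def)
  finally show ?thesis by (simp add: B_self)
qed

lemma B_right_coef:
  assumes "b \<in> set bs"
  shows "B y b = coef y b * ((b \<bullet> b) / 2)"
proof -
  have "B y b = (\<Sum>a\<in>\<Delta>. coef y a * B a b)"
    by (subst sum_coef[of y, symmetric]) (simp add: B_sum_left B_scaleR_left)
  also have "\<dots> = (\<Sum>a\<in>{b}. coef y a * B a b)"
    using assms finite_\<Delta> B_right_simple[OF assms] by (intro sum.mono_neutral_right) (auto simp: \<Delta>_def)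
  finally show ?thesis by (simp add: B_self)
qed

lemma linear_order: "linear_order_on (reflections W) r"
  using order by (simp add: admissible_order_def)

lemma r_antisym: "(s, t) \<in> r \<Longrightarrow> (t, s) \<in> r \<Longrightarrow> s = t"
  and r_trans: "(s, t) \<in> r \<Longrightarrow> (t, u) \<in> r \<Longrightarrow> (s, u) \<in> r"
  and r_refl: "s \<in> reflections W \<Longrightarrow> (s, s) \<in> r"
  using linear_order
  by (auto simp: linear_order_on_def partial_order_on_def preorder_on_def
      dest: antisymD transD refl_onD)

lemma r_total: "s \<in> reflections W \<Longrightarrow> t \<in> reflections W \<Longrightarrow> (s, t) \<in> r \<or> (t, s) \<in> r"
  using linear_order r_refl[of s] by (cases "s = t") (simp_all add: linear_order_on_def total_on_def)

end

section \<open>The ordered roots of one irreducible component\<close>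

locale component_order = bipartite_reflection_group +
  fixes C as' bs'
  assumes C: "C \<in> irreducible_components \<Delta>"
    and as': "distinct as'" "set as' = set as \<inter> C"
    and bs': "distinct bs'" "set bs' = set bs \<inter> C"
    and r_component: "r \<inter> reflections (generated_by (reflect ` C)) \<times> reflections (generated_by (reflect ` C)) =
      {(reflect (bip_root as' bs' i), reflect (bip_root as' bs' j)) | i j.
         i \<le> j \<and> 2 * j < (length as' + length bs') * coxeter_number as' bs'}"
begin

abbreviation \<rho> :: "nat \<Rightarrow> 'a" where
  "\<rho> \<equiv> bip_root as' bs'"

definition n where
  "n = length as' + length bs'"

definition valid :: "nat \<Rightarrow> bool" where
  "valid j \<longleftrightarrow> 2 * j < n * coxeter_number as' bs'"

text \<open>The simple roots of the component repeated with period \<open>n\<close>, so that every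
  \<open>n\<close> letters contribute one Coxeter element of the component to
  \<open>prefix\<close>.\<close>

definition word :: "nat \<Rightarrow> 'a" where
  "word i = (as' @ bs') ! (i mod n)"

definition prefix :: "nat \<Rightarrow> 'a \<Rightarrow> 'a" where
  "prefix q = prod_of (map (\<lambda>i. reflect (word i)) [0..<q])"

lemma C_eq: "set (as' @ bs') = C"
  using component_subset[OF C] as' bs' by (auto simp: \<Delta>_def)

lemma n_pos: "0 < n"
proof -
  have "as' @ bs' \<noteq> []" using C_eq component_nonempty[OF C] by auto
  then show ?thesis by (simp add: n_def)
qed

lemma distinct': "distinct (as' @ bs')"
  using as' bs' distinct by auto

lemma word_mem: "word i \<in> C"
  using n_pos C_eq unfolding word_def by (metis length_append mod_less_divisor n_def nth_mem)

lemma word_simple: "word i \<in> \<Delta>" and word_root: "word i \<in> \<Phi>" and word_span: "word i \<in> span C"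
  using word_mem[of i] component_subset[OF C] \<Delta>_subset by (auto intro: span_base)

text \<open>Simple roots outside \<open>C\<close> are orthogonal to the span of \<open>C\<close>, so
  their reflections fix it. The invariance of \<open>B\<close> under the full
  \<open>\<gamma>\<close> thus applies to the recursion inside a component.\<close>

lemma \<gamma>_component:
  assumes "x \<in> span C"
  shows "coxeter_element as' bs' x = \<gamma> x"
proof -
  have orth: "y \<bullet> a = 0" if "y \<in> span C" "a \<in> \<Delta>" "a \<notin> C" for a y
    using orthogonal_spans[of C "{a}" y a] component_orth[OF C _ that(2,3)] that(1) by (simp add: span_base)
  have 1: "prod_of (map reflect bs) x = prod_of (map reflect bs') x"
    using distinct orth_bs bs' orth assms by (intro prod_reflect_restrict) (auto simp: \<Delta>_def)
  let ?y = "prod_of (map reflect bs') x"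
  have "?y \<in> span C" using assms bs'(2) by (intro prod_reflect_span_closed) auto
  then have "prod_of (map reflect as) ?y = prod_of (map reflect as') ?y"
    using distinct orth_as as' orth by (intro prod_reflect_restrict) (auto simp: \<Delta>_def)
  then show ?thesis by (simp add: coxeter_element_def \<gamma> 1)
qed

lemma coxeter_component_eq: "coxeter_element as' bs' = prod_of (map reflect (as' @ bs'))"
  by (simp add: coxeter_element_def prod_of_append)

lemma \<rho>_mem: "\<rho> k \<in> \<Phi> \<and> \<rho> k \<in> span C"
proof (induction k rule: less_induct)
  case (less k)
  have C\<Phi>: "C \<subseteq> \<Phi>" using component_subset[OF C] \<Delta>_subset by blast
  have cox: "coxeter_element as' bs' x \<in> \<Phi> \<and> coxeter_element as' bs' x \<in> span C" if "x \<in> \<Phi>" "x \<in> span C" for x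
    using that \<gamma>_root \<gamma>_component prod_reflect_span_closed[of x C "as' @ bs'"] C_eq
    by (metis coxeter_component_eq order_refl)
  consider "k < length as'" | "length as' \<le> k" "k < n" | "n \<le> k" unfolding n_def by linarith
  then show ?case
  proof cases
    case 1
    then have "as' ! k \<in> C" using C_eq by auto
    then show ?thesis using 1 C\<Phi> by (auto simp: bip_root_simple_left intro: span_base)
  next
    case 2
    then have "bs' ! (k - length as') \<in> C" using C_eq by (auto simp: n_def)
    then show ?thesis using 2 C\<Phi> cox[of "bs' ! (k - length as')"]
      by (auto simp: bip_root_simple_right n_def intro: span_base span_neg \<Phi>_minus)
  next
    case 3
    then have "\<rho> (k - n) \<in> \<Phi> \<and> \<rho> (k - n) \<in> span C" using less.IH[of "k - n"] n_pos by simp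
    moreover have "\<rho> k = coxeter_element as' bs' (\<rho> (k - n))"
      using bip_root_shift[of as' bs' "k - n"] n_pos 3 by (simp add: n_def)
    ultimately show ?thesis using cox by simp
  qed
qed

lemma \<rho>_shift: "\<rho> (k + n) = \<gamma> (\<rho> k)"
  using bip_root_shift[of as' bs' k] n_pos \<gamma>_component \<rho>_mem by (simp add: n_def)

lemma \<rho>_left: "k < length as' \<Longrightarrow> \<rho> k = as' ! k"
  by (rule bip_root_simple_left)

lemma \<rho>_right: "length as' \<le> k \<Longrightarrow> k < n \<Longrightarrow> \<rho> k = - \<gamma> (bs' ! (k - length as'))"
proof -
  assume k: "length as' \<le> k" "k < n"
  then have "bs' ! (k - length as') \<in> C" using C_eq by (auto simp: n_def)
  then show ?thesis using bip_root_simple_right[of as' k bs'] k \<gamma>_component by (simp add: n_def span_base)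
qed

lemma prefix_short: "q \<le> n \<Longrightarrow> prefix q = prod_of (map reflect (take q (as' @ bs')))"
  unfolding prefix_def
  by (intro arg_cong[of _ _ prod_of] nth_equalityI) (auto simp: n_def word_def nth_append)

lemma prefix_append: "j \<le> q \<Longrightarrow> prefix q = prefix j \<circ> prod_of (map (\<lambda>i. reflect (word i)) [j..<q])"
  unfolding prefix_def prod_of_append[symmetric] map_append[symmetric]
  by (metis le_add_diff_inverse upt_add_eq_append zero_le)

lemma prefix_shift: "prefix (q + n) = coxeter_element as' bs' \<circ> prefix q"
proof -
  have "prefix (q + n) = prefix n \<circ> prod_of (map (\<lambda>i. reflect (word i)) [n..<q + n])"
    by (rule prefix_append) simp
  also have "[n..<q + n] = map (\<lambda>i. i + n) [0..<q]"
    using map_add_upt[of n q] by (simp add: add.commute)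
  also have "map (\<lambda>i. reflect (word i)) (map (\<lambda>i. i + n) [0..<q]) = map (\<lambda>i. reflect (word i)) [0..<q]"
    by (simp add: word_def o_def)
  also have "prefix n = coxeter_element as' bs'"
    by (simp add: prefix_short coxeter_component_eq n_def)
  finally show ?thesis unfolding prefix_def .
qed

lemma linear_prefix: "linear (prefix q)"
proof -
  have "orthogonal_transformation (prefix q)"
    unfolding prefix_def by (rule orthogonal_transformation_prod_of) (auto simp: orthogonal_transformation_reflect)
  then show ?thesis by (simp add: orthogonal_transformation_def)
qed

lemma inj_prefix: "inj (prefix q)"
  unfolding prefix_def by (rule bij_is_inj[OF bij_prod_of]) (auto simp: bij_reflect)

text \<open>The classical description of the root attached to a letter of a word: the letter
  transported by all earlier reflections. It makes the exchange argument available for the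
  recursively defined roots.\<close>

lemma \<rho>_eq_prefix: "\<rho> q = prefix q (word q)"
proof (induction q rule: less_induct)
  case (less q)
  consider "q < length as'" | "length as' \<le> q" "q < n" | "n \<le> q" unfolding n_def by linarith
  then show ?case
  proof cases
    case 1
    have "prefix q (as' ! q) = as' ! q"
    proof -
      have "as' ! q \<bullet> a = 0" if a: "a \<in> set (take q as')" for a
      proof -
        obtain i where i: "i < q" "a = as' ! i" using a 1 by (auto simp: in_set_conv_nth)
        then have "a \<noteq> as' ! q" using 1 as'(1) by (simp add: nth_eq_iff_index_eq)
        moreover have "a \<in> set as" "as' ! q \<in> set as" using 1 i as'(2) nth_mem[of q as'] nth_mem[of i as'] by auto
        ultimately show ?thesis using orth_as by (auto simp: pairwise_def orthogonal_def)
      qed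
      then show ?thesis using 1 prefix_short[of q] prod_reflect_orth[of "take q as'" "as' ! q"] by (simp add: n_def)
    qed
    then show ?thesis using 1 by (simp add: \<rho>_left word_def n_def nth_append)
  next
    case 2
    define b where "b = bs' ! (q - length as')"
    define ds where "ds = drop (Suc (q - length as')) bs'"
    have w: "word q = b" using 2 by (simp add: word_def n_def nth_append b_def)
    have q': "q - length as' < length bs'" using 2 by (simp add: n_def)
    have split: "as' @ bs' = take q (as' @ bs') @ b # ds"
      using 2 q' by (simp add: b_def ds_def id_take_nth_drop[symmetric])
    have bbs: "b \<in> set bs'" using q' by (simp add: b_def)
    have "distinct (b # ds)" using distinct' split by (metis distinct_append)
    then have "b \<bullet> a = 0" if "a \<in> set ds" for a
    proof -
      have "a \<in> set bs'" using that by (metis ds_def in_set_dropD)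
      then show ?thesis using \<open>distinct (b # ds)\<close> that bbs bs'(2) orth_bs
        by (auto simp: pairwise_def orthogonal_def)
    qed
    then have fixb: "prod_of (map reflect ds) b = b" by (rule prod_reflect_orth)
    \<comment> \<open>The letters after \<open>b\<close> belong to the same orthogonal half and fix
      it, its own reflection negates it, and the prefix before it remains.\<close>
    have "coxeter_element as' bs' b = prod_of (map reflect (take q (as' @ bs') @ b # ds)) b"
      using arg_cong[OF split, of "\<lambda>l. prod_of (map reflect l) b"] unfolding coxeter_component_eq .
    also have "\<dots> = prefix q (- b)"
      using prefix_short[of q] 2 by (simp add: prod_of_append fixb)
    finally have "coxeter_element as' bs' b = - prefix q b"
      by (simp add: linear_neg[OF linear_prefix])
    then show ?thesis using 2 w bip_root_simple_right[of as' q bs'] by (simp add: n_def b_def)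
  next
    case 3
    then have "\<rho> q = coxeter_element as' bs' (\<rho> (q - n))"
      using bip_root_shift[of as' bs' "q - n"] n_pos by (simp add: n_def)
    also have "\<rho> (q - n) = prefix (q - n) (word (q - n))" using less 3 n_pos by simp
    also have "word (q - n) = word q" using 3 by (simp add: word_def le_mod_geq)
    finally show ?thesis using prefix_shift[of "q - n"] 3 by simp
  qed
qed

text \<open>Pulled back by the prefix, a coincidence makes consecutive letters proportional although
  they are different simple roots. In rank one the letters do coincide, but there the Coxeter number
  is at most 2 and \<open>Suc i\<close> is not a valid index.\<close>

lemma consecutive_reflections_distinct:
  assumes "valid (Suc i)"
  shows "reflect (\<rho> i) \<noteq> reflect (\<rho> (Suc i))"
proof
  assume eq: "reflect (\<rho> i) = reflect (\<rho> (Suc i))"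
  have "n \<noteq> 1"
  proof
    assume n1: "n = 1"
    then obtain a where "as' @ bs' = [a]"
      by (metis One_nat_def length_0_conv length_Suc_conv length_append n_def)
    then have "coxeter_element as' bs' = reflect a" by (simp add: coxeter_component_eq)
    then have "coxeter_element as' bs' ^^ 2 = id" by (simp add: numeral_2_eq_2)
    then have "coxeter_number as' bs' \<le> 2" unfolding coxeter_number_def by (intro Least_le) simp
    then show False using assms n1 by (simp add: valid_def)
  qed
  then have "i mod n \<noteq> Suc i mod n" using n_pos by (simp add: mod_Suc)
  then have ne: "word i \<noteq> word (Suc i)"
    unfolding word_def using distinct' n_pos by (subst nth_eq_iff_index_eq) (auto simp: n_def)
  obtain c where c: "\<rho> (Suc i) = c *\<^sub>R \<rho> i" using reflect_eqD[OF eq] by blast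
  have "\<rho> (Suc i) = prefix i (reflect (word i) (word (Suc i)))"
    by (simp add: \<rho>_eq_prefix prefix_def prod_of_append)
  moreover have "c *\<^sub>R \<rho> i = prefix i (c *\<^sub>R word i)"
    by (simp add: \<rho>_eq_prefix linear_cmul[OF linear_prefix])
  ultimately have "prefix i (reflect (word i) (word (Suc i))) = prefix i (c *\<^sub>R word i)"
    using c by simp
  then have "reflect (word i) (word (Suc i)) = c *\<^sub>R word i"
    by (rule injD[OF inj_prefix])
  then have "word (Suc i) = (- c) *\<^sub>R word i"
    by (metis reflect_reflect reflect_scaleR reflect_self scaleR_minus_left scaleR_minus_right)
  then have "coef (word (Suc i)) (word (Suc i)) = - c * coef (word i) (word (Suc i))"
    using coef_scale by metis
  then show False using ne word_simple[of i] word_simple[of "Suc i"] by (simp add: coef_simple)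
qed

lemma valid_le: "valid j \<Longrightarrow> i \<le> j \<Longrightarrow> valid i"
  by (simp add: valid_def)

lemma r_\<rho>: "i \<le> j \<Longrightarrow> valid j \<Longrightarrow> (reflect (\<rho> i), reflect (\<rho> j)) \<in> r"
  using r_component unfolding valid_def n_def by blast

text \<open>A repetition at \<open>i < j\<close> puts the reflection with index \<open>Suc i\<close>
  both above and below that with index \<open>i\<close>; antisymmetry of \<open>r\<close> then
  contradicts the consecutive case.\<close>

lemma reflections_distinct:
  assumes "i < j" "valid j"
  shows "reflect (\<rho> i) \<noteq> reflect (\<rho> j)"
proof
  assume eq: "reflect (\<rho> i) = reflect (\<rho> j)"
  have v: "valid (Suc i)" by (rule valid_le[OF assms(2)]) (use assms in simp)
  have "(reflect (\<rho> i), reflect (\<rho> (Suc i))) \<in> r" using r_\<rho>[OF _ v] by simp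
  moreover have "(reflect (\<rho> (Suc i)), reflect (\<rho> i)) \<in> r"
    using r_\<rho>[of "Suc i" j] assms eq by simp
  ultimately show False using r_antisym consecutive_reflections_distinct[OF v] by blast
qed

text \<open>If \<open>\<rho> q\<close> were negative, the exchange argument would give \<open>\<rho> q = - \<rho> j\<close> for some \<open>j < q\<close>,
  contradicting the distinctness of the reflections.\<close>

lemma positive_\<rho>:
  assumes "valid q"
  shows "positive (\<rho> q)"
proof -
  \<comment> \<open>The root of the word with its first \<open>j\<close> letters stripped:
    \<open>x q\<close> is simple and \<open>x 0\<close> is \<open>\<rho> q\<close>, so letters can
    be restored one at a time from the right.\<close>
  define x where "x j = prod_of (map (\<lambda>i. reflect (word i)) [j..<q]) (word q)" for j
  have x: "\<rho> q = prefix j (x j)" if "j \<le> q" for j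
    using prefix_append[OF that] by (simp add: \<rho>_eq_prefix x_def)
  have step: "x j = reflect (word j) (x (Suc j))" if "j < q" for j
    using that by (simp add: x_def upt_conv_Cons)
  have "x (q - d) \<in> \<Phi> \<and> positive (x (q - d))" for d
  proof (induction d)
    case 0
    then show ?case using word_root word_simple positive_simple by (simp add: x_def)
  next
    case (Suc d)
    show ?case
    proof (cases "d < q")
      case True
      define j where "j = q - Suc d"
      have j: "j < q" "q - d = Suc j" using True by (auto simp: j_def)
      have IH: "x (Suc j) \<in> \<Phi>" "positive (x (Suc j))" using Suc j by auto
      have "x (Suc j) \<noteq> word j"
      proof
        assume eq: "x (Suc j) = word j"
        have "\<rho> q = prefix (Suc j) (word j)" using x[of "Suc j"] eq j by simp
        also have "\<dots> = - \<rho> j"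
          by (simp add: prefix_def prod_of_append \<rho>_eq_prefix linear_neg[OF linear_prefix, unfolded prefix_def])
        finally show False using reflections_distinct[OF j(1) assms] by simp
      qed
      then have "positive (x j)" "x j \<in> \<Phi>"
        using positive_reflect[OF IH word_simple] reflect_stable[OF word_root IH(1)] step[OF j(1)] by auto
      then show ?thesis by (simp add: j_def)
    next
      case False
      \<comment> \<open>Subtraction is truncated, so from \<open>d = q\<close> on the index rests at
        0.\<close>
      then have "q - Suc d = q - d" by simp
      then show ?thesis using Suc by simp
    qed
  qed
  from this[of q] show ?thesis using x[of 0] by (simp add: prefix_def)
qed

text \<open>For \<open>p < n\<close> the left root is in \<open>as'\<close> or of the form
  \<open>- \<gamma> b\<close> with \<open>b\<close> in \<open>bs'\<close>; in the second case
  \<open>B_serre\<close> moves \<open>b\<close> to the right slot. Either way a coefficient of the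
  positive root \<open>\<rho> q\<close> appears. Larger \<open>p\<close> are lowered by a period in
  both arguments.\<close>

lemma B_\<rho>_nonneg: "p \<le> q \<Longrightarrow> valid q \<Longrightarrow> B (\<rho> p) (\<rho> q) \<ge> 0"
proof (induction p arbitrary: q rule: less_induct)
  case (less p)
  have pos: "coef (\<rho> q) a \<ge> 0" if "a \<in> \<Delta>" for a
    using positive_\<rho>[OF less.prems(2)] that by (simp add: positive_def)
  consider "p < length as'" | "length as' \<le> p" "p < n" | "n \<le> p" unfolding n_def by linarith
  then show ?case
  proof cases
    case 1
    then have "as' ! p \<in> set as" using as'(2) nth_mem by blast
    then show ?thesis using 1 pos by (simp add: \<rho>_left B_left_coef \<Delta>_def)
  next
    case 2
    then have b: "bs' ! (p - length as') \<in> set bs" using bs'(2) nth_mem[of "p - length as'" bs'] by (auto simp: n_def)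
    have "B (\<rho> p) (\<rho> q) = B (\<rho> q) (bs' ! (p - length as'))"
      using B_serre[of "\<rho> q" "bs' ! (p - length as')"] by (simp add: \<rho>_right[OF 2] B_minus_left)
    moreover have "coef (\<rho> q) (bs' ! (p - length as')) \<ge> 0" using b by (intro pos) (simp add: \<Delta>_def)
    ultimately show ?thesis unfolding B_right_coef[OF b] by (metis mult_nonneg_nonneg inner_ge_zero divide_nonneg_pos zero_less_numeral)
  next
    case 3
    have "B (\<rho> (p - n)) (\<rho> (q - n)) \<ge> 0"
      using less 3 n_pos valid_le[of q "q - n"] by auto
    then show ?thesis
      using \<rho>_shift[of "p - n"] \<rho>_shift[of "q - n"] 3 less.prems(1) by (simp add: B_g)
  qed
qed

lemma B_\<rho>_block: 
  assumes "p < q" "q < n"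
  shows "B (\<rho> q) (\<rho> p) = 0"
proof -
  consider "q < length as'" | "p < length as'" "length as' \<le> q" | "length as' \<le> p" by linarith
  then show ?thesis
  proof cases
    case 1
    then have "as' ! p \<noteq> as' ! q" using as'(1) assms by (simp add: nth_eq_iff_index_eq)
    moreover have "as' ! p \<in> set as" "as' ! q \<in> set as"
      using 1 assms as'(2) nth_mem[of p as'] nth_mem[of q as'] by auto
    ultimately show ?thesis using 1 assms B_left_simple[of "as' ! q" "as' ! p"] by (simp add: \<rho>_left \<Delta>_def)
  next
    case 2
    then have "as' ! p \<in> set as" "bs' ! (q - length as') \<in> set bs"
      using assms as'(2) bs'(2) nth_mem[of p as'] nth_mem[of "q - length as'" bs'] by (auto simp: n_def)
    moreover from this have "as' ! p \<noteq> bs' ! (q - length as')" using distinct by auto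
    ultimately have "B (as' ! p) (bs' ! (q - length as')) = 0" using B_left_simple by (simp add: \<Delta>_def)
    then show ?thesis
      using B_serre[of "as' ! p" "bs' ! (q - length as')"] 2 assms by (simp add: \<rho>_left \<rho>_right B_minus_left)
  next
    case 3
    let ?b = "bs' ! (p - length as')" and ?c = "bs' ! (q - length as')"
    have "?b \<in> set bs" "?c \<in> set bs"
      using 3 assms bs'(2) nth_mem[of "p - length as'" bs'] nth_mem[of "q - length as'" bs'] by (auto simp: n_def)
    moreover have "?c \<noteq> ?b" using 3 assms bs'(1) by (auto simp: nth_eq_iff_index_eq n_def)
    ultimately have "B ?c ?b = 0" using B_right_simple by (simp add: \<Delta>_def)
    then show ?thesis using 3 assms by (simp add: \<rho>_right B_minus_left B_minus_right B_g)
  qed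
qed

text \<open>If the two indices straddle the end of the first period, \<open>B_serre\<close>
  exchanges the arguments and turns \<open>q\<close> into \<open>q - n < p\<close>, which is the
  case of a single period again.\<close>

lemma B_\<rho>_zero: "p < q \<Longrightarrow> q < p + n \<Longrightarrow> B (\<rho> q) (\<rho> p) = 0"
proof (induction p arbitrary: q rule: less_induct)
  case (less p)
  show ?case
  proof (cases "p < n")
    case True
    show ?thesis
    proof (cases "q < n")
      case False
      then have "\<rho> q = \<gamma> (\<rho> (q - n))" using \<rho>_shift[of "q - n"] by simp
      moreover have "B (\<rho> p) (\<rho> (q - n)) = 0" using False True less.prems by (intro B_\<rho>_block) auto
      ultimately show ?thesis using B_serre[of "\<rho> p" "\<rho> (q - n)"] by simp
    qed (use less.prems B_\<rho>_block in blast)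
  next
    case False
    then have "B (\<rho> (q - n)) (\<rho> (p - n)) = 0" using less n_pos by auto
    then show ?thesis using \<rho>_shift[of "p - n"] \<rho>_shift[of "q - n"] False less.prems(1) by (simp add: B_g)
  qed
qed

text \<open>From distance \<open>n\<close> on, \<open>B_serre\<close> gives minus
  \<open>B (\<rho> (p + n)) (\<rho> q)\<close>, whose indices are in increasing order; at smaller
  distance the value is zero.\<close>

lemma B_\<rho>_nonpos:
  assumes "p < q" "valid q"
  shows "B (\<rho> q) (\<rho> p) \<le> 0"
proof (cases "q < p + n")
  case False
  then have "B (\<rho> (p + n)) (\<rho> q) \<ge> 0" using assms(2) by (intro B_\<rho>_nonneg) auto
  then show ?thesis using B_serre[of "\<rho> q" "\<rho> p"] by (simp add: \<rho>_shift)
qed (use assms B_\<rho>_zero in simp)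

text \<open>Since \<open>B\<close> vanishes on the pair \<open>i\<close>, \<open>j\<close>, two
  pairings isolate the coefficients and give \<open>y \<ge> 0\<close> and \<open>x \<le> 0\<close>.
  The pairing of \<open>\<rho> m\<close> with \<open>\<rho> i\<close> then forces
  \<open>x = 0\<close>, so two different indices would carry the same reflection.\<close>

lemma B_\<rho>_rank_two:
  assumes ij: "i < j" "valid j" and mi: "m < i" and B0: "B (\<rho> i) (\<rho> j) = 0"
    and m: "\<rho> m = x *\<^sub>R \<rho> i + y *\<^sub>R \<rho> j"
  shows False
proof -
  have valid: "valid i" "valid m" using valid_le[OF ij(2)] ij mi by auto
  have nz: "\<rho> k \<noteq> 0" for k using \<rho>_mem zero_notin_\<Phi> by metis
  have pos: "B (\<rho> k) (\<rho> k) > 0" for k using nz[of k] by (simp add: B_self)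
  have "B (\<rho> m) (\<rho> j) = y * B (\<rho> j) (\<rho> j)" by (simp add: m B_add_left B_scaleR_left B0)
  then have y: "y \<ge> 0" using B_\<rho>_nonneg[of m j] pos[of j] ij mi by (simp add: zero_le_mult_iff)
  have "B (\<rho> i) (\<rho> m) = x * B (\<rho> i) (\<rho> i)" by (simp add: m B_add_right B_scaleR_right B0)
  then have x: "x \<le> 0" using B_\<rho>_nonpos[OF mi valid(1)] pos[of i] by (simp add: mult_le_0_iff)
  have "B (\<rho> m) (\<rho> i) = x * B (\<rho> i) (\<rho> i) + y * B (\<rho> j) (\<rho> i)" by (simp add: m B_add_left B_scaleR_left)
  moreover have "B (\<rho> m) (\<rho> i) \<ge> 0" using B_\<rho>_nonneg[of m i] mi valid by simp
  moreover have "y * B (\<rho> j) (\<rho> i) \<le> 0" using y B_\<rho>_nonpos[OF ij] by (simp add: mult_le_0_iff)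
  ultimately have "x * B (\<rho> i) (\<rho> i) \<ge> 0" by linarith
  then have "x = 0" using x pos[of i] by (simp add: zero_le_mult_iff)
  then have eq: "\<rho> m = y *\<^sub>R \<rho> j" using m by simp
  then have "y \<noteq> 0" using nz[of m] by auto
  then have "reflect (\<rho> m) = reflect (\<rho> j)" using eq reflect_scale by metis
  then show False using reflections_distinct[of m j] ij mi by simp
qed

end

section \<open>Rank two planes and ascents in factorizations of the Coxeter element\<close>

context bipartite_reflection_group
begin

lemma obtain_component_order:
  assumes "C \<in> irreducible_components \<Delta>"
  obtains as' bs' where "component_order W \<Phi> as bs r \<gamma> C as' bs'"
proof -
  have "\<exists>as' bs'. distinct as' \<and> set as' = set as \<inter> C \<and> distinct bs' \<and> set bs' = set bs \<inter> C \<and>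
    r \<inter> reflections (generated_by (reflect ` C)) \<times> reflections (generated_by (reflect ` C)) =
      {(reflect (bip_root as' bs' i), reflect (bip_root as' bs' j)) | i j.
         i \<le> j \<and> 2 * j < (length as' + length bs') * coxeter_number as' bs'}"
    using order assms unfolding admissible_order_def \<Delta>_def Let_def by (elim conjE) (erule (1) bspec)
  then obtain as' bs' where "distinct as'" "set as' = set as \<inter> C" "distinct bs'" "set bs' = set bs \<inter> C"
    "r \<inter> reflections (generated_by (reflect ` C)) \<times> reflections (generated_by (reflect ` C)) =
      {(reflect (bip_root as' bs' i), reflect (bip_root as' bs' j)) | i j.
         i \<le> j \<and> 2 * j < (length as' + length bs') * coxeter_number as' bs'}"
    by (elim exE conjE)
  then have "component_order W \<Phi> as bs r \<gamma> C as' bs'"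
    using assms by (intro component_order.intro component_order_axioms.intro bipartite_reflection_group_axioms)
  then show thesis by (rule that)
qed

text \<open>Across components, \<open>\<delta>\<close> lies in the span of a single component and is
  therefore proportional to \<open>\<alpha>\<close> or \<open>\<beta>\<close>. Inside one component
  this is \<open>B_\<rho>_rank_two\<close> after rescaling the roots.\<close>

lemma rank_two_minimal:
  assumes roots: "\<alpha> \<in> \<Phi>" "\<beta> \<in> \<Phi>" "\<delta> \<in> \<Phi>" and B0: "B \<alpha> \<beta> = 0"
    and less: "(reflect \<alpha>, reflect \<beta>) \<in> r" "reflect \<alpha> \<noteq> reflect \<beta>"
    and span: "\<delta> \<in> span {\<alpha>, \<beta>}"
  shows "(reflect \<alpha>, reflect \<delta>) \<in> r"
proof -
  have nz: "\<alpha> \<noteq> 0" "\<beta> \<noteq> 0" "\<delta> \<noteq> 0" using roots zero_notin_\<Phi> by auto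
  have refl: "reflect b \<in> reflections W" if "b \<in> \<Phi>" for b using that reflections_eq by blast
  obtain x y where xy: "\<delta> = x *\<^sub>R \<alpha> + y *\<^sub>R \<beta>"
  proof -
    obtain x where "\<delta> - x *\<^sub>R \<alpha> \<in> span {\<beta>}" using span by (auto simp: span_breakdown_eq)
    then obtain y where "\<delta> - x *\<^sub>R \<alpha> - y *\<^sub>R \<beta> = 0" by (auto simp: span_breakdown_eq)
    then show thesis using that[of x y] by (simp add: algebra_simps)
  qed
  obtain A where A: "A \<in> irreducible_components \<Delta>" "\<alpha> \<in> span A" "reflect \<alpha> \<in> generated_by (reflect ` A)"
    using root_component[OF roots(1)] .
  obtain A' where A': "A' \<in> irreducible_components \<Delta>" "\<beta> \<in> span A'" "reflect \<beta> \<in> generated_by (reflect ` A')"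
    using root_component[OF roots(2)] .
  obtain D where D: "D \<in> irreducible_components \<Delta>" "\<delta> \<in> span D" "reflect \<delta> \<in> generated_by (reflect ` D)"
    using root_component[OF roots(3)] .
  show ?thesis
  proof (cases "A = A'")
    case False
    have ab: "\<alpha> \<bullet> \<beta> = 0" by (rule components_orthogonal[OF A(1) A'(1) False A(2) A'(2)])
    have "x = 0 \<or> y = 0"
    proof (cases "D = A")
      case True
      then have "\<delta> \<bullet> \<beta> = 0" using components_orthogonal[OF A(1) A'(1) False _ A'(2)] D(2) by simp
      then have "y = 0" using nz by (simp add: xy inner_add_left ab)
      then show ?thesis ..
    next
      case False
      then have "\<delta> \<bullet> \<alpha> = 0" by (rule components_orthogonal[OF D(1) A(1) _ D(2) A(2)])
      moreover have "\<beta> \<bullet> \<alpha> = 0" using ab by (simp add: inner_commute)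
      ultimately have "x = 0" using nz by (simp add: xy inner_add_left)
      then show ?thesis ..
    qed
    then have "reflect \<delta> = reflect \<alpha> \<or> reflect \<delta> = reflect \<beta>"
      using nz by (auto simp: xy reflect_scale)
    then show ?thesis using less r_refl[OF refl[OF roots(1)]] by auto
  next
    case True
    have "\<delta> \<in> span A"
      unfolding xy using A(2) A'(2) True by (intro span_add span_mul) auto
    have "D = A"
    proof (rule ccontr)
      assume "D \<noteq> A"
      then have "\<delta> \<bullet> \<delta> = 0" by (rule components_orthogonal[OF D(1) A(1) _ D(2) \<open>\<delta> \<in> span A\<close>])
      then show False using nz by simp
    qed
    obtain as' bs' where "component_order W \<Phi> as bs r \<gamma> A as' bs'"
      using obtain_component_order[OF A(1)] .
    then interpret component_order W \<Phi> as bs r \<gamma> A as' bs' .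
    have T: "reflect \<alpha> \<in> reflections (generated_by (reflect ` A))" "reflect \<beta> \<in> reflections (generated_by (reflect ` A))"
      "reflect \<delta> \<in> reflections (generated_by (reflect ` A))"
      using A(3) A'(3) D(3) True \<open>D = A\<close> nz by (auto simp: reflections_def is_reflection_def)
    have index: "\<exists>i j. i \<le> j \<and> valid j \<and> s = reflect (\<rho> i) \<and> t = reflect (\<rho> j)"
      if "(s, t) \<in> r" "s \<in> reflections (generated_by (reflect ` A))" "t \<in> reflections (generated_by (reflect ` A))" for s t
    proof -
      have "(s, t) \<in> r \<inter> reflections (generated_by (reflect ` A)) \<times> reflections (generated_by (reflect ` A))"
        using that by blast
      then show ?thesis unfolding r_component valid_def n_def by blast
    qed
    show ?thesis
    proof (rule ccontr)
      assume "(reflect \<alpha>, reflect \<delta>) \<notin> r"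
      then have \<delta>\<alpha>: "(reflect \<delta>, reflect \<alpha>) \<in> r" "reflect \<delta> \<noteq> reflect \<alpha>"
        using r_total[OF refl[OF roots(1)] refl[OF roots(3)]] by auto
      obtain i j where ij: "i \<le> j" "valid j" "reflect \<alpha> = reflect (\<rho> i)" "reflect \<beta> = reflect (\<rho> j)"
        using index[OF less(1) T(1,2)] by blast
      obtain m i' where mi: "m \<le> i'" "valid i'" "reflect \<delta> = reflect (\<rho> m)" "reflect \<alpha> = reflect (\<rho> i')"
        using index[OF \<delta>\<alpha>(1) T(3,1)] by blast
      \<comment> \<open>The two comparisons index \<open>reflect \<alpha>\<close> separately;
        distinctness of the listed reflections identifies the indices.\<close>
      have "i' = i"
        using reflections_distinct[of i i'] reflections_distinct[of i' i] valid_le[OF ij(2,1)] mi ij(3)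
        by (metis linorder_neqE_nat)
      have "i < j" "m < i" using ij mi less(2) \<delta>\<alpha>(2) \<open>i' = i\<close> by (auto simp: order_less_le)
      obtain a where a: "\<rho> i = a *\<^sub>R \<alpha>" using reflect_eqD[OF ij(3)] by blast
      obtain b where b: "\<rho> j = b *\<^sub>R \<beta>" using reflect_eqD[OF ij(4)] by blast
      obtain d where d: "\<rho> m = d *\<^sub>R \<delta>" using reflect_eqD[OF mi(3)] by blast
      have "a \<noteq> 0" "b \<noteq> 0" using a b \<rho>_mem zero_notin_\<Phi> by (metis scale_zero_left)+
      have "B (\<rho> i) (\<rho> j) = 0" by (simp add: a b B_scaleR_left B_scaleR_right B0)
      moreover have "\<rho> m = (d * x / a) *\<^sub>R \<rho> i + (d * y / b) *\<^sub>R \<rho> j"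
        using \<open>a \<noteq> 0\<close> \<open>b \<noteq> 0\<close> by (simp add: d xy a b scaleR_add_right)
      ultimately show False using B_\<rho>_rank_two[OF \<open>i < j\<close> ij(2) \<open>m < i\<close>] by blast
    qed
  qed
qed

lemma reflections_roots:
  assumes "set ts \<subseteq> reflections W"
  obtains cs where "set cs \<subseteq> \<Phi>" "ts = map reflect cs"
proof (rule that)
  let ?h = "inv_into \<Phi> reflect"
  have mem: "?h t \<in> \<Phi> \<and> reflect (?h t) = t" if "t \<in> set ts" for t
    using assms that unfolding reflections_eq by (auto intro: inv_into_into f_inv_into_f)
  then show "set (map ?h ts) \<subseteq> \<Phi>" by auto
  show "ts = map reflect (map ?h ts)" by (rule nth_equalityI) (simp_all add: mem)
qed

text \<open>The outer words \<open>us\<close> and \<open>vs\<close> are kept because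
  \<open>B\<close> belongs to \<open>\<gamma>\<close>: a factorization of all of
  \<open>\<gamma>\<close> by at most \<open>DIM('a)\<close> reflections is what yields
  \<open>B \<alpha> \<beta> = 0\<close>. The equation for the two products places the root of
  \<open>s'\<close> in the plane.\<close>

lemma ascent_minimal:
  assumes refl: "set (us @ s # t # vs) \<subseteq> reflections W" and \<gamma>: "prod_of (us @ s # t # vs) = \<gamma>"
    and len: "length (us @ s # t # vs) \<le> DIM('a)"
    and less: "(s, t) \<in> r" "s \<noteq> t"
    and refl': "s' \<in> reflections W" "t' \<in> reflections W" and eq: "s' \<circ> t' = s \<circ> t"
  shows "(s, s') \<in> r"
proof -
  obtain cs where "set cs \<subseteq> \<Phi>" "us @ s # t # vs = map reflect cs"
    using reflections_roots[OF refl] .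
  then obtain us' \<alpha> \<beta> vs' where cs: "cs = us' @ \<alpha> # \<beta> # vs'" "us = map reflect us'" "s = reflect \<alpha>" "t = reflect \<beta>"
     "vs = map reflect vs'" "\<alpha> \<in> \<Phi>" "\<beta> \<in> \<Phi>"
    by (auto simp: append_eq_map_conv Cons_eq_map_conv)
  obtain \<delta> \<epsilon> where \<delta>: "\<delta> \<in> \<Phi>" "s' = reflect \<delta>" "\<epsilon> \<in> \<Phi>" "t' = reflect \<epsilon>"
    using refl' reflections_eq by auto
  have nz: "\<alpha> \<noteq> 0" "\<delta> \<noteq> 0" "\<epsilon> \<noteq> 0" using cs \<delta> zero_notin_\<Phi> by auto
  have "B \<alpha> \<beta> = 0"
    using B_eq_0'[of us' \<alpha> "\<beta> # vs'" \<beta>] \<gamma> len nz by (simp add: cs)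
  moreover have "reflect \<delta> \<noteq> reflect \<epsilon>"
  proof
    assume "reflect \<delta> = reflect \<epsilon>"
    then have "s \<circ> t = id" using eq \<delta> by simp
    then have "s \<circ> (s \<circ> t) = s" by simp
    then have "t = s" by (simp add: comp_assoc[symmetric] cs)
    then show False using less by simp
  qed
  then have "\<delta> \<in> span {\<alpha>, \<beta>}"
    using reflect_pair_span[of \<alpha> \<beta> \<delta> \<epsilon>] eq \<delta> cs nz by simp
  ultimately show ?thesis
    using rank_two_minimal[of \<alpha> \<beta> \<delta>] cs \<delta> less by simp
qed

lemma abs_length_\<gamma>: "abs_length W \<gamma> = DIM('a)"
proof -
  have simple: "set (map reflect (as @ bs)) \<subseteq> reflections W"
    using reflections_eq \<Delta>_subset by (auto simp: \<Delta>_def)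
  show ?thesis
    unfolding abs_length_def
  proof (rule Least_equality)
    show "\<exists>ts. set ts \<subseteq> reflections W \<and> length ts = DIM('a) \<and> prod_of ts = \<gamma>"
      using simple length_simple \<gamma>_eq by (intro exI[of _ "map reflect (as @ bs)"]) simp
  next
    fix k assume "\<exists>ts. set ts \<subseteq> reflections W \<and> length ts = k \<and> prod_of ts = \<gamma>"
    then obtain ts where ts: "set ts \<subseteq> reflections W" "length ts = k" "prod_of ts = \<gamma>" by blast
    obtain cs where "set cs \<subseteq> \<Phi>" "ts = map reflect cs" using reflections_roots[OF ts(1)] .
    then show "DIM('a) \<le> k" using length_ge_DIM[of cs] ts by simp
  qed
qed

end

section \<open>Cycles from the Hurwitz action\<close>

text \<open>An expansion in base \<open>M\<close> with the first entry most significant: when all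
  ranks are below \<open>M\<close>, lexicographic comparison of lists of equal length becomes
  comparison of natural numbers.\<close>

fun lex_code :: "('b \<Rightarrow> nat) \<Rightarrow> nat \<Rightarrow> 'b list \<Rightarrow> nat" where
  "lex_code rk M [] = 0"
| "lex_code rk M (t # ts) = rk t * M ^ length ts + lex_code rk M ts"

lemma lex_code_less:
  assumes "\<And>t. t \<in> set ts \<Longrightarrow> rk t < M"
  shows "lex_code rk M ts < M ^ length ts"
  using assms
proof (induction ts)
  case (Cons t ts)
  then have "lex_code rk M ts < M ^ length ts" "Suc (rk t) \<le> M" by (auto simp: Suc_le_eq)
  then have "lex_code rk M (t # ts) < Suc (rk t) * M ^ length ts" by simp
  also have "\<dots> \<le> M * M ^ length ts" using \<open>Suc (rk t) \<le> M\<close> by (rule mult_le_mono1)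
  finally show ?case by simp
qed simp

lemma lex_code_mono:
  assumes "length xs = length ys" "i < length xs" "take i xs = take i ys" "rk (xs ! i) < rk (ys ! i)"
    and "\<And>t. t \<in> set xs \<Longrightarrow> rk t < M"
  shows "lex_code rk M xs < lex_code rk M ys"
  using assms
proof (induction xs arbitrary: ys i)
  case (Cons x xs)
  then obtain y ys' where ys: "ys = y # ys'" by (cases ys) auto
  show ?case
  proof (cases i)
    case 0
    have "lex_code rk M xs < M ^ length xs" using Cons.prems(5) by (intro lex_code_less) simp
    then have "lex_code rk M (x # xs) < Suc (rk x) * M ^ length xs" by simp
    also have "\<dots> \<le> rk y * M ^ length xs"
      using Cons.prems(4) 0 ys by (intro mult_le_mono1) simp
    finally show ?thesis using ys Cons.prems(1) by simp
  next
    case (Suc j)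
    have "lex_code rk M xs < lex_code rk M ys'"
      by (rule Cons.IH[of ys' j]) (use Cons.prems ys Suc in auto)
    then show ?thesis using Cons.prems ys Suc by simp
  qed
qed simp

definition partial_prod :: "nat \<Rightarrow> ('a \<Rightarrow> 'a) list \<Rightarrow> 'a \<Rightarrow> 'a" where
  "partial_prod j ts = prod_of (take j ts)"

definition remove_at :: "nat \<Rightarrow> 'b list \<Rightarrow> 'b list" where
  "remove_at i us = take i us @ drop (Suc i) us"

lemma length_remove_at: "i < length us \<Longrightarrow> length (remove_at i us) = length us - 1"
  by (simp add: remove_at_def)

lemma nth_remove_at:
  "i < length us \<Longrightarrow> j < length us - 1 \<Longrightarrow> remove_at i us ! j = (if j < i then us ! j else us ! Suc j)"
  by (auto simp: remove_at_def nth_append)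

lemma length_chain_butlast [simp]: "length (chain_of (butlast ts)) = length ts - 1"
  by (simp add: chain_of_def)

text \<open>Vertex \<open>j\<close> is a product of \<open>Suc j\<close> factors; this shift
  explains the exceptional index \<open>Suc i\<close> whenever vertex \<open>i\<close> is
  removed.\<close>

lemma nth_chain_butlast:
  "j < length ts - 1 \<Longrightarrow> chain_of (butlast ts) ! j = partial_prod (Suc j) ts"
  by (simp add: chain_of_def partial_prod_def take_butlast)

lemma partial_prod_Suc: "j < length ts \<Longrightarrow> partial_prod (Suc j) ts = partial_prod j ts \<circ> ts ! j"
  by (simp add: partial_prod_def take_Suc_conv_app_nth prod_of_append)

text \<open>A move keeps the product of the two entries involved, so it can affect only the partial
  product that separates them.\<close>

lemma partial_prod_hurwitz:
  assumes "Suc i < length ts" "bij (ts ! Suc i)" "j \<noteq> Suc i"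
  shows "partial_prod j (hurwitz i ts) = partial_prod j ts"
proof (cases "j \<le> i")
  case True
  then show ?thesis using assms(1) by (simp add: partial_prod_def hurwitz_eq[OF assms(1)] min_def)
next
  case False
  then obtain d where j: "j = Suc (Suc (i + d))"
    using assms(3) by (metis less_iff_Suc_add not_le add_Suc_shift add_0_right add_Suc nat_less_le not_less_eq_eq Suc_leI)
  have "take j (hurwitz i ts) = take i ts @ [ts ! Suc i, conj_by (ts ! Suc i) (ts ! i)] @ take d (drop (Suc (Suc i)) ts)"
    using assms(1) by (simp add: hurwitz_eq[OF assms(1)] j min_def)
  moreover have "take j ts = take i ts @ [ts ! i, ts ! Suc i] @ take d (drop (Suc (Suc i)) ts)"
  proof -
    have "ts = take i ts @ [ts ! i, ts ! Suc i] @ drop (Suc (Suc i)) ts"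
      using assms(1) by (metis Cons_nth_drop_Suc Suc_lessD append_Cons append_Nil append_take_drop_id)
    then have "take j ts = take j (take i ts @ [ts ! i, ts ! Suc i] @ drop (Suc (Suc i)) ts)" by simp
    then show ?thesis using assms(1) by (simp add: j min_def)
  qed
  moreover have "ts ! Suc i \<circ> conj_by (ts ! Suc i) (ts ! i) = ts ! i \<circ> ts ! Suc i"
    by (rule comp_conj_by[OF assms(2)])
  ultimately show ?thesis
    by (simp add: partial_prod_def prod_of_append) (simp add: comp_assoc[symmetric])
qed

lemma remove_at_chain_eqI:
  assumes "length xs = length ys" "i < length xs - 1"
    and "\<And>j. j \<noteq> Suc i \<Longrightarrow> j < length xs \<Longrightarrow> partial_prod j xs = partial_prod j ys"
  shows "remove_at i (chain_of (butlast xs)) = remove_at i (chain_of (butlast ys))"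
proof (rule nth_equalityI)
  show "length (remove_at i (chain_of (butlast xs))) = length (remove_at i (chain_of (butlast ys)))"
    using assms by (simp add: length_remove_at)
  fix j assume "j < length (remove_at i (chain_of (butlast xs)))"
  then have "j < length xs - 1 - 1" using assms by (simp add: length_remove_at)
  then show "remove_at i (chain_of (butlast xs)) ! j = remove_at i (chain_of (butlast ys)) ! j"
    using assms by (auto simp: nth_remove_at nth_chain_butlast)
qed

lemma frag_eq_neg_imp_0: "x = - x \<Longrightarrow> (x :: 'b \<Rightarrow>\<^sub>0 int) = 0"
proof (rule poly_mapping_eqI)
  fix i assume "x = - x"
  then have "Poly_Mapping.lookup x i = - Poly_Mapping.lookup x i"
    by (metis lookup_uminus uminus_apply)
  then show "Poly_Mapping.lookup x i = Poly_Mapping.lookup 0 i" by simp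
qed

lemma simplicial_boundary_frag_of:
  "simplicial_boundary (frag_of us) = (\<Sum>i<length us. frag_cmul ((- 1) ^ i) (frag_of (remove_at i us)))"
  by (simp add: simplicial_boundary_def remove_at_def)

lemma simplicial_boundary_diff: "simplicial_boundary (c - c') = simplicial_boundary c - simplicial_boundary c'"
  and simplicial_boundary_cmul: "simplicial_boundary (frag_cmul n c) = frag_cmul n (simplicial_boundary c)"
  by (simp_all add: simplicial_boundary_def frag_extend_diff frag_extend_cmul)

lemma simplicial_boundary_sum: "finite I \<Longrightarrow> simplicial_boundary (\<Sum>i\<in>I. f i) = (\<Sum>i\<in>I. simplicial_boundary (f i))"
  by (simp add: simplicial_boundary_def frag_extend_sum)

definition chain_map :: "(('a \<Rightarrow> 'a) list \<Rightarrow>\<^sub>0 int) \<Rightarrow> (('a \<Rightarrow> 'a) list \<Rightarrow>\<^sub>0 int)" where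
  "chain_map = frag_extend (\<lambda>ts. frag_of (chain_of (butlast ts)))"

lemma as_chains_truncation: "as_chains (truncation c) = chain_map c"
  unfolding as_chains_def truncation_def chain_map_def
  by (rule frag_extend_compose[of "\<lambda>ts. frag_of (chain_of ts)" butlast, unfolded o_def])

lemma chain_map_frag_of: "chain_map (frag_of ts) = frag_of (chain_of (butlast ts))"
  by (simp add: chain_map_def)

lemma chain_map_add: "chain_map (c + c') = chain_map c + chain_map c'"
  and chain_map_diff: "chain_map (c - c') = chain_map c - chain_map c'"
  and chain_map_cmul: "chain_map (frag_cmul n c) = frag_cmul n (chain_map c)"
  by (simp_all add: chain_map_def frag_extend_add frag_extend_diff frag_extend_cmul)

lemma chain_map_sum: "finite I \<Longrightarrow> chain_map (\<Sum>i\<in>I. f i) = (\<Sum>i\<in>I. chain_map (f i))"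
  by (simp add: chain_map_def frag_extend_sum)

lemma chain_map_frag_extend: "chain_map (frag_extend b c) = frag_extend (\<lambda>i. chain_map (b i)) c"
proof -
  have "Poly_Mapping.keys c \<subseteq> UNIV" by simp
  then show ?thesis
  proof (induction c rule: frag_induction)
    case (diff x y)
    then show ?case by (simp add: frag_extend_diff chain_map_diff)
  qed (simp_all add: chain_map_def)
qed

lemma simplicial_boundary_chain_map:
  "simplicial_boundary (chain_map c) =
     frag_extend (\<lambda>ts. \<Sum>i<length ts - 1. frag_cmul ((- 1) ^ i) (frag_of (remove_at i (chain_of (butlast ts))))) c"
proof -
  have "Poly_Mapping.keys c \<subseteq> UNIV" by simp
  then show ?thesis
  proof (induction c rule: frag_induction)
    case (diff x y)
    then show ?case by (simp add: frag_extend_diff chain_map_diff simplicial_boundary_diff)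
  next
    case (one ts)
    then show ?case by (simp add: chain_map_frag_of simplicial_boundary_frag_of)
  qed (simp add: chain_map_def simplicial_boundary_def)
qed

section \<open>Reduced factorizations, their codes, and the cycles \<open>beta\<close>\<close>

context bipartite_reflection_group
begin

lemma reflection_bij: "t \<in> reflections W \<Longrightarrow> bij t"
  using reflections_eq bij_reflect by auto

lemma prod_bij: "set ts \<subseteq> reflections W \<Longrightarrow> bij (prod_of ts)"
  by (rule bij_prod_of) (auto intro: reflection_bij)

lemma conj_reflection: "s \<in> reflections W \<Longrightarrow> t \<in> reflections W \<Longrightarrow> conj_by t s \<in> reflections W"
proof -
  assume "s \<in> reflections W" "t \<in> reflections W"
  then obtain a b where ab: "a \<in> \<Phi>" "s = reflect a" "b \<in> \<Phi>" "t = reflect b" by (auto simp: reflections_eq)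
  have "inv (reflect b) = reflect b" by (rule inv_unique_comp) simp_all
  then have "conj_by t s = reflect (reflect b a) \<circ> (reflect b \<circ> reflect b)"
    using orthogonal_transformation_reflect_comp[OF orthogonal_transformation_reflect, of b a]
    by (simp add: conj_by_def ab comp_assoc[symmetric] del: reflect_comp_reflect)
  then show ?thesis using reflect_stable[OF ab(3,1)] by (simp add: reflections_eq)
qed

lemma finite_reflections: "finite (reflections W)"
  using reflections_eq finite_\<Phi> by simp

lemma prod_in_W: "set ts \<subseteq> reflections W \<Longrightarrow> prod_of ts \<in> W"
  by (subst W_generated) (auto simp: generated_by_def)

lemma abs_length_le: "set ts \<subseteq> reflections W \<Longrightarrow> abs_length W (prod_of ts) \<le> length ts"
  unfolding abs_length_def by (rule Least_le) blast

lemma ex_rex: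
  assumes "x \<in> W"
  obtains ts where "ts \<in> rex W x"
proof -
  have "x \<in> generated_by (reflections W)" using assms W_generated by simp
  then have "\<exists>k ts. set ts \<subseteq> reflections W \<and> length ts = k \<and> prod_of ts = x"
    by (auto simp: generated_by_def)
  then have "\<exists>ts. set ts \<subseteq> reflections W \<and> length ts = abs_length W x \<and> prod_of ts = x"
    unfolding abs_length_def by (rule LeastI_ex)
  then show thesis using that by (auto simp: rex_def)
qed

lemma rexD:
  assumes "ts \<in> rex W x"
  shows "set ts \<subseteq> reflections W" "length ts = abs_length W x" "prod_of ts = x" "x \<in> W"
  using assms prod_in_W by (auto simp: rex_def)

text \<open>A shorter factorization of either part would shorten the factorization of
  \<open>x\<close>.\<close>

lemma rex_appendD:
  assumes "us @ vs \<in> rex W x"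
  shows "us \<in> rex W (prod_of us)" "vs \<in> rex W (prod_of vs)"
proof -
  note x = rexD[OF assms]
  have uv: "set us \<subseteq> reflections W" "set vs \<subseteq> reflections W" using x by auto
  obtain us' where us': "us' \<in> rex W (prod_of us)" using ex_rex prod_in_W uv by blast
  obtain vs' where vs': "vs' \<in> rex W (prod_of vs)" using ex_rex prod_in_W uv by blast
  have "prod_of (us' @ vs') = x" using rexD(3)[OF us'] rexD(3)[OF vs'] x(3) by (simp add: prod_of_append)
  then have "abs_length W x \<le> length (us' @ vs')"
    using abs_length_le[of "us' @ vs'"] rexD(1)[OF us'] rexD(1)[OF vs'] by auto
  then have "length us + length vs \<le> length us' + length vs'" using x(2) by simp
  moreover have "length us' \<le> length us" "length vs' \<le> length vs"
    using abs_length_le uv rexD(2)[OF us'] rexD(2)[OF vs'] by auto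
  ultimately have "length us = length us'" "length vs = length vs'" by auto
  then show "us \<in> rex W (prod_of us)" "vs \<in> rex W (prod_of vs)"
    using uv rexD(2)[OF us'] rexD(2)[OF vs'] by (auto simp: rex_def)
qed

lemma inv_prod_append:
  "set us \<subseteq> reflections W \<Longrightarrow> inv (prod_of us) \<circ> prod_of (us @ vs) = prod_of vs"
  using prod_bij[of us] by (simp add: prod_of_append fun_eq_iff bij_is_inj)

lemma abs_le_append:
  assumes "us @ vs \<in> rex W x"
  shows "abs_le W (prod_of us) x"
proof -
  have us: "set us \<subseteq> reflections W" using rexD(1)[OF assms] by simp
  have "inv (prod_of us) \<circ> x = prod_of vs"
    using inv_prod_append[OF us, of vs] rexD(3)[OF assms] by simp
  then show ?thesis
    using rexD(2)[OF assms] rexD(2)[OF rex_appendD(1)[OF assms]] rexD(2)[OF rex_appendD(2)[OF assms]]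
    by (simp add: abs_le_def)
qed

lemma rex_appendI:
  assumes "abs_le W u v" "us \<in> rex W u" "vs \<in> rex W (inv u \<circ> v)"
  shows "us @ vs \<in> rex W v"
proof -
  have "bij u" using prod_bij[OF rexD(1)[OF assms(2)]] rexD(3)[OF assms(2)] by simp
  then have "u \<circ> (inv u \<circ> v) = v" by (simp add: fun_eq_iff bij_is_surj surj_f_inv_f)
  then show ?thesis
    using assms(1) rexD[OF assms(2)] rexD[OF assms(3)] by (simp add: rex_def prod_of_append abs_le_def)
qed

lemma inv_comp_in_W:
  assumes "u \<in> W" "v \<in> W"
  shows "inv u \<circ> v \<in> W"
proof -
  obtain us where us: "us \<in> rex W u" using ex_rex[OF assms(1)] .
  have "inv u = prod_of (rev us)"
    using prod_of_rev[OF rexD(1)[OF us]] rexD(3)[OF us] inv_unique_comp by metis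
  then have "inv u \<in> W" using prod_in_W[of "rev us"] rexD(1)[OF us] by simp
  then show ?thesis using W_comp assms(2) by blast
qed

lemma id_in_W: "id \<in> W"
  using prod_in_W[of "[]"] by simp

lemma abs_length_id: "abs_length W id = 0"
  using abs_length_le[of "[]"] by simp

lemma rex_hurwitz:
  assumes "ts \<in> rex W x" "Suc i < length ts"
  shows "hurwitz i ts \<in> rex W x"
proof -
  note ts = rexD[OF assms(1)]
  have mem: "ts ! i \<in> reflections W" "ts ! Suc i \<in> reflections W" using ts(1) assms(2) by auto
  have "set (hurwitz i ts) \<subseteq> reflections W"
    using ts(1) conj_reflection[OF mem] mem hurwitz_eq[OF assms(2)] set_take_subset[of i ts] set_drop_subset[of "Suc (Suc i)" ts]
    by auto
  moreover have "prod_of (hurwitz i ts) = prod_of ts"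
    using partial_prod_hurwitz[OF assms(2) reflection_bij[OF mem(2)], of "length ts"] assms(2)
    by (simp add: partial_prod_def)
  ultimately show ?thesis using ts by (simp add: rex_def)
qed

definition rk :: "('a \<Rightarrow> 'a) \<Rightarrow> nat" where
  "rk s = card {u \<in> reflections W. (u, s) \<in> r}"

text \<open>No rank exceeds the number of reflections, so its successor is a valid base.\<close>

definition code :: "('a \<Rightarrow> 'a) list \<Rightarrow> nat" where
  "code = lex_code rk (Suc (card (reflections W)))"

lemma rk_less: "rk s < Suc (card (reflections W))"
  unfolding rk_def less_Suc_eq_le by (rule card_mono[OF finite_reflections]) auto

lemma rk_mono:
  assumes "(s, t) \<in> r" "s \<noteq> t" "t \<in> reflections W"
  shows "rk s < rk t"
  unfolding rk_def
proof (rule psubset_card_mono)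
  show "finite {u \<in> reflections W. (u, t) \<in> r}" using finite_reflections by simp
  have "t \<notin> {u \<in> reflections W. (u, s) \<in> r}" using r_antisym assms by blast
  moreover have "t \<in> {u \<in> reflections W. (u, t) \<in> r}" using r_refl assms by simp
  moreover have "{u \<in> reflections W. (u, s) \<in> r} \<subseteq> {u \<in> reflections W. (u, t) \<in> r}"
    using r_trans assms by blast
  ultimately show "{u \<in> reflections W. (u, s) \<in> r} \<subset> {u \<in> reflections W. (u, t) \<in> r}" by blast
qed

lemma code_mono:
  "length xs = length ys \<Longrightarrow> i < length xs \<Longrightarrow> take i xs = take i ys \<Longrightarrow> rk (xs ! i) < rk (ys ! i) \<Longrightarrow>
    code xs < code ys"
  unfolding code_def by (rule lex_code_mono) (auto intro: rk_less)

text \<open>The comparison happens at the first position \<open>j\<close> moved by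
  \<open>inv p\<close>. Strands ending at or before \<open>j\<close> pass nothing and arrive
  unconjugated; at \<open>j\<close> itself arrives a later, hence smaller, entry of the decreasing
  sequence.\<close>

lemma code_lift_formula:
  assumes ts: "ts \<in> decreasing_rex W r x" and p: "p permutes {..<length ts}" "p \<noteq> id"
  shows "code (lift_formula (length ts) p ts) < code ts"
proof -
  let ?k = "length ts"
  have refls: "set ts \<subseteq> reflections W" and dec: "sorted_wrt (\<lambda>s t. (t, s) \<in> r \<and> t \<noteq> s) ts"
    using ts by (auto simp: decreasing_rex_def rex_def)
  define q where "q = inv p"
  have q: "q permutes {..<?k}" unfolding q_def by (rule permutes_inv[OF p(1)])
  have pq: "p (q i) = i" and qp: "q (p i) = i" for i
    unfolding q_def using permutes_inverses[OF p(1)] by auto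
  have "\<exists>j. q j \<noteq> j"
  proof (rule ccontr)
    assume "\<nexists>j. q j \<noteq> j"
    then have "p j = j" for j using pq[of j] by simp
    then show False using p(2) by auto
  qed
  define j where "j = (LEAST j. q j \<noteq> j)"
  have qj: "q j \<noteq> j" unfolding j_def using \<open>\<exists>j. q j \<noteq> j\<close> by (rule LeastI_ex)
  have fixed: "q i = i" if "i < j" for i using not_less_Least[of i "\<lambda>j. q j \<noteq> j"] that by (auto simp: j_def)
  have jk: "j < ?k" using qj permutes_not_in[OF q, of j] by auto
  have "q j < ?k" using permutes_in_image[OF q, of j] jk by simp
  have "j < q j"
  proof (rule ccontr)
    assume "\<not> j < q j"
    then have "q j < j" using qj by simp
    then have "q (q j) = q j" by (rule fixed)
    then show False using qj by (metis pq)
  qed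
  \<comment> \<open>A strand passed on the way to \<open>i\<close> ends before \<open>i\<close>,
    where \<open>q\<close> is the identity; it therefore also started before \<open>i\<close> and
    cannot lie to the right of \<open>q i\<close>.\<close>
  have cross: "crossed ?k p (q i) i = []" if "i \<le> j" for i
  proof -
    have "i \<le> q i" using that fixed[of i] \<open>j < q j\<close> by (cases "i = j") auto
    moreover have "m < i" if "p m < i" for m
      using fixed[of "p m"] that \<open>i \<le> j\<close> by (simp add: qp)
    ultimately show ?thesis unfolding crossed_def filter_empty_conv
      by (metis Suc_le_lessD atLeastLessThan_iff le_less_trans less_asym set_upt)
  qed
  have entry: "lift_formula ?k p ts ! i = ts ! q i" if "i \<le> j" for i
    using that jk cross[OF that] by (simp add: lift_formula_def q_def)
  show ?thesis
  proof (rule code_mono[where i = j])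
    show "take j (lift_formula ?k p ts) = take j ts"
      using jk entry fixed by (intro nth_equalityI) (auto simp: lift_formula_def)
    have "(ts ! q j, ts ! j) \<in> r \<and> ts ! q j \<noteq> ts ! j"
      using sorted_wrt_nth_less[OF dec \<open>j < q j\<close> \<open>q j < ?k\<close>] .
    then show "rk (lift_formula ?k p ts ! j) < rk (ts ! j)"
      using entry[of j] rk_mono[of "ts ! q j" "ts ! j"] subsetD[OF refls nth_mem[OF jk]] by simp
  qed (use jk in \<open>auto simp: lift_formula_def\<close>)
qed

lemma rex_braid_lift:
  assumes "ts \<in> rex W x" "p permutes {..<length ts}"
  shows "braid_lift_action (length ts) p ts \<in> rex W x"
  by (rule braid_lift_action_closed[where P = "\<lambda>us. us \<in> rex W x", OF assms(1) _ assms(2)])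
    (use rex_hurwitz in auto)

lemma keys_beta: "ts \<in> rex W x \<Longrightarrow> Poly_Mapping.keys (beta ts) \<subseteq> rex W x"
proof -
  assume ts: "ts \<in> rex W x"
  have "braid_lift_action (length ts) p ts \<in> rex W x" if "p permutes {..<length ts}" for p
    by (rule rex_braid_lift[OF ts that])
  then have "beta ts \<in> carrier (free_Abelian_group (rex W x))"
    unfolding beta_def by (intro sum_closed_free_Abelian_group) auto
  then show ?thesis by simp
qed

text \<open>Every permutation other than the identity lowers the code, so nothing can cancel the
  identity term, whose sign is 1.\<close>

lemma lookup_beta:
  assumes ts: "ts \<in> decreasing_rex W r x"
  shows "Poly_Mapping.lookup (beta ts) ts = 1"
    and "y \<in> Poly_Mapping.keys (beta ts) \<Longrightarrow> y \<noteq> ts \<Longrightarrow> code y < code ts"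
proof -
  let ?k = "length ts"
  have refls: "set ts \<subseteq> reflections W" using ts by (auto simp: decreasing_rex_def rex_def)
  have bij: "bij t" if "t \<in> set ts" for t using that refls reflection_bij by blast
  have act: "braid_lift_action ?k p ts = lift_formula ?k p ts" if "p permutes {..<?k}" for p
    by (rule braid_lift_action_eq[OF refl bij that])
  have id: "braid_lift_action ?k id ts = ts"
    using act[OF permutes_id] lift_formula_id[of ts ?k] by simp
  have less: "code (braid_lift_action ?k p ts) < code ts" if "p permutes {..<?k}" "p \<noteq> id" for p
    using act[OF that(1)] code_lift_formula[OF ts that] by simp
  have lookup: "Poly_Mapping.lookup (beta ts) y =
      (\<Sum>p | p permutes {..<?k}. sign p * (if braid_lift_action ?k p ts = y then 1 else 0))" for y
    unfolding beta_def lookup_sum_frag by (intro sum.cong) auto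
  have "Poly_Mapping.lookup (beta ts) ts =
      (\<Sum>p | p permutes {..<?k}. if p = id then 1 else 0)"
    unfolding lookup
  proof (rule sum.cong[OF refl], goal_cases)
    case (1 p)
    then show ?case using less[of p] id by (cases "p = id") auto
  qed
  also have "\<dots> = 1" using finite_permutations[of "{..<?k}"] permutes_id[of "{..<?k}"] by simp
  finally show "Poly_Mapping.lookup (beta ts) ts = 1" .
  assume y: "y \<in> Poly_Mapping.keys (beta ts)" "y \<noteq> ts"
  have "\<exists>p. p permutes {..<?k} \<and> braid_lift_action ?k p ts = y"
  proof (rule ccontr)
    assume "\<not> ?thesis"
    then have "Poly_Mapping.lookup (beta ts) y = 0" unfolding lookup by (intro sum.neutral) auto
    then show False using y(1) by (simp add: in_keys_iff)
  qed
  then show "code y < code ts" using less id y(2) by metis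
qed

lemma beta_cycle:
  assumes ts: "ts \<in> rex W x"
  shows "simplicial_boundary (chain_map (beta ts)) = 0"
proof -
  let ?k = "length ts"
  let ?P = "{p. p permutes {..<?k}}"
  let ?f = "\<lambda>i p. frag_of (remove_at i (chain_of (butlast (braid_lift_action ?k p ts))))"
  have fin: "finite ?P" by (rule finite_permutations) simp
  have refls: "set ts \<subseteq> reflections W" using rexD[OF ts] by simp
  have rex: "braid_lift_action ?k p ts \<in> rex W x" if "p permutes {..<?k}" for p
    by (rule rex_braid_lift[OF ts that])
  have len: "length (braid_lift_action ?k p ts) = ?k" if "p permutes {..<?k}" for p
    using rexD(2)[OF rex[OF that]] rexD(2)[OF ts] by simp
  have "simplicial_boundary (chain_map (beta ts)) =
      (\<Sum>p\<in>?P. \<Sum>i<?k - 1. frag_cmul ((- 1) ^ i) (frag_cmul (sign p) (?f i p)))"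
    unfolding beta_def chain_map_sum[OF fin] simplicial_boundary_sum[OF fin]
    by (rule sum.cong[OF refl])
       (simp add: chain_map_cmul chain_map_frag_of simplicial_boundary_cmul simplicial_boundary_frag_of len
         frag_cmul_sum mult.commute)
  also have "\<dots> = (\<Sum>i<?k - 1. frag_cmul ((- 1) ^ i) (\<Sum>p\<in>?P. frag_cmul (sign p) (?f i p)))"
    by (subst sum.swap) (simp add: frag_cmul_sum)
  also have "\<dots> = 0"
  proof (rule sum.neutral, rule ballI)
    fix i assume "i \<in> {..<?k - 1}"
    then have i: "Suc i < ?k" by auto
    have P: "adj i \<circ> p permutes {..<?k}" if "p permutes {..<?k}" for p
      by (rule permutes_compose[OF that adj_permutes[OF i]])
    have inv: "adj i \<circ> (adj i \<circ> p) = p" for p by (simp add: comp_assoc[symmetric])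
    have h: "remove_at i (chain_of (butlast (hurwitz i y))) = remove_at i (chain_of (butlast y))"
      if y: "y \<in> rex W x" for y
    proof -
      have ly: "length y = ?k" using rexD(2)[OF y] rexD(2)[OF ts] by simp
      have "bij (y ! Suc i)" using rexD(1)[OF y] i ly by (intro reflection_bij) auto
      then show ?thesis
        using i ly by (intro remove_at_chain_eqI) (auto intro!: partial_prod_hurwitz)
    qed
    have f: "?f i (adj i \<circ> p) = ?f i p" if p: "p permutes {..<?k}" for p
    proof -
      have "bij t" if "t \<in> set ts" for t using that refls reflection_bij by blast
      from braid_lift_action_adj[OF refl this p i] show ?thesis
        using h[OF rex[OF p]] h[OF rex[OF P[OF p]]] by auto
    qed
    have sgn: "sign (adj i \<circ> p) = - sign p" if p: "p permutes {..<?k}" for p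
    proof -
      have "permutation p" using p by (auto simp: permutation_permutes)
      then show ?thesis by (simp add: sign_compose permutation_swap_id sign_swap_id)
    qed
    \<comment> \<open>Reindexing by the sign-reversing involution shows that the sum is its own
      negative; the integral chain group has no 2-torsion.\<close>
    have "(\<Sum>p\<in>?P. frag_cmul (sign p) (?f i p)) = (\<Sum>p\<in>?P. frag_cmul (sign (adj i \<circ> p)) (?f i (adj i \<circ> p)))"
      by (rule sum.reindex_bij_witness[of _ "\<lambda>p. adj i \<circ> p" "\<lambda>p. adj i \<circ> p"])
         (simp_all only: P inv mem_Collect_eq)
    also have "\<dots> = (\<Sum>p\<in>?P. - frag_cmul (sign p) (?f i p))"
      by (rule sum.cong[OF refl]) (simp add: f sgn)
    also have "\<dots> = - (\<Sum>p\<in>?P. frag_cmul (sign p) (?f i p))" by (rule sum_negf)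
    finally have "(\<Sum>p\<in>?P. frag_cmul (sign p) (?f i p)) = 0" by (rule frag_eq_neg_imp_0)
    then show "frag_cmul ((- 1) ^ i) (\<Sum>p\<in>?P. frag_cmul (sign p) (?f i p)) = 0" by simp
  qed
  finally show ?thesis .
qed

end

text \<open>Strict growth from a value at least 0 to the value \<open>k\<close> within
  \<open>k\<close> steps leaves no slack. It is applied to lengths along a maximal chain.\<close>

lemma strict_steps_eq:
  fixes f :: "nat \<Rightarrow> nat"
  assumes "f k = k" "\<And>i. i < k \<Longrightarrow> f i < f (Suc i)" "i \<le> k"
  shows "f i = i"
proof (rule antisym)
  have "f i + d \<le> f (i + d)" if "i + d \<le> k" for d
    using that
  proof (induction d)
    case (Suc d)
    then show ?case using assms(2)[of "i + d"] by simp
  qed simp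
  from this[of "k - i"] show "f i \<le> i" using assms(1,3) by simp
  have "j \<le> f j" if "j \<le> k" for j
    using that
  proof (induction j)
    case (Suc j)
    then show ?case using assms(2)[of j] by simp
  qed simp
  then show "i \<le> f i" using assms(3) .
qed

section \<open>Faces of chains and leading terms of cycles\<close>

context bipartite_reflection_group
begin

lemma rex_take:
  assumes "ts \<in> rex W x"
  shows "take j ts \<in> rex W (partial_prod j ts)"
  using rex_appendD(1)[of "take j ts" "drop j ts" x] assms by (simp add: partial_prod_def)

lemma abs_length_partial_prod:
  assumes "ts \<in> rex W x" "j \<le> length ts"
  shows "abs_length W (partial_prod j ts) = j"
  using rexD(2)[OF rex_take[OF assms(1), of j]] assms(2) by simp

lemma partial_prod_length: "ts \<in> rex W x \<Longrightarrow> partial_prod (length ts) ts = x"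
  using rexD(3) by (simp add: partial_prod_def)

lemma abs_le_partial_prod:
  assumes "ts \<in> rex W x" "i \<le> j"
  shows "abs_le W (partial_prod i ts) (partial_prod j ts)"
proof -
  have "take j ts = take i ts @ drop i (take j ts)"
    using assms(2) by (metis append_take_drop_id min.absorb1 take_take)
  then show ?thesis
    using abs_le_append[of "take i ts" "drop i (take j ts)"] rex_take[OF assms(1), of j]
    by (simp add: partial_prod_def)
qed

lemma abs_less_partial_prod:
  assumes "ts \<in> rex W x" "i < j" "j \<le> length ts"
  shows "abs_less W (partial_prod i ts) (partial_prod j ts)"
  using abs_le_partial_prod[OF assms(1), of i j] abs_length_partial_prod[OF assms(1), of i]
    abs_length_partial_prod[OF assms(1), of j] assms(2,3) by (auto simp: abs_less_def)

lemma nth_eq_of_partial_prod: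
  assumes xs: "xs \<in> rex W x" and ys: "ys \<in> rex W x" and j: "j < length xs"
    and eq: "partial_prod j xs = partial_prod j ys" "partial_prod (Suc j) xs = partial_prod (Suc j) ys"
  shows "xs ! j = ys ! j"
proof -
  have len: "length xs = length ys" using rexD(2)[OF xs] rexD(2)[OF ys] by simp
  have "bij (partial_prod j xs)"
    using prod_bij[OF rexD(1)[OF rex_take[OF xs, of j]]] by (simp add: partial_prod_def)
  moreover have "partial_prod j xs \<circ> xs ! j = partial_prod j xs \<circ> ys ! j"
    using eq partial_prod_Suc[of j xs] partial_prod_Suc[of j ys] j len by simp
  ultimately show ?thesis by (simp add: fun_eq_iff bij_is_inj inj_eq)
qed

text \<open>\<open>abs_length\<close> ranks the vertices, and the face lacks exactly one rank, which
  reveals the removed position. The end products \<open>id\<close> and \<open>x\<close> are not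
  vertices but are the same for both factorizations.\<close>

lemma remove_at_chain_eqD:
  assumes xs: "xs \<in> rex W x" and ys: "ys \<in> rex W x"
    and i: "i < length xs - 1" and i': "i' < length ys - 1"
    and eq: "remove_at i (chain_of (butlast xs)) = remove_at i' (chain_of (butlast ys))"
  shows "i' = i" and "j \<le> length xs \<Longrightarrow> j \<noteq> Suc i \<Longrightarrow> partial_prod j xs = partial_prod j ys"
proof -
  have len: "length xs = length ys" using rexD(2)[OF xs] rexD(2)[OF ys] by simp
  have entry: "(if j < i then partial_prod (Suc j) xs else partial_prod (Suc (Suc j)) xs) =
      (if j < i' then partial_prod (Suc j) ys else partial_prod (Suc (Suc j)) ys)"
    if "j < length xs - 1 - 1" for j
    using arg_cong[OF eq, of "\<lambda>l. l ! j"] that i i' len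
    by (simp add: nth_remove_at nth_chain_butlast split: if_splits)
  have al: "abs_length W (partial_prod j xs) = j" "abs_length W (partial_prod j ys) = j" if "j \<le> length xs" for j
    using abs_length_partial_prod[OF xs that] abs_length_partial_prod[OF ys, of j] that len by auto
  show ii: "i' = i"
  proof (rule ccontr)
    assume "i' \<noteq> i"
    then consider "i < i'" | "i' < i" by linarith
    then show False
    proof cases
      case 1
      then have "partial_prod (Suc (Suc i)) xs = partial_prod (Suc i) ys" using entry[of i] i' len by auto
      moreover have "Suc (Suc i) \<le> length xs" using 1 i' len by linarith
      ultimately show False using al(1)[of "Suc (Suc i)"] al(2)[of "Suc i"] by auto
    next
      case 2
      then have "partial_prod (Suc i') xs = partial_prod (Suc (Suc i')) ys" using entry[of i'] i len by auto
      moreover have "Suc (Suc i') \<le> length xs" using 2 i by linarith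
      ultimately show False using al(1)[of "Suc i'"] al(2)[of "Suc (Suc i')"] by auto
    qed
  qed
  assume j: "j \<le> length xs" "j \<noteq> Suc i"
  consider "j = 0" | "j = length xs" | "0 < j" "j < Suc i" | "Suc i < j" "j < length xs"
    using j by linarith
  then show "partial_prod j xs = partial_prod j ys"
  proof cases
    case 1
    then show ?thesis by (simp add: partial_prod_def)
  next
    case 2
    then show ?thesis using partial_prod_length[OF xs] partial_prod_length[OF ys] len by simp
  next
    case 3
    then have "Suc (j - 1) = j" "j - 1 < i" "j - 1 < length xs - 1 - 1" using i by auto
    then show ?thesis using entry[of "j - 1"] ii by simp
  next
    case 4
    then have "Suc (Suc (j - 2)) = j" "\<not> j - 2 < i" "j - 2 < length xs - 1 - 1" by auto
    then show ?thesis using entry[of "j - 2"] ii by simp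
  qed
qed

text \<open>A single tail, a reduced factorization of \<open>inv w \<circ> \<gamma>\<close>,
  completes all reduced factorizations of \<open>w\<close>, so that statements about
  \<open>\<gamma>\<close> can be applied to them.\<close>

lemma noncrossing_rex_append:
  assumes w: "w \<in> noncrossing W \<gamma>"
  obtains cs where "\<And>ts. ts \<in> rex W w \<Longrightarrow> ts @ cs \<in> rex W \<gamma>"
proof -
  have w': "w \<in> W" "abs_le W w \<gamma>" using w by (auto simp: noncrossing_def)
  have "\<gamma> \<in> W" using prod_reflect_in_W[of "as @ bs"] \<Delta>_subset by (simp add: \<gamma>_eq \<Delta>_def)
  then obtain cs where "cs \<in> rex W (inv w \<circ> \<gamma>)" using ex_rex inv_comp_in_W w' by blast
  then show thesis using that rex_appendI[OF w'(2)] by blast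
qed

text \<open>At an ascent the cycle condition provides another term of the cycle in the same rank two fibre,
  and the ascent is the smallest element of that fibre.\<close>

lemma top_term_decreasing:
  assumes w: "w \<in> noncrossing W \<gamma>"
    and c: "Poly_Mapping.keys c \<subseteq> rex W w" "simplicial_boundary (chain_map c) = 0"
    and x: "x \<in> Poly_Mapping.keys c" and max: "\<And>y. y \<in> Poly_Mapping.keys c \<Longrightarrow> code y \<le> code x"
  shows "x \<in> decreasing_rex W r w"
proof (rule ccontr)
  assume not: "x \<notin> decreasing_rex W r w"
  have xr: "x \<in> rex W w" using c(1) x by blast
  note rx = rexD[OF xr]
  have tr: "transp (\<lambda>s t. (t, s) \<in> r \<and> t \<noteq> s)"
    unfolding transp_def using r_trans r_antisym by blast
  have "\<not> sorted_wrt (\<lambda>s t. (t, s) \<in> r \<and> t \<noteq> s) x" using not xr by (simp add: decreasing_rex_def)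
  then obtain i where i: "Suc i < length x" "\<not> ((x ! Suc i, x ! i) \<in> r \<and> x ! Suc i \<noteq> x ! i)"
    using sorted_wrt_iff_nth_Suc_transp[OF tr, of x] by blast
  have split: "x = take i x @ x ! i # x ! Suc i # drop (Suc (Suc i)) x"
    using i(1) by (metis Cons_nth_drop_Suc Suc_lessD append_take_drop_id)
  have mem: "x ! i \<in> reflections W" "x ! Suc i \<in> reflections W" using rx(1) i(1) by auto
  \<comment> \<open>Equal neighbours would cancel, whereas a segment of a reduced factorization is
    reduced.\<close>
  have ne: "x ! i \<noteq> x ! Suc i"
  proof
    assume eq: "x ! i = x ! Suc i"
    have "[x ! i, x ! Suc i] \<in> rex W (x ! i \<circ> x ! Suc i)"
    proof -
      have "take i x @ [x ! i, x ! Suc i] @ drop (Suc (Suc i)) x \<in> rex W w" using xr split by simp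
      from rex_appendD(1)[OF rex_appendD(2)[OF this]] show ?thesis by simp
    qed
    then have "abs_length W (x ! i \<circ> x ! Suc i) = 2" using rexD(2) by fastforce
    then show False using abs_length_id reflection_involution[OF mem(1)] eq by simp
  qed
  then have asc: "(x ! i, x ! Suc i) \<in> r" using i(2) r_total[OF mem] by auto
  have i': "i < length x - 1" using i(1) by simp
  let ?u = "remove_at i (chain_of (butlast x))"
  have len: "length y = length x" if "y \<in> Poly_Mapping.keys c" for y
    using rexD(2)[of y w] c(1) that rx(2) by auto
  \<comment> \<open>The face \<open>?u\<close> determines the removed index \<open>i\<close>. If
    only \<open>x\<close> had this face, its coefficient in the boundary would be that of
    \<open>x\<close> up to sign, hence nonzero.\<close>
  have "\<exists>y\<in>Poly_Mapping.keys c. y \<noteq> x \<and> remove_at i (chain_of (butlast y)) = ?u"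
  proof (rule ccontr)
    assume no: "\<not> ?thesis"
    have coeff: "Poly_Mapping.lookup
        (\<Sum>j<length y - 1. frag_cmul ((- 1) ^ j) (frag_of (remove_at j (chain_of (butlast y))))) ?u =
        (if y = x then (- 1) ^ i else 0)" if y: "y \<in> Poly_Mapping.keys c" for y
    proof -
      have yr: "y \<in> rex W w" using c(1) y by blast
      have "((- 1) ^ j * Poly_Mapping.lookup (frag_of (remove_at j (chain_of (butlast y)))) ?u :: int) =
          (if j = i then if y = x then (- 1) ^ i else 0 else 0)" if "j < length y - 1" for j
      proof (cases "remove_at j (chain_of (butlast y)) = ?u")
        case True
        then have "j = i" using remove_at_chain_eqD(1)[OF xr yr i' that True[symmetric]] by simp
        then show ?thesis using no True y by (cases "y = x") auto
      next
        case False
        then show ?thesis by auto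
      qed
      then have "Poly_Mapping.lookup
          (\<Sum>j<length y - 1. frag_cmul ((- 1) ^ j) (frag_of (remove_at j (chain_of (butlast y))))) ?u =
          (\<Sum>j<length y - 1. if j = i then if y = x then (- 1) ^ i else 0 else 0)"
        unfolding lookup_sum_frag lookup_frag_cmul by (intro sum.cong) auto
      also have "\<dots> = (if y = x then (- 1) ^ i else 0)"
        using i' len[OF y] by simp
      finally show ?thesis .
    qed
    have "0 = Poly_Mapping.lookup (simplicial_boundary (chain_map c)) ?u" using c(2) by simp
    also have "\<dots> = (\<Sum>y\<in>Poly_Mapping.keys c. Poly_Mapping.lookup c y * (if y = x then (- 1) ^ i else 0))"
      unfolding simplicial_boundary_chain_map lookup_frag_extend using coeff by (intro sum.cong) auto
    also have "\<dots> = Poly_Mapping.lookup c x * (- 1) ^ i"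
      using x by (simp add: if_distrib cong: if_cong)
    finally have "Poly_Mapping.lookup c x = 0" by simp
    then show False using x by (simp add: in_keys_iff)
  qed
  then obtain y where y: "y \<in> Poly_Mapping.keys c" "y \<noteq> x" "remove_at i (chain_of (butlast y)) = ?u" by blast
  have yr: "y \<in> rex W w" using c(1) y by blast
  note ry = rexD[OF yr]
  have pp: "partial_prod j x = partial_prod j y" if "j \<le> length x" "j \<noteq> Suc i" for j
    using remove_at_chain_eqD(2)[OF xr yr i' _ y(3)[symmetric] that] i' len[OF y(1)] by simp
  have nth: "x ! j = y ! j" if "j < length x" "j \<noteq> i" "j \<noteq> Suc i" for j
    using nth_eq_of_partial_prod[OF xr yr that(1)] pp that by simp
  have eq: "y ! i \<circ> y ! Suc i = x ! i \<circ> x ! Suc i"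
  proof -
    have "partial_prod i x \<circ> (x ! i \<circ> x ! Suc i) = partial_prod (Suc (Suc i)) x"
      using i(1) by (simp add: partial_prod_Suc comp_assoc)
    also have "\<dots> = partial_prod (Suc (Suc i)) y" using pp i(1) by simp
    also have "\<dots> = partial_prod i x \<circ> (y ! i \<circ> y ! Suc i)"
      using i(1) len[OF y(1)] pp[of i] by (simp add: partial_prod_Suc comp_assoc)
    finally have "partial_prod i x \<circ> (y ! i \<circ> y ! Suc i) = partial_prod i x \<circ> (x ! i \<circ> x ! Suc i)" by simp
    moreover have "inj (partial_prod i x)"
      using prod_bij[OF rexD(1)[OF rex_take[OF xr, of i]]] by (simp add: partial_prod_def bij_is_inj)
    ultimately show ?thesis by (simp add: fun_eq_iff inj_eq)
  qed
  have memy: "y ! i \<in> reflections W" "y ! Suc i \<in> reflections W" using ry(1) i(1) len[OF y(1)] by auto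
  obtain cs where cs: "x @ cs \<in> rex W \<gamma>" using noncrossing_rex_append[OF w] xr by blast
  have full: "take i x @ x ! i # x ! Suc i # (drop (Suc (Suc i)) x @ cs) = x @ cs"
    using split by (metis append_Cons append_assoc)
  have "(x ! i, y ! i) \<in> r"
  proof (rule ascent_minimal[OF _ _ _ asc ne memy eq])
    show "set (take i x @ x ! i # x ! Suc i # (drop (Suc (Suc i)) x @ cs)) \<subseteq> reflections W"
      unfolding full by (rule rexD(1)[OF cs])
    show "prod_of (take i x @ x ! i # x ! Suc i # (drop (Suc (Suc i)) x @ cs)) = \<gamma>"
      unfolding full by (rule rexD(3)[OF cs])
    show "length (take i x @ x ! i # x ! Suc i # (drop (Suc (Suc i)) x @ cs)) \<le> DIM('a)"
      unfolding full using rexD(2)[OF cs] abs_length_\<gamma> by simp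
  qed
  moreover have "x ! i \<noteq> y ! i"
  proof
    assume *: "x ! i = y ! i"
    have "bij (x ! i)" using mem reflection_bij by blast
    then have "x ! Suc i = y ! Suc i" using eq * by (simp add: fun_eq_iff bij_is_inj inj_eq)
    then have "x = y" using nth * len[OF y(1)] by (intro nth_equalityI) (metis, metis)
    then show False using y(2) by simp
  qed
  ultimately have "rk (x ! i) < rk (y ! i)" using rk_mono memy by blast
  moreover have "take i x = take i y"
    using nth i(1) len[OF y(1)] by (intro nth_equalityI) auto
  ultimately have "code x < code y" using code_mono[of x y i] i(1) len[OF y(1)] by simp
  then show False using max[OF y(1)] by simp
qed

text \<open>Cycles pulled back to combinations of factorizations. For \<open>w = id\<close> the
  empty list goes to the empty simplex, whose boundary is zero, so everything is a cycle and the
  basis statement covers this case too.\<close>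

definition cycles :: "('a \<Rightarrow> 'a) \<Rightarrow> (('a \<Rightarrow> 'a) list \<Rightarrow>\<^sub>0 int) set" where
  "cycles w = {c. Poly_Mapping.keys c \<subseteq> rex W w \<and> simplicial_boundary (chain_map c) = 0}"

lemma cycles_zero: "0 \<in> cycles w"
  by (simp add: cycles_def chain_map_def simplicial_boundary_def)

lemma cycles_diff: "x \<in> cycles w \<Longrightarrow> y \<in> cycles w \<Longrightarrow> x - y \<in> cycles w"
  using keys_diff[of x y] by (auto simp: cycles_def chain_map_diff simplicial_boundary_diff)

lemma beta_mem_cycles: "ts \<in> rex W w \<Longrightarrow> beta ts \<in> cycles w"
  using keys_beta beta_cycle by (auto simp: cycles_def)

theorem int_basis_beta:
  assumes "w \<in> noncrossing W \<gamma>"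
  shows "int_basis (decreasing_rex W r w) beta (cycles w)"
proof (rule int_basis_triangular[where wt = code])
  show "0 \<in> cycles w" by (rule cycles_zero)
  show "x - y \<in> cycles w" if "x \<in> cycles w" "y \<in> cycles w" for x y using that by (rule cycles_diff)
  show "beta ts \<in> cycles w" if "ts \<in> decreasing_rex W r w" for ts
    using that beta_mem_cycles by (simp add: decreasing_rex_def)
  show "Poly_Mapping.lookup (beta ts) ts = 1" if "ts \<in> decreasing_rex W r w" for ts
    using that by (rule lookup_beta)
  show "code y < code ts" if "ts \<in> decreasing_rex W r w" "y \<in> Poly_Mapping.keys (beta ts)" "y \<noteq> ts" for ts y
    using that by (rule lookup_beta(2))
  show "x \<in> decreasing_rex W r w"
    if "c \<in> cycles w" "x \<in> Poly_Mapping.keys c" "\<And>y. y \<in> Poly_Mapping.keys c \<Longrightarrow> code y \<le> code x" for c x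
    by (rule top_term_decreasing[OF assms]) (use that in \<open>auto simp: cycles_def\<close>)
qed

text \<open>All \<open>beta\<close> are cycles and the decreasing ones already form a basis of the
  cycles. The group generated by the \<open>beta\<close> and the group that maps onto homology are
  therefore one and the same.\<close>

lemma carrier_beta_group:
  assumes "w \<in> noncrossing W \<gamma>"
  shows "carrier (beta_group W w) = cycles w"
  unfolding beta_group_def
proof (rule carrier_subgroup_generated_basis[OF _ _ _ _ _ int_basis_beta[OF assms]])
  show "x - y \<in> cycles w" if "x \<in> cycles w" "y \<in> cycles w" for x y using that by (rule cycles_diff)
  show "beta ` rex W w \<subseteq> cycles w" using beta_mem_cycles by blast
  show "beta ` decreasing_rex W r w \<subseteq> beta ` rex W w" by (auto simp: decreasing_rex_def)
  show "cycles w \<subseteq> {c. Poly_Mapping.keys c \<subseteq> rex W w}" by (auto simp: cycles_def)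
qed (rule cycles_zero)

section \<open>Maximal chains and top homology\<close>

lemma abs_le_imp_reflection:
  assumes "u \<in> W" "v \<in> W" "abs_le W u v" "abs_length W v = Suc (abs_length W u)"
  shows "inv u \<circ> v \<in> reflections W"
proof -
  obtain ts where ts: "ts \<in> rex W (inv u \<circ> v)" using ex_rex inv_comp_in_W assms(1,2) by blast
  have "length ts = 1" using rexD(2)[OF ts] assms(3,4) by (simp add: abs_le_def)
  then obtain t where "ts = [t]" by (auto simp: length_Suc_conv)
  then show ?thesis using rexD(1,3)[OF ts] by simp
qed

text \<open>With \<open>id\<close> and \<open>w\<close> added, the simplex makes \<open>k\<close>
  strict steps from length 0 to length \<open>k\<close>. Each step raises the length by one and is
  therefore multiplication by a reflection; these are the factors.\<close>

lemma chain_of_maximal: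
  assumes w: "w \<in> W" and k: "abs_length W w = k" "1 \<le> k"
    and us: "us \<in> order_simplices (abs_less W) (open_interval W \<gamma> w) (k - 1)"
  shows "\<exists>ts\<in>rex W w. chain_of (butlast ts) = us"
proof -
  have us': "length us = k - 1" "sorted_wrt (abs_less W) us"
    "\<And>u. u \<in> set us \<Longrightarrow> u \<in> W \<and> abs_less W id u \<and> abs_less W u w"
    using us by (auto simp: order_simplices_def open_interval_def noncrossing_def)
  define vs where "vs = id # us @ [w]"
  have lvs: "length vs = Suc k" using us'(1) k by (simp add: vs_def)
  have vsW: "vs ! i \<in> W" if "i \<le> k" for i
  proof -
    have "set vs \<subseteq> W" using us'(3) id_in_W w by (auto simp: vs_def)
    then show ?thesis using that lvs nth_mem[of i vs] by auto
  qed
  have vsk: "vs ! k = w" and vs0: "vs ! 0 = id" using us'(1) k by (auto simp: vs_def nth_append nth_Cons')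
  have step: "abs_less W (vs ! i) (vs ! Suc i)" if "i < k" for i
  proof -
    have idw: "abs_less W id w" using k abs_length_id by (auto simp: abs_less_def abs_le_def)
    consider "i = 0" "k = 1" | "i = 0" "k > 1" | "i > 0" "i = k - 1" | "i > 0" "i < k - 1" using \<open>i < k\<close> by linarith
    then show ?thesis
    proof cases
      case 1
      then show ?thesis using us'(1) idw by (simp add: vs_def)
    next
      case 2
      then have "us ! 0 \<in> set us" using us'(1) by simp
      then show ?thesis using us'(1,3) 2 by (simp add: vs_def nth_append)
    next
      case 3
      then have "us ! (i - 1) \<in> set us" using us'(1) by simp
      then show ?thesis using us'(1,3) 3 by (simp add: vs_def nth_append nth_Cons')
    next
      case 4
      then have "abs_less W (us ! (i - 1)) (us ! i)" using us'(1) by (intro sorted_wrt_nth_less[OF us'(2)]) auto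
      moreover have "i - 1 < length us" "i < length us" using us'(1) 4 by auto
      ultimately show ?thesis using 4 by (simp add: vs_def nth_append nth_Cons')
    qed
  qed
  have al: "abs_length W (vs ! i) = i" if "i \<le> k" for i
  proof (rule strict_steps_eq[OF _ _ that])
    show "abs_length W (vs ! k) = k" using vsk k by simp
    show "abs_length W (vs ! j) < abs_length W (vs ! Suc j)" if "j < k" for j
      using that vsW by (intro abs_less_imp_length_less[OF W] step) auto
  qed
  define t where "t i = inv (vs ! i) \<circ> vs ! Suc i" for i
  define ts where "ts = map t [0..<k]"
  have "t i \<in> reflections W" if "i < k" for i
    unfolding t_def using that vsW al step by (intro abs_le_imp_reflection) (auto simp: abs_less_def)
  then have refls: "set ts \<subseteq> reflections W" by (auto simp: ts_def)
  have pp: "partial_prod i ts = vs ! i" if "i \<le> k" for i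
    using that
  proof (induction i)
    case 0
    then show ?case using vs0 by (simp add: partial_prod_def)
  next
    case (Suc i)
    have "set (take i ts) \<subseteq> reflections W" using refls by (meson order_trans set_take_subset)
    then have "bij (vs ! i)" using Suc prod_bij[of "take i ts"] by (simp add: partial_prod_def)
    have "partial_prod (Suc i) ts = vs ! i \<circ> t i" using Suc by (simp add: partial_prod_Suc ts_def)
    also have "\<dots> = vs ! Suc i"
      using \<open>bij (vs ! i)\<close> by (simp add: t_def fun_eq_iff bij_is_surj surj_f_inv_f)
    finally show ?case .
  qed
  have "prod_of ts = w" using pp[of k] vsk by (simp add: partial_prod_def ts_def)
  then have "ts \<in> rex W w" using refls k by (simp add: rex_def ts_def)
  moreover have "chain_of (butlast ts) = us"
  proof (rule nth_equalityI)
    show "length (chain_of (butlast ts)) = length us" using us'(1) by (simp add: ts_def)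
    fix j assume "j < length (chain_of (butlast ts))"
    then have j: "j < length ts - 1" "j < k - 1" by (auto simp: ts_def)
    then show "chain_of (butlast ts) ! j = us ! j"
      using pp[of "Suc j"] us'(1) by (simp add: nth_chain_butlast vs_def nth_append)
  qed
  ultimately show ?thesis by blast
qed

lemma chain_of_mem_order_simplices:
  assumes w: "w \<in> noncrossing W \<gamma>" and ts: "ts \<in> rex W w"
  shows "chain_of (butlast ts) \<in> order_simplices (abs_less W) (open_interval W \<gamma> w) (abs_length W w - 1)"
proof -
  have len: "length ts = abs_length W w" using rexD(2)[OF ts] .
  obtain cs where cs: "ts @ cs \<in> rex W \<gamma>" using noncrossing_rex_append[OF w] ts by blast
  have mem: "partial_prod (Suc j) ts \<in> open_interval W \<gamma> w" if "j < length ts - 1" for j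
  proof -
    have "partial_prod (Suc j) ts \<in> W" using rexD(4)[OF rex_take[OF ts]] .
    moreover have "abs_le W (partial_prod (Suc j) ts) \<gamma>"
      using abs_le_append[of "take (Suc j) ts" "drop (Suc j) ts @ cs" \<gamma>] cs
      by (simp add: partial_prod_def append_assoc[symmetric] del: append_assoc)
    moreover have "abs_less W id (partial_prod (Suc j) ts)"
      using abs_less_partial_prod[OF ts, of 0 "Suc j"] that by (simp add: partial_prod_def)
    moreover have "abs_less W (partial_prod (Suc j) ts) w"
      using abs_less_partial_prod[OF ts, of "Suc j" "length ts"] that partial_prod_length[OF ts] by simp
    ultimately show ?thesis by (simp add: open_interval_def noncrossing_def)
  qed
  have "set (chain_of (butlast ts)) \<subseteq> open_interval W \<gamma> w"
  proof
    fix u assume "u \<in> set (chain_of (butlast ts))"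
    then obtain j where "j < length ts - 1" "u = chain_of (butlast ts) ! j" by (auto simp: in_set_conv_nth)
    then show "u \<in> open_interval W \<gamma> w" using mem by (simp add: nth_chain_butlast)
  qed
  moreover have "sorted_wrt (abs_less W) (chain_of (butlast ts))"
    unfolding sorted_wrt_iff_nth_less
    using abs_less_partial_prod[OF ts] by (auto simp: nth_chain_butlast)
  ultimately show ?thesis by (simp add: order_simplices_def len)
qed

text \<open>The chain lists all partial products except the first and the last, which are
  \<open>id\<close> and \<open>w\<close>; successive partial products determine the factors.\<close>

lemma bij_betw_chain_of:
  assumes w: "w \<in> noncrossing W \<gamma>" and k: "1 \<le> abs_length W w"
  shows "bij_betw (\<lambda>ts. chain_of (butlast ts)) (rex W w)
    (order_simplices (abs_less W) (open_interval W \<gamma> w) (abs_length W w - 1))"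
  unfolding bij_betw_def
proof
  show "inj_on (\<lambda>ts. chain_of (butlast ts)) (rex W w)"
  proof (rule inj_onI)
    fix xs ys assume xs: "xs \<in> rex W w" and ys: "ys \<in> rex W w" and eq: "chain_of (butlast xs) = chain_of (butlast ys)"
    have len: "length xs = length ys" using rexD(2)[OF xs] rexD(2)[OF ys] by simp
    have pp: "partial_prod j xs = partial_prod j ys" if "j \<le> length xs" for j
    proof -
      consider "j = 0" | "j = length xs" | "0 < j" "j < length xs"
        using \<open>j \<le> length xs\<close> by linarith
      then show ?thesis
      proof cases
        case 1
        then show ?thesis by (simp add: partial_prod_def)
      next
        case 2
        then show ?thesis using partial_prod_length[OF xs] partial_prod_length[OF ys] len by simp
      next
        case 3
        then obtain i where "j = Suc i" "i < length xs - 1" by (cases j) auto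
        then show ?thesis using arg_cong[OF eq, of "\<lambda>l. l ! i"] len by (simp add: nth_chain_butlast)
      qed
    qed
    show "xs = ys"
      by (rule nth_equalityI[OF len]) (use nth_eq_of_partial_prod[OF xs ys] pp in simp)
  qed
  show "(\<lambda>ts. chain_of (butlast ts)) ` rex W w =
    order_simplices (abs_less W) (open_interval W \<gamma> w) (abs_length W w - 1)"
    using chain_of_mem_order_simplices[OF w] chain_of_maximal[OF _ refl k] w
    by (auto simp: noncrossing_def image_iff)
qed

lemma carrier_top_homology:
  "carrier (top_homology W \<gamma> w) =
    reduced_cycles (abs_less W) (open_interval W \<gamma> w) (abs_length W w - 1)"
  unfolding top_homology_def Let_def
proof (rule carrier_subgroup_generated_frag)
  let ?Z = "reduced_cycles (abs_less W) (open_interval W \<gamma> w) (abs_length W w - 1)"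
  show "?Z \<subseteq> {c. Poly_Mapping.keys c \<subseteq> order_simplices (abs_less W) (open_interval W \<gamma> w) (abs_length W w - 1)}"
    by (auto simp: reduced_cycles_def)
  show "0 \<in> ?Z" by (simp add: reduced_cycles_def simplicial_boundary_def)
  show "x - y \<in> ?Z" if "x \<in> ?Z" "y \<in> ?Z" for x y
    using that keys_diff[of x y] by (auto simp: reduced_cycles_def simplicial_boundary_diff)
qed

lemma bij_betw_chain_map_cycles:
  assumes "w \<in> noncrossing W \<gamma>" "1 \<le> abs_length W w"
  shows "bij_betw chain_map (cycles w) (carrier (top_homology W \<gamma> w))"
proof -
  let ?S = "order_simplices (abs_less W) (open_interval W \<gamma> w) (abs_length W w - 1)"
  have b: "bij_betw chain_map {c. Poly_Mapping.keys c \<subseteq> rex W w} {c. Poly_Mapping.keys c \<subseteq> ?S}"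
    unfolding chain_map_def by (rule bij_betw_frag_extend[OF bij_betw_chain_of[OF assms]])
  have "chain_map ` cycles w = carrier (top_homology W \<gamma> w)"
    unfolding carrier_top_homology
  proof (intro equalityI subsetI)
    fix z assume "z \<in> chain_map ` cycles w"
    then show "z \<in> reduced_cycles (abs_less W) (open_interval W \<gamma> w) (abs_length W w - 1)"
      using bij_betwE[OF b] by (auto simp: cycles_def reduced_cycles_def)
  next
    fix z assume z: "z \<in> reduced_cycles (abs_less W) (open_interval W \<gamma> w) (abs_length W w - 1)"
    then have "z \<in> {c. Poly_Mapping.keys c \<subseteq> ?S}" by (simp add: reduced_cycles_def)
    then have "z \<in> chain_map ` {c. Poly_Mapping.keys c \<subseteq> rex W w}" using bij_betw_imp_surj_on[OF b] by simp
    then show "z \<in> chain_map ` cycles w" using z by (auto simp: cycles_def reduced_cycles_def)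
  qed
  moreover have "inj_on chain_map (cycles w)"
    by (rule inj_on_subset[OF bij_betw_imp_inj_on[OF b]]) (auto simp: cycles_def)
  ultimately show ?thesis by (simp add: bij_betw_def)
qed

end

theorem theorem4p5:
  fixes W :: "('a::euclidean_space \<Rightarrow> 'a) set"
    and \<Phi> :: "'a set"
    and as bs :: "'a list"
    and r :: "(('a \<Rightarrow> 'a) \<times> ('a \<Rightarrow> 'a)) set"
    and \<gamma> w :: "'a \<Rightarrow> 'a"
  assumes "finite_reflection_group W"
    and "root_system_of W \<Phi>"
    and "simple_system \<Phi> (set as \<union> set bs)"
    and "card (set as \<union> set bs) = DIM('a)"
    and "distinct (as @ bs)"
    and "pairwise orthogonal (set as)"
    and "pairwise orthogonal (set bs)"
    and "\<gamma> = coxeter_element as bs"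
    and "admissible_order W as bs r"
    and "w \<in> noncrossing W \<gamma>"
  shows "int_basis (decreasing_rex W r w) beta (carrier (beta_group W w)) \<and>
    (abs_length W w \<ge> 1 \<longrightarrow>
       int_basis (decreasing_rex W r w) (\<lambda>ts. as_chains (zeta ts))
         (carrier (top_homology W \<gamma> w))) \<and>
    (abs_length W w \<ge> 1 \<longrightarrow>
       (\<lambda>c. as_chains (truncation c)) \<in> iso (beta_group W w) (top_homology W \<gamma> w) \<and>
       (\<forall>ts \<in> rex W w. as_chains (truncation (beta ts)) = as_chains (zeta ts)))"
proof -
  interpret bipartite_reflection_group W \<Phi> as bs r \<gamma>
    using assms(1-9) by (rule bipartite_reflection_group.intro)
  note w = assms(10)
  note basis = int_basis_beta[OF w]
  have "int_basis (decreasing_rex W r w) (\<lambda>ts. as_chains (zeta ts)) (carrier (top_homology W \<gamma> w))"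
    if k: "abs_length W w \<ge> 1"
  proof -
    \<comment> \<open>By linearity \<open>chain_map\<close> passes inside
      \<open>frag_extend\<close>, so the second basis is the first one transported along the
      bijection between cycles and homology.\<close>
    have eq: "frag_extend (\<lambda>ts. as_chains (zeta ts)) = chain_map \<circ> frag_extend beta"
      by (simp add: fun_eq_iff zeta_def as_chains_truncation chain_map_frag_extend)
    show ?thesis
      unfolding int_basis_def eq
      by (rule bij_betw_trans[OF basis[unfolded int_basis_def] bij_betw_chain_map_cycles[OF w k]])
  qed
  moreover have "(\<lambda>c. as_chains (truncation c)) \<in> iso (beta_group W w) (top_homology W \<gamma> w)"
    if k: "abs_length W w \<ge> 1"
  proof -
    have bij: "bij_betw chain_map (carrier (beta_group W w)) (carrier (top_homology W \<gamma> w))"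
      using bij_betw_chain_map_cycles[OF w k] by (simp only: carrier_beta_group[OF w])
    \<comment> \<open>Both groups inherit their addition from free abelian groups, so additivity of
      \<open>chain_map\<close> is the homomorphism property.\<close>
    then have "chain_map \<in> iso (beta_group W w) (top_homology W \<gamma> w)"
      using bij_betwE[OF bij]
      by (auto simp: iso_def hom_def beta_group_def top_homology_def Let_def chain_map_add)
    then show ?thesis by (simp add: as_chains_truncation[abs_def])
  qed
  ultimately show ?thesis using basis carrier_beta_group[OF w] by (simp add: zeta_def)
qed

end
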